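(* Let $w\equiv a\pmod 6$ with $a\in\{0,2,4\}$, let $\lambda$ be an integer with $\frac{w-a}{12}\le\lambda\le\frac{w-a}{6}$, and let $$f(z)=q^\lambda\sum_{n=0}^\infty a(n)q^n,\qquad a(0)\ne0 .$$ (i) Case $a=0$: if $f$ is a solution of $$\partial_{w-1}^2f-\frac{(12\lambda-w-1)(12\lambda-w+1)}{144}E_4f=0,$$ then $f$ is a balanced quasimodular form of weight $w$ and depth $1$ if $\lambda>\frac w{12}$. If $\lambda=\frac w{12}$, the functions $\Delta^{w/12}$ and $z\Delta^{w/12}$ form a fundamental system of this equation. (ii) Case $a=2$: if $f$ is a solution of $$E_4\partial_{w-1}^2f+\frac13E_6\partial_{w-1}f-\frac{(12\lambda-w+1)(12\lambda-w+3)}{144}E_4^2f=0,$$ then $f$ is a balanced quasimodular form of weight $w$ and depth $1$ if $\lambda>\frac{w-2}{12}$. If $\lambda=\frac{w-2}{12}$, the functions $E_2\Delta^{\frac{w-2}{12}}$ and $zE_2\Delta^{\frac{w-2}{12}}+\frac{6}{\pi i}\Delta^{\frac{w-2}{12}}$ form a fundamental system of this equation. (iii) Case $a=4$: if $f$ is a solution of $$E_4^2\partial_{w-1}^2f+\frac23E_4E_6\partial_{w-1}f-\left(\left(\frac{(12\lambda-w+3)(12\lambda-w+5)}{144}-\frac1{18}\right)E_4^3+384\Delta\right)f=0,$$ then $f$ is a balanced quasimodular form of weight $w$ and depth $1$ if $\lambda>\frac{w-4}{12}$. If $\lambda=\frac{w-4}{12}$, the functions $E_4\Delta^{\frac{w-4}{12}}$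 and $zE_4\Delta^{\frac{w-4}{12}}$ form a fundamental system of this equation.
   Context: $\mathcal{M}_k$ denotes the space of holomorphic modular forms of weight $k$ for $\mathrm{PSL}(2,\mathbb{Z})$ (holomorphic also at $i\infty$); $q=e^{2\pi iz}$; $E_{2k}=1-\frac{4k}{B_{2k}}\sum_{n\ge1}\sigma_{2k-1}(n)q^n$ ($k\ge1$); $\Delta=\frac1{1728}(E_4^3-E_6^2)$. $f'=\frac1{2\pi i}\frac{df}{dz}$; the Serre derivative is $\partial_k f=f'-\frac{k}{12}E_2f$, iterated as $\partial_k^0f=f$, $\partial_k^{j+1}f=\partial_{k+2j}(\partial_k^jf)$. Quasimodular forms of weight $w$ and depth $\le r$ are the elements of $\mathcal{QM}_w^r=\bigoplus_{\ell=0}^rE_2^\ell\mathcal{M}_{w-2\ell}$. A quasimodular form $f=h_0+E_2h_1$ ($h_0\in\mathcal{M}_w$, $h_1\in\mathcal{M}_{w-2}$, $h_1\ne0$) of weight $w$ and depth $1$ is called balanced if, with $g_0=f$ and $g_1=\frac{6}{\pi i}h_1$ (so that $z^{-w}f(-1/z)=g_0(z)+z^{-1}g_1(z)$), there are integers $\lambda_0\ge\lambda_1\ge0$ with $\lambda_0<\dim\mathcal{QM}_w^1$, $\lambda_1<\dim\mathcal{M}_{w-2}$, such that $g_0$ and $g_1$ have vanishing orders at $i\infty$ (in $q$) exactly $\lambda_0$ and $\lambda_1$, respectively, and $\lambda_0+\lambda_1=\dim\mathcal{QM}_w^1-1$. A fundamental system is a basis of the space of holomorphic solutions on the upper half plane.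 *)

theory Defs
  imports
    "HOL-Complex_Analysis.Complex_Analysis"
    "HOL-Library.Function_Algebras"
    "HOL-Number_Theory.Cong"
begin

definition uhp :: "complex set" where
  "uhp = {z. Im z > 0}"

definition qpar :: "complex \<Rightarrow> complex" where
  "qpar z = exp (2 * of_real pi * \<i> * z)"

text \<open>
  Functions on the upper half plane are represented by total functions on the complex numbers.
  Where a set of such functions is treated as a vector space, its elements are required to vanish
  outside the upper half plane, so that equality of elements (and hence dimension and linear
  independence) refers to the values on the upper half plane only.
\<close>

definition restrict_uhp :: "(complex \<Rightarrow> complex) \<Rightarrow> complex \<Rightarrow> complex" where
  "restrict_uhp f = (\<lambda>z. if z \<in> uhp then f z else 0)"

definition scale_fun :: "complex \<Rightarrow> (complex \<Rightarrow> complex) \<Rightarrow> complex \<Rightarrow> complex" where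
  "scale_fun c f = (\<lambda>z. c * f z)"

interpretation fun_space: vector_space scale_fun
  by unfold_locales (auto simp: scale_fun_def fun_eq_iff algebra_simps)

definition q_expansion :: "int \<Rightarrow> (nat \<Rightarrow> complex) \<Rightarrow> (complex \<Rightarrow> complex) \<Rightarrow> bool" where
  "q_expansion l c f \<longleftrightarrow>
     (\<forall>z\<in>uhp. summable (\<lambda>n. c n * qpar z ^ n) \<and> f z = qpar z powi l * (\<Sum>n. c n * qpar z ^ n))"

definition vanishing_order_at_cusp :: "(complex \<Rightarrow> complex) \<Rightarrow> int \<Rightarrow> bool" where
  "vanishing_order_at_cusp f l \<longleftrightarrow> (\<exists>c. c 0 \<noteq> 0 \<and> q_expansion l c f)"

definition modular_forms :: "int \<Rightarrow> (complex \<Rightarrow> complex) set" where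
  "modular_forms k = {f.
     f holomorphic_on uhp \<and>
     (\<forall>a b c d :: int. a * d - b * c = 1 \<longrightarrow>
        (\<forall>z\<in>uhp. f ((of_int a * z + of_int b) / (of_int c * z + of_int d))
                   = (of_int c * z + of_int d) powi k * f z)) \<and>
     (\<exists>c. q_expansion 0 c f) \<and>
     (\<forall>z. z \<notin> uhp \<longrightarrow> f z = 0)}"

text \<open>The Bernoulli numbers, with the convention $B_1 = -1/2$.\<close>

fun bernoulli_number :: "nat \<Rightarrow> complex" where
  "bernoulli_number 0 = 1"
| "bernoulli_number (Suc n) =
     - (\<Sum>k\<le>n. of_nat ((n + 2) choose k) * bernoulli_number k) / of_nat (n + 2)"

definition divisor_power_sum :: "nat \<Rightarrow> nat \<Rightarrow> nat" where
  "divisor_power_sum m n = (\<Sum>d | d dvd n. d ^ m)"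

text \<open>\<open>eisenstein k\<close> has weight \<open>2 * k\<close>, i.e. it is $E_{2k}$.\<close>

definition eisenstein :: "nat \<Rightarrow> complex \<Rightarrow> complex" where
  "eisenstein k z = 1 - 4 * of_nat k / bernoulli_number (2 * k) *
     (\<Sum>n. of_nat (divisor_power_sum (2 * k - 1) (Suc n)) * qpar z ^ Suc n)"

abbreviation E2 :: "complex \<Rightarrow> complex" where "E2 \<equiv> eisenstein 1"
abbreviation E4 :: "complex \<Rightarrow> complex" where "E4 \<equiv> eisenstein 2"
abbreviation E6 :: "complex \<Rightarrow> complex" where "E6 \<equiv> eisenstein 3"

definition modular_discriminant :: "complex \<Rightarrow> complex" where
  "modular_discriminant z = (E4 z ^ 3 - E6 z ^ 2) / 1728"

definition normalized_deriv :: "(complex \<Rightarrow> complex) \<Rightarrow> complex \<Rightarrow> complex" where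
  "normalized_deriv f z = deriv f z / (2 * of_real pi * \<i>)"

definition serre_deriv :: "int \<Rightarrow> (complex \<Rightarrow> complex) \<Rightarrow> complex \<Rightarrow> complex" where
  "serre_deriv k f z = normalized_deriv f z - of_int k / 12 * E2 z * f z"

primrec iterated_serre_deriv :: "int \<Rightarrow> nat \<Rightarrow> (complex \<Rightarrow> complex) \<Rightarrow> complex \<Rightarrow> complex" where
  "iterated_serre_deriv k 0 f = f"
| "iterated_serre_deriv k (Suc j) f = serre_deriv (k + 2 * int j) (iterated_serre_deriv k j f)"

definition quasimodular_forms :: "int \<Rightarrow> nat \<Rightarrow> (complex \<Rightarrow> complex) set" where
  "quasimodular_forms w r =
     {(\<lambda>z. \<Sum>l\<le>r. E2 z ^ l * h l z) | h. \<forall>l\<le>r. h l \<in> modular_forms (w - 2 * int l)}"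

definition balanced_quasimodular :: "int \<Rightarrow> (complex \<Rightarrow> complex) \<Rightarrow> bool" where
  "balanced_quasimodular w f \<longleftrightarrow>
     (\<exists>h0 \<in> modular_forms w. \<exists>h1 \<in> modular_forms (w - 2).
        (\<exists>z\<in>uhp. h1 z \<noteq> 0) \<and>
        (\<forall>z\<in>uhp. f z = h0 z + E2 z * h1 z) \<and>
        (\<exists>l0 l1 :: int.
           l0 \<ge> l1 \<and> l1 \<ge> 0 \<and>
           l0 < int (fun_space.dim (quasimodular_forms w 1)) \<and>
           l1 < int (fun_space.dim (modular_forms (w - 2))) \<and>
           vanishing_order_at_cusp f l0 \<and>
           vanishing_order_at_cusp (\<lambda>z. 6 / (of_real pi * \<i>) * h1 z) l1 \<and>
           l0 + l1 = int (fun_space.dim (quasimodular_forms w 1)) - 1))"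

text \<open>An equation is given by its operator \<open>L\<close>; its solutions are the zeros of \<open>L\<close>.\<close>

definition holomorphic_solution ::
  "((complex \<Rightarrow> complex) \<Rightarrow> complex \<Rightarrow> complex) \<Rightarrow> (complex \<Rightarrow> complex) \<Rightarrow> bool" where
  "holomorphic_solution L f \<longleftrightarrow> f holomorphic_on uhp \<and> (\<forall>z\<in>uhp. L f z = 0)"

definition solution_space ::
  "((complex \<Rightarrow> complex) \<Rightarrow> complex \<Rightarrow> complex) \<Rightarrow> (complex \<Rightarrow> complex) set" where
  "solution_space L = {f. holomorphic_solution L f \<and> (\<forall>z. z \<notin> uhp \<longrightarrow> f z = 0)}"

text \<open>The two functions must be distinct, since the set would otherwise be a singleton.\<close>

definition fundamental_system ::
  "((complex \<Rightarrow> complex) \<Rightarrow> complex \<Rightarrow> complex) \<Rightarrow>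
     (complex \<Rightarrow> complex) \<Rightarrow> (complex \<Rightarrow> complex) \<Rightarrow> bool" where
  "fundamental_system L u v \<longleftrightarrow>
     restrict_uhp u \<noteq> restrict_uhp v \<and>
     fun_space.independent {restrict_uhp u, restrict_uhp v} \<and>
     fun_space.span {restrict_uhp u, restrict_uhp v} = solution_space L"

definition mde_a0 :: "int \<Rightarrow> int \<Rightarrow> (complex \<Rightarrow> complex) \<Rightarrow> complex \<Rightarrow> complex" where
  "mde_a0 w l f z =
     iterated_serre_deriv (w - 1) 2 f z
     - of_int ((12 * l - w - 1) * (12 * l - w + 1)) / 144 * E4 z * f z"

definition mde_a2 :: "int \<Rightarrow> int \<Rightarrow> (complex \<Rightarrow> complex) \<Rightarrow> complex \<Rightarrow> complex" where
  "mde_a2 w l f z =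
     E4 z * iterated_serre_deriv (w - 1) 2 f z
     + 1 / 3 * E6 z * serre_deriv (w - 1) f z
     - of_int ((12 * l - w + 1) * (12 * l - w + 3)) / 144 * E4 z ^ 2 * f z"

definition mde_a4 :: "int \<Rightarrow> int \<Rightarrow> (complex \<Rightarrow> complex) \<Rightarrow> complex \<Rightarrow> complex" where
  "mde_a4 w l f z =
     E4 z ^ 2 * iterated_serre_deriv (w - 1) 2 f z
     + 2 / 3 * E4 z * E6 z * serre_deriv (w - 1) f z
     - ((of_int ((12 * l - w + 3) * (12 * l - w + 5)) / 144 - 1 / 18) * E4 z ^ 3
        + 384 * modular_discriminant z) * f z"

end

theory Submission
  imports Defs
begin

text \<open>
  Each of the three equations is invariant under the weight $w - 1$ action of the modular group, and
  the Wronskian of two solutions satisfies a first order equation, hence is a constant multiple of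
  $V = E_4^{a/2} \Delta^m$ with $w = 6 m + a$. In particular the space of holomorphic solutions has
  dimension at most two. Let $f$ be a solution with a $q$-expansion and
  $g(z) = z^{1-w} f(-1/z)$. The relations of the modular group and the periodicity of $V$ force $f$ and
  $g$ to be independent and $g(z + 1) = f(z) + g(z)$, so $g_1 = g - z f$ is periodic and transforms
  like a form of weight $w - 2$, and $f$ minus a multiple of $E_2 g_1$ transforms like a form of
  weight $w$. The Wronskian gives $(g_1/f)' = c V / f^2 - 1$, from which $g_1$ has order exactly
  $m - \lambda$ at the cusp. If $\lambda = m/2$, the first function of the claimed system is checked to
  be a solution and the second one is its image under $z \mapsto -1/z$.

  The modularity of $E_4$ and $E_6$ comes from lattice sums. Their constant terms, as well as the
  differential equations of Ramanujan, follow from the one-dimensionality of the spaces of forms of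
  weight at most 10, which is proved by the maximum principle.
\<close>

section \<open>Functions on the upper half plane and their q-expansions\<close>

text \<open>The constants in the three operators are fixed by local exponents. At i infinity the
  indicial equation has the roots l and m - l; in the third case the summand - 1/18 is what makes l
  a root. At the zeros of \<open>E4\<close> the exponents are 0 and 2 in the second case and 1 and 2
  in the third, where the coefficient 384 brings this about. So for a = 2 and a = 4 the equations
  are singular inside the upper half plane, and the usual existence and uniqueness theorems do not
  apply there. This shapes the proof: a second solution is never constructed from the equation but
  obtained as the image of the given one under z -> -1/z, and division by the leading coefficient is
  replaced by the identity theorem. The weight k = w - 1 is odd, so z -> -1/z acts on solutions with
  square -1; together with the other relation of the modular group this excludes that f spans an
  invariant line. The orders l and m - l add up to m, one less than the dimension of the
  quasimodular space, and this is the balance to be shown.\<close>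

lemma uhp_iff: "z \<in> uhp \<longleftrightarrow> Im z > 0"
  by (simp add: uhp_def)

lemma open_uhp: "open uhp"
  unfolding uhp_def by (rule open_halfspace_Im_gt)

lemma convex_uhp: "convex uhp"
  unfolding uhp_def by (rule convex_halfspace_Im_gt)

lemma connected_uhp: "connected uhp"
  by (rule convex_connected[OF convex_uhp])

lemma uhp_nonzero: "z \<in> uhp \<Longrightarrow> z \<noteq> 0"
  by (auto simp: uhp_def)

lemma uhp_minus_inverse: "z \<in> uhp \<Longrightarrow> - 1 / z \<in> uhp"
  by (auto simp: uhp_def Im_divide sum_power2_gt_zero_iff complex_eq_iff intro!: divide_pos_pos)

lemma uhp_add_int: "z \<in> uhp \<Longrightarrow> z + of_int n \<in> uhp"
  by (auto simp: uhp_def)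

section \<open>The parameter q and descent of periodic functions to the punctured disc\<close>

lemma norm_qpar: "norm (qpar z) = exp (- 2 * pi * Im z)"
  by (simp add: qpar_def)

lemma qpar_nonzero [simp]: "qpar z \<noteq> 0"
  by (simp add: qpar_def)

lemma norm_qpar_less_1: "z \<in> uhp \<Longrightarrow> norm (qpar z) < 1"
  by (simp add: norm_qpar uhp_def)

lemma qpar_in_ball: "z \<in> uhp \<Longrightarrow> qpar z \<in> ball 0 1"
  by (simp add: norm_qpar_less_1)

lemma qpar_plus_int: "qpar (z + of_int n) = qpar z"
proof -
  have "2 * complex_of_real pi * \<i> * (z + of_int n) = 2 * of_real pi * \<i> * z + 2 * of_int n * of_real pi * \<i>"
    by (simp add: algebra_simps)
  moreover have "exp (2 * of_int n * of_real pi * \<i>) = (1::complex)"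
    using exp_integer_2pi[of "of_int n"] by (simp add: mult_ac)
  ultimately show ?thesis
    unfolding qpar_def by (simp add: exp_add)
qed

lemma qpar_plus_1: "qpar (z + 1) = qpar z"
  using qpar_plus_int[of z 1] by simp

lemma qpar_of_nat_mult: "qpar (of_nat n * z) = qpar z ^ n"
  by (simp add: qpar_def exp_of_nat_mult[symmetric] mult_ac)

lemma has_field_derivative_qpar [derivative_intros]:
  assumes "(f has_field_derivative f') (at x within A)"
  shows "((\<lambda>x. qpar (f x)) has_field_derivative (2 * of_real pi * \<i> * qpar (f x) * f')) (at x within A)"
  unfolding qpar_def by (auto intro!: derivative_eq_intros assms)

lemma holomorphic_on_qpar [holomorphic_intros]: 
  "f holomorphic_on A \<Longrightarrow> (\<lambda>z. qpar (f z)) holomorphic_on A"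
  unfolding qpar_def by (intro holomorphic_intros)

lemma qpar_surj:
  assumes "q \<in> ball 0 1" "q \<noteq> 0"
  obtains z where "z \<in> uhp" "qpar z = q"
proof
  define z where "z = Ln q / (2 * of_real pi * \<i>)"
  show "qpar z = q" using assms by (simp add: z_def qpar_def)
  have "Im z = - ln (norm q) / (2 * pi)"
    using assms by (simp add: z_def Im_divide Re_divide power2_eq_square field_simps)
  with assms show "z \<in> uhp" by (auto simp: uhp_def intro!: divide_neg_pos)
qed

lemma qpar_eq_imp:
  assumes "qpar z = qpar w"
  obtains n :: int where "z = w + of_int n"
proof -
  obtain n :: int where "2 * complex_of_real pi * \<i> * z = 2 * of_real pi * \<i> * w + of_int (2 * n) * of_real pi * \<i>"
    using assms unfolding qpar_def exp_eq by auto
  then have "(2 * complex_of_real pi * \<i>) * z = (2 * complex_of_real pi * \<i>) * (w + of_int n)"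
    by (simp add: algebra_simps)
  then have "z = w + of_int n" by (subst (asm) mult_cancel_left) auto
  then show ?thesis using that by blast
qed

lemma periodic_plus_int:
  assumes "\<And>z. z \<in> uhp \<Longrightarrow> f (z + 1) = f z" "z \<in> uhp"
  shows "f (z + of_int n) = f z"
proof -
  have nat: "f (z + of_nat k) = f z" if "z \<in> uhp" for z k
  proof (induction k)
    case (Suc k)
    have "z + of_nat k \<in> uhp" using that by (auto simp: uhp_def)
    then show ?case using assms(1)[of "z + of_nat k"] Suc by (simp add: add_ac)
  qed auto
  show ?thesis
  proof (cases "n \<ge> 0")
    case True
    then show ?thesis using nat[OF assms(2), of "nat n"] by simp
  next
    case False
    then have "f (z + of_int n + of_nat (nat (-n))) = f (z + of_int n)"
      by (intro nat uhp_add_int assms)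
    then show ?thesis using False by simp
  qed
qed

text \<open>Any branch of the logarithm serves, since only periodic \<open>f\<close> are meant; the
  principal one leaves a cut along the negative axis that \<open>q_function_holomorphic\<close> has
  to cross.\<close>

definition q_function :: "(complex \<Rightarrow> complex) \<Rightarrow> complex \<Rightarrow> complex" where
  "q_function f q = f (Ln q / (2 * of_real pi * \<i>))"

lemma q_function_qpar:
  assumes per: "\<And>z. z \<in> uhp \<Longrightarrow> f (z + 1) = f z" and z: "z \<in> uhp"
  shows "q_function f (qpar z) = f z"
proof -
  define w where "w = Ln (qpar z) / (2 * of_real pi * \<i>)"
  have "qpar w = qpar z" by (simp add: w_def qpar_def)
  then obtain n :: int where n: "w = z + of_int n" by (rule qpar_eq_imp)
  then show ?thesis using periodic_plus_int[of f z n] per z 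
    unfolding q_function_def w_def by simp
qed

lemma q_function_holomorphic:
  assumes f: "f holomorphic_on uhp" and per: "\<And>z. z \<in> uhp \<Longrightarrow> f (z + 1) = f z"
  shows "q_function f holomorphic_on ball 0 1 - {0}"
proof -
  have "q_function f field_differentiable (at q)" if q: "q \<in> ball 0 1 - {0}" for q
  proof -
    \<comment> \<open>A branch of the logarithm centred at q: the quotient x / q stays off the cut
      as long as x is in the disc of radius |q| about q.\<close>
    define L where "L x = (Ln (x / q) + Ln q) / (2 * of_real pi * \<i>)" for x
    define B where "B = ball q (norm q) \<inter> ball 0 1 - {0}"
    have q0: "q \<noteq> 0" using q by auto
    have opB: "open B" unfolding B_def by auto
    have qB: "q \<in> B" using q by (auto simp: B_def)
    have slit: "x / q \<notin> \<real>\<^sub>\<le>\<^sub>0" if "x \<in> B" for x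
    proof
      assume "x / q \<in> \<real>\<^sub>\<le>\<^sub>0"
      then obtain t where t: "x / q = of_real t" "t \<le> 0" by (auto elim!: nonpos_Reals_cases)
      then have x: "x = of_real t * q" using q0 by (simp add: field_simps)
      have "norm q \<le> dist q x"
      proof -
        have "q - x = of_real (1 - t) * q" by (simp add: x algebra_simps)
        then have "dist q x = (1 - t) * norm q" using t(2) by (simp add: dist_norm norm_mult del: of_real_diff)
        moreover have "1 * norm q \<le> (1 - t) * norm q" using t(2) by (intro mult_right_mono) auto
        ultimately show ?thesis by simp
      qed
      with \<open>x \<in> B\<close> show False by (auto simp: B_def)
    qed
    have qL: "qpar (L x) = x" if "x \<in> B" for x
    proof -
      have "exp (Ln (x / q)) * exp (Ln q) = x" using that q0 by (subst (1 2) exp_Ln) (auto simp: B_def)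
      then show ?thesis by (simp add: L_def qpar_def exp_add)
    qed
    have Lu: "L x \<in> uhp" if "x \<in> B" for x
    proof -
      have "norm (qpar (L x)) < 1" using that qL by (auto simp: B_def)
      then show ?thesis by (simp add: norm_qpar uhp_def zero_less_mult_iff)
    qed
    have Lhol: "L holomorphic_on B"
      unfolding L_def using slit q0 by (intro holomorphic_intros) auto
    have "(f \<circ> L) holomorphic_on B"
      by (rule holomorphic_on_compose_gen[OF Lhol f]) (use Lu in auto)
    moreover have "(f \<circ> L) x = q_function f x" if "x \<in> B" for x
    proof -
      have "q_function f (qpar (L x)) = f (L x)" using per Lu[OF that] by (rule q_function_qpar)
      then show ?thesis using qL[OF that] by simp
    qed
    ultimately have "q_function f holomorphic_on B" by (rule holomorphic_transform)
    then show ?thesis using opB qB holomorphic_on_imp_differentiable_at by blast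
  qed
  then show ?thesis
    by (simp add: holomorphic_on_def field_differentiable_at_within)
qed

text \<open>\<open>cusp_rep l F f\<close> is \<^term>\<open>q_expansion\<close> with the power series replaced by its sum.\<close>

definition cusp_rep :: "int \<Rightarrow> (complex \<Rightarrow> complex) \<Rightarrow> (complex \<Rightarrow> complex) \<Rightarrow> bool" where
  "cusp_rep l F f \<longleftrightarrow> F holomorphic_on ball 0 1 \<and> (\<forall>z\<in>uhp. f z = qpar z powi l * F (qpar z))"

lemma cusp_rep_imp_q_expansion:
  assumes "cusp_rep l F f"
  shows "q_expansion l (\<lambda>n. (deriv ^^ n) F 0 / fact n) f"
  unfolding q_expansion_def
proof (intro ballI conjI)
  fix z assume z: "z \<in> uhp"
  have "(\<lambda>n. (deriv ^^ n) F 0 / fact n * qpar z ^ n) sums F (qpar z)"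
    using holomorphic_power_series[of F 0 1 "qpar z"] assms qpar_in_ball[OF z] by (simp add: cusp_rep_def)
  then show "summable (\<lambda>n. (deriv ^^ n) F 0 / fact n * qpar z ^ n)"
    "f z = qpar z powi l * (\<Sum>n. (deriv ^^ n) F 0 / fact n * qpar z ^ n)"
    using assms z by (auto simp: cusp_rep_def sums_iff)
qed

text \<open>Summability at every point of the half plane is summability on the whole punctured disc,
  because \<open>qpar\<close> is onto it; at 0 a power series converges trivially.\<close>

lemma q_expansion_imp_cusp_rep:
  assumes "q_expansion l c f"
  shows "cusp_rep l (\<lambda>q. \<Sum>n. c n * q ^ n) f"
proof -
  have "(\<lambda>n. c n * (q - 0) ^ n) sums (\<Sum>n. c n * q ^ n)" if "q \<in> ball 0 1" for q
  proof (cases "q = 0")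
    case False
    then obtain z where "z \<in> uhp" "qpar z = q" using qpar_surj \<open>q \<in> ball 0 1\<close> by metis
    then show ?thesis using assms by (auto simp: q_expansion_def intro!: summable_sums)
  qed auto
  then have "(\<lambda>q. \<Sum>n. c n * q ^ n) holomorphic_on ball 0 1"
    by (rule power_series_holomorphic)
  then show ?thesis using assms by (auto simp: cusp_rep_def q_expansion_def)
qed

lemma q_expansion_iff_cusp_rep: "(\<exists>c. q_expansion l c f) \<longleftrightarrow> (\<exists>F. cusp_rep l F f)"
  using cusp_rep_imp_q_expansion q_expansion_imp_cusp_rep by blast

lemma vanishing_order_iff: "vanishing_order_at_cusp f l \<longleftrightarrow> (\<exists>F. cusp_rep l F f \<and> F 0 \<noteq> 0)"
proof
  assume "vanishing_order_at_cusp f l"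
  then obtain c where c: "c 0 \<noteq> 0" "q_expansion l c f" by (auto simp: vanishing_order_at_cusp_def)
  then show "\<exists>F. cusp_rep l F f \<and> F 0 \<noteq> 0" 
    using q_expansion_imp_cusp_rep[OF c(2)] by (intro exI[of _ "\<lambda>q. \<Sum>n. c n * q ^ n"]) simp
next
  assume "\<exists>F. cusp_rep l F f \<and> F 0 \<noteq> 0"
  then obtain F where F: "cusp_rep l F f" "F 0 \<noteq> 0" by auto
  then show "vanishing_order_at_cusp f l" unfolding vanishing_order_at_cusp_def
    using cusp_rep_imp_q_expansion[OF F(1)] by (intro exI[of _ "\<lambda>n. (deriv ^^ n) F 0 / fact n"]) simp
qed

text \<open>Away from 0 both functions are determined by f, and at 0 by continuity. The value at 0
  is what later comparisons of leading coefficients use.\<close>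

lemma cusp_rep_unique:
  assumes "cusp_rep l F f" "cusp_rep l G f" "q \<in> ball 0 1"
  shows "F q = G q"
proof -
  have eq: "F x = G x" if x: "x \<in> ball 0 1" "x \<noteq> 0" for x
  proof -
    obtain z where "z \<in> uhp" "qpar z = x" using qpar_surj x by metis
    then show ?thesis using assms by (auto simp: cusp_rep_def)
  qed
  show ?thesis
  proof (cases "q = 0")
    case True
    have "isCont F 0" "isCont G 0" using assms
      by (auto simp: cusp_rep_def intro!: continuous_on_interior[of "ball 0 1"] holomorphic_on_imp_continuous_on)
    then have "F \<midarrow>0\<rightarrow> F 0" "G \<midarrow>0\<rightarrow> G 0" by (auto simp: isCont_def)
    moreover have "F \<midarrow>0\<rightarrow> G 0"
    proof (rule Lim_transform_within_open[OF \<open>G \<midarrow>0\<rightarrow> G 0\<close>, of "ball 0 1"])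
      show "G x = F x" if "x \<in> ball 0 1" "x \<noteq> 0" for x using eq that by auto
    qed auto
    ultimately show ?thesis using True LIM_unique by metis
  qed (use eq assms in auto)
qed

text \<open>Riemann's removable singularity theorem: boundedness for large Im z is boundedness near
  q = 0.\<close>

lemma cusp_rep_of_bounded:
  assumes f: "f holomorphic_on uhp" and per: "\<And>z. z \<in> uhp \<Longrightarrow> f (z + 1) = f z"
    and bd: "\<And>z. Im z \<ge> Y \<Longrightarrow> norm (f z) \<le> B"
  shows "\<exists>F. cusp_rep 0 F f"
proof -
  have "\<exists>g. g holomorphic_on ball 0 1 \<and> (\<forall>q\<in>ball 0 1 - {0}. g q = q_function f q)"
  proof (subst holomorphic_on_extend_bounded)
    show "q_function f holomorphic_on ball 0 1 - {0}" using f per by (rule q_function_holomorphic)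
    show "(0::complex) \<in> interior (ball 0 1)" by simp
    have "eventually (\<lambda>q::complex. q \<in> ball 0 (min 1 (exp (-2 * pi * Y)))) (at 0)"
      by (intro eventually_at_in_open') auto
    moreover have "eventually (\<lambda>q::complex. q \<noteq> 0) (at 0)" by (simp add: eventually_at_filter)
    ultimately have "eventually (\<lambda>q. norm (q_function f q) \<le> B) (at 0)"
    proof eventually_elim
      case (elim q)
      then obtain z where z: "z \<in> uhp" "qpar z = q" using qpar_surj[of q] by auto
      then have "exp (- 2 * pi * Im z) < exp (-2 * pi * Y)" using elim norm_qpar[of z] by simp
      then have "Im z \<ge> Y" by simp
      moreover have "q_function f (qpar z) = f z" using per z(1) by (rule q_function_qpar)
      ultimately show ?case using bd[of z] z by simp
    qed
    then show "\<exists>B. eventually (\<lambda>q. norm (q_function f q) \<le> B) (at 0)" by blast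
  qed
  then obtain F where F: "F holomorphic_on ball 0 1" "\<And>q. q \<in> ball 0 1 - {0} \<Longrightarrow> F q = q_function f q" by auto
  have "F (qpar z) = f z" if "z \<in> uhp" for z
  proof -
    have "q_function f (qpar z) = f z" using per that by (rule q_function_qpar)
    then show ?thesis using F(2)[of "qpar z"] qpar_in_ball[OF that] by simp
  qed
  then have "cusp_rep 0 F f" using F by (auto simp: cusp_rep_def)
  then show ?thesis by blast
qed

lemma cusp_rep_bounded:
  assumes "cusp_rep 0 F f" "Y > 0"
  shows "\<exists>B. \<forall>z. Im z \<ge> Y \<longrightarrow> norm (f z) \<le> B"
proof -
  have "exp (-2 * pi * Y) < 1" using assms(2) by simp
  then have "cball 0 (exp (-2 * pi * Y)) \<subseteq> ball (0::complex) 1"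
    by (meson cball_subset_ball_iff mem_ball_0 order_refl subset_iff mem_cball_0 le_less_trans)
  then have "F holomorphic_on cball 0 (exp (-2 * pi * Y))"
    using assms(1) holomorphic_on_subset unfolding cusp_rep_def by blast
  then have "compact (F ` cball 0 (exp (-2 * pi * Y)))"
    by (intro compact_continuous_image holomorphic_on_imp_continuous_on) auto
  then obtain B where B: "\<forall>q\<in>cball 0 (exp (-2 * pi * Y)). norm (F q) \<le> B"
    by (auto dest!: compact_imp_bounded simp: bounded_iff)
  have "norm (f z) \<le> B" if "Im z \<ge> Y" for z
  proof -
    have "f z = F (qpar z)" using assms that by (auto simp: cusp_rep_def uhp_def)
    moreover have "qpar z \<in> cball 0 (exp (-2 * pi * Y))" using that by (simp add: norm_qpar)
    ultimately show ?thesis using B by simp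
  qed
  then show ?thesis by blast
qed

lemma cusp_rep_holomorphic: "cusp_rep 0 F f \<Longrightarrow> f holomorphic_on uhp"
proof -
  assume F: "cusp_rep 0 F f"
  have "F \<circ> qpar holomorphic_on uhp"
    by (rule holomorphic_on_compose_gen[of _ _ _ "ball 0 1"])
       (use F qpar_in_ball in \<open>auto simp: cusp_rep_def intro!: holomorphic_intros\<close>)
  then show ?thesis by (rule holomorphic_transform) (use F in \<open>auto simp: cusp_rep_def\<close>)
qed

lemma cusp_rep_periodic: "cusp_rep l F f \<Longrightarrow> z \<in> uhp \<Longrightarrow> f (z + 1) = f z"
  using uhp_add_int[of z 1] by (simp add: cusp_rep_def qpar_plus_1)

section \<open>The modular group\<close>

lemma modular_transform:
  assumes "f \<in> modular_forms k" "a * d - b * c = 1" "z \<in> uhp"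
  shows "f ((of_int a * z + of_int b) / (of_int c * z + of_int d)) = (of_int c * z + of_int d) powi k * f z"
  using assms by (auto simp: modular_forms_def)

lemma modular_minus_inverse: "f \<in> modular_forms k \<Longrightarrow> z \<in> uhp \<Longrightarrow> f (- 1 / z) = z powi k * f z"
  using modular_transform[of f k 0 0 "-1" 1 z] by simp

lemma modular_holomorphic: "f \<in> modular_forms k \<Longrightarrow> f holomorphic_on uhp"
  by (simp add: modular_forms_def)

lemma modular_outside: "f \<in> modular_forms k \<Longrightarrow> z \<notin> uhp \<Longrightarrow> f z = 0"
  by (simp add: modular_forms_def)

lemma modular_cusp_rep: "f \<in> modular_forms k \<Longrightarrow> \<exists>F. cusp_rep 0 F f"
  using q_expansion_iff_cusp_rep[of 0 f] by (auto simp: modular_forms_def)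

lemma det_1_denom_nonzero:
  assumes "a * d - b * c = (1::int)" "z \<in> uhp"
  shows "of_int c * z + of_int d \<noteq> 0"
proof
  assume *: "of_int c * z + of_int d = 0"
  then have "of_int c * Im z = 0" by (simp add: complex_eq_iff)
  then have "c = 0" using assms(2) by (auto simp: uhp_def)
  with * assms(1) show False by auto
qed

lemma Im_moebius:
  assumes "a * d - b * c = (1::int)" "z \<in> uhp"
  shows "Im ((of_int a * z + of_int b) / (of_int c * z + of_int d)) = Im z / (norm (of_int c * z + of_int d))\<^sup>2"
proof -
  have "real_of_int a * of_int d - of_int b * of_int c = 1"
    using assms(1) by (metis of_int_1 of_int_diff of_int_mult)
  then have "Im z * (of_int a * of_int d) = Im z * (1 + of_int b * of_int c)" by simp
  then have "Im ((of_int a * z + of_int b) * cnj (of_int c * z + of_int d)) = Im z"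
    by (simp add: algebra_simps)
  then show ?thesis
    by (subst complex_div_cnj) (simp add: Im_divide_of_real)
qed

lemma moebius_uhp:
  assumes "a * d - b * c = (1::int)" "z \<in> uhp"
  shows "(of_int a * z + of_int b) / (of_int c * z + of_int d) \<in> uhp"
  using Im_moebius[OF assms] det_1_denom_nonzero[OF assms] assms(2) by (simp add: uhp_def)

text \<open>Euclid's algorithm on the lower row (c, d), as strong induction on |c|: with d = q c +
  r, translating by q and then applying z -> -1/z leads to the lower row (r, - c). Even weight takes
  care of the matrices with c = 0 and a = d = - 1.\<close>

lemma modular_transform_generated:
  fixes k :: int
  assumes k: "even k" and T: "\<And>z. z \<in> uhp \<Longrightarrow> f (z + 1) = f z"
    and S: "\<And>z. z \<in> uhp \<Longrightarrow> f (- 1 / z) = z powi k * f z"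
    and det: "a * d - b * c = 1" and z: "z \<in> uhp"
  shows "f ((of_int a * z + of_int b) / (of_int c * z + of_int d)) = (of_int c * z + of_int d) powi k * f z"
  using det z
proof (induction "nat \<bar>c\<bar>" arbitrary: a b c d z rule: less_induct)
  case less
  note det = less.prems(1) and z = less.prems(2)
  show ?case
  proof (cases "c = 0")
    case True
    then have "a = 1 \<and> d = 1 \<or> a = -1 \<and> d = -1" using det by (simp add: zmult_eq_1_iff)
    then show ?thesis
    proof
      assume "a = 1 \<and> d = 1"
      then show ?thesis using True periodic_plus_int[of f z b] T z by simp
    next
      assume ad: "a = -1 \<and> d = -1"
      have "f (z + of_int (-b)) = f z" using T z by (rule periodic_plus_int)
      then show ?thesis using True ad k by (simp add: power_int_minus_left minus_divide_left)
    qed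
  next
    case False
    \<comment> \<open>The factor \<open>sgn c\<close> makes q c equal to (d div |c|) |c|, so the
      remainder is nonnegative and smaller than |c| for negative c as well.\<close>
    define q r where "q = d div \<bar>c\<bar> * sgn c" and "r = d mod \<bar>c\<bar>"
    have "sgn c * c = \<bar>c\<bar>" by (simp add: abs_sgn mult.commute)
    then have d: "d = q * c + r" by (simp add: q_def r_def mult.assoc)
    define u where "u = z + of_int q"
    have u: "u \<in> uhp" unfolding u_def by (rule uhp_add_int[OF z])
    have u0: "u \<noteq> 0" using u uhp_nonzero by auto
    define v where "v = - 1 / u"
    have v: "v \<in> uhp" unfolding v_def by (rule uhp_minus_inverse[OF u])
    have det': "(b - a * q) * (- c) - (- a) * r = 1" using det unfolding d by (simp add: algebra_simps)
    have "nat \<bar>r\<bar> < nat \<bar>c\<bar>" using False by (simp add: r_def)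
    note IH = less.hyps[OF this det' v]
    have cu: "of_int c * z + of_int d = of_int c * u + of_int r" by (simp add: u_def d algebra_simps)
    have au: "of_int a * z + of_int b = of_int a * u + of_int (b - a * q)" by (simp add: u_def algebra_simps)
    have den: "of_int r * v + of_int (- c) = - (of_int c * u + of_int r) / u"
      using u0 by (simp add: v_def field_simps)
    have num: "of_int (b - a * q) * v + of_int (- a) = - (of_int a * u + of_int (b - a * q)) / u"
      using u0 by (simp add: v_def field_simps)
    have fv: "f v = u powi k * f u" unfolding v_def by (rule S[OF u])
    have fu: "f u = f z" unfolding u_def using T z by (rule periodic_plus_int)
    have "f ((of_int a * z + of_int b) / (of_int c * z + of_int d))
        = (- (of_int c * u + of_int r) / u) powi k * (u powi k * f z)"
    proof -
      have "(of_int a * z + of_int b) / (of_int c * z + of_int d)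
          = (of_int (b - a * q) * v + of_int (- a)) / (of_int r * v + of_int (- c))"
        unfolding den num cu au using u0
        by (metis divide_divide_times_eq minus_divide_divide divide_minus_left mult.commute mult_divide_mult_cancel_left)
      then show ?thesis using IH by (simp only: den fv fu)
    qed
    also have "\<dots> = (of_int c * u + of_int r) powi k * f z"
    proof -
      have "(- (of_int c * u + of_int r) / u) powi k = (of_int c * u + of_int r) powi k / u powi k"
        using k by (simp only: power_int_divide_distrib power_int_minus_left if_True)
      then show ?thesis using u0 by simp
    qed
    finally show ?thesis by (simp only: cu)
  qed
qed

lemma restrict_uhp_eq: "z \<in> uhp \<Longrightarrow> restrict_uhp f z = f z"
  by (simp add: restrict_uhp_def)

lemma modular_formsI:
  fixes k :: int
  assumes k: "even k" and T: "\<And>z. z \<in> uhp \<Longrightarrow> f (z + 1) = f z"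
    and S: "\<And>z. z \<in> uhp \<Longrightarrow> f (- 1 / z) = z powi k * f z"
    and F: "cusp_rep 0 F f"
  shows "restrict_uhp f \<in> modular_forms k"
proof -
  have "f holomorphic_on uhp" by (rule cusp_rep_holomorphic[OF F])
  then have "restrict_uhp f holomorphic_on uhp" 
    by (rule holomorphic_transform) (simp add: restrict_uhp_eq)
  moreover have "cusp_rep 0 F (restrict_uhp f)"
    using F by (simp add: cusp_rep_def restrict_uhp_eq)
  then have "\<exists>c. q_expansion 0 c (restrict_uhp f)" using q_expansion_iff_cusp_rep by blast
  moreover have "restrict_uhp f ((of_int a * z + of_int b) / (of_int c * z + of_int d))
      = (of_int c * z + of_int d) powi k * restrict_uhp f z" 
    if "a * d - b * c = 1" "z \<in> uhp" for a b c d z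
    using modular_transform_generated[OF k T S that] moebius_uhp[OF that] that by (simp add: restrict_uhp_eq)
  ultimately show ?thesis unfolding modular_forms_def by (simp add: restrict_uhp_def)
qed

section \<open>Minimal lattice vectors and reduction to the fundamental domain\<close>

lemma lattice_finite:
  assumes "z \<in> uhp"
  shows "finite {(c::int, d::int). norm (of_int c * z + of_int d) \<le> 1}"
proof -
  have y: "Im z > 0" using assms by (simp add: uhp_def)
  define M where "M = \<lceil>1 / Im z\<rceil>"
  define N where "N = \<lceil>1 + of_int M * norm z\<rceil>"
  have "c \<in> {-M..M} \<and> d \<in> {-N..N}" if *: "norm (of_int c * z + of_int d) \<le> 1" for c d
  proof -
    have "\<bar>of_int c * Im z\<bar> \<le> 1" using abs_Im_le_cmod[of "of_int c * z + of_int d"] * by simp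
    then have "\<bar>real_of_int c\<bar> \<le> 1 / Im z" using y by (simp add: abs_mult field_simps)
    then have c: "\<bar>real_of_int c\<bar> \<le> of_int M" unfolding M_def by linarith
    have "norm (of_int d :: complex) \<le> norm (of_int c * z + of_int d) + norm (of_int c * z)"
      using norm_triangle_ineq4[of "of_int c * z + of_int d" "of_int c * z"] by simp
    also have "\<dots> \<le> 1 + of_int M * norm z" using * c by (intro add_mono) (auto simp: norm_mult intro!: mult_right_mono)
    finally have "\<bar>real_of_int d\<bar> \<le> of_int N" unfolding N_def by simp linarith
    with c show ?thesis by auto
  qed
  then have "{(c, d). norm (of_int c * z + of_int d) \<le> 1} \<subseteq> {-M..M} \<times> {-N..N}" by auto
  then show ?thesis by (rule finite_subset) auto
qed

text \<open>A nonzero pair (c, d) minimising |c z + d| gives an image point of greatest height in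
  the orbit. Minimality forces the pair to be primitive, so it completes to a matrix; after a
  translation, comparing it with the upper row gives |t| >= 1 and thus (Im t)^2 >= 1 - 1/4.\<close>

lemma modular_reduction:
  assumes z: "z \<in> uhp"
  obtains a b c d :: int where "a * d - b * c = 1" 
    "\<bar>Re ((of_int a * z + of_int b) / (of_int c * z + of_int d))\<bar> \<le> 1/2"
    "(Im ((of_int a * z + of_int b) / (of_int c * z + of_int d)))\<^sup>2 \<ge> 3/4"
proof -
  define P where "P = (\<lambda>(c::int, d::int). norm (of_int c * z + of_int d))"
  define A where "A = {(c, d). norm (of_int c * z + of_int d) \<le> 1} - {(0, 0)}"
  have "finite A" using lattice_finite[OF z] by (simp add: A_def)
  moreover have "(0, 1) \<in> A" by (simp add: A_def)
  then have "A \<noteq> {}" by blast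
  ultimately obtain p where p: "p \<in> A" "\<And>p'. p' \<in> A \<Longrightarrow> P p \<le> P p'"
    using ex_min_if_finite[of "P ` A"] by (auto simp: not_less)
  obtain c d where cd: "p = (c, d)" by (cases p)
  have cd0: "c \<noteq> 0 \<or> d \<noteq> 0" and le1: "P (c, d) \<le> 1" using p(1) by (auto simp: A_def cd P_def)
  \<comment> \<open>The pair (0, 1) lies in \<open>A\<close>, so the minimum is at most 1 and no
    pair outside \<open>A\<close> can be smaller.\<close>
  have min: "P (c, d) \<le> P (c', d')" if "c' \<noteq> 0 \<or> d' \<noteq> 0" for c' d'
    using p(2)[of "(c', d')"] that le1 by (cases "P (c', d') \<le> 1") (auto simp: A_def cd P_def)
  have Ppos: "P (c, d) > 0"
  proof -
    have "of_int c * z + of_int d \<noteq> 0"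
    proof
      assume *: "of_int c * z + of_int d = 0"
      then have "of_int c * Im z = 0" by (simp add: complex_eq_iff)
      then have "c = 0" using z by (auto simp: uhp_def)
      with * cd0 show False by auto
    qed
    then show ?thesis by (simp add: P_def)
  qed
  define g where "g = gcd c d"
  have "g > 0" using cd0 by (auto simp: g_def)
  obtain c' d' where c': "c = g * c'" "d = g * d'" unfolding g_def by (meson dvdE gcd_dvd1 gcd_dvd2)
  have "P (c, d) = of_int g * P (c', d')"
  proof -
    have "of_int c * z + of_int d = of_int g * (of_int c' * z + of_int d')" 
      by (simp add: c' algebra_simps)
    then show ?thesis using \<open>g > 0\<close> by (simp add: P_def norm_mult)
  qed
  moreover have "P (c, d) \<le> P (c', d')" using cd0 c' by (intro min) auto
  ultimately have "of_int g * P (c', d') \<le> 1 * P (c', d')" "P (c', d') > 0" 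
    using Ppos \<open>g > 0\<close> by (auto simp: zero_less_mult_iff)
  then have "g \<le> 1" by (subst (asm) mult_le_cancel_right) auto
  with \<open>g > 0\<close> have "g = 1" by linarith
  then have "gcd c d = 1" unfolding g_def .
  then obtain u v where "u * c + v * d = 1" using bezout_int[of c d] by auto
  then have det0: "v * d - (- u) * c = 1" by (simp add: algebra_simps)
  define w where "w = (of_int v * z + of_int (-u)) / (of_int c * z + of_int d)"
  define n where "n = - round (Re w)"
  define t where "t = w + of_int n"
  have den: "of_int c * z + of_int d \<noteq> 0" by (rule det_1_denom_nonzero[OF det0 z])
  have t_eq: "t = (of_int (v + n * c) * z + of_int (- u + n * d)) / (of_int c * z + of_int d)"
    using den by (simp add: t_def w_def field_simps)
  have det: "(v + n * c) * d - (- u + n * d) * c = 1" using det0 by (simp add: algebra_simps)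
  have Re_t: "\<bar>Re t\<bar> \<le> 1/2" using of_int_round_abs_le[of "Re w"] by (simp add: t_def n_def abs_minus_commute)
  have "norm t \<ge> 1"
  proof -
    have "P (c, d) \<le> P (v + n * c, - u + n * d)"
      by (rule min) (use det in auto)
    then show ?thesis using den unfolding t_eq P_def by (simp add: norm_divide le_divide_eq)
  qed
  then have "1 \<le> (norm t)\<^sup>2" by (simp add: one_le_power)
  then have "1 \<le> (Re t)\<^sup>2 + (Im t)\<^sup>2" by (simp add: cmod_power2)
  moreover have "(Re t)\<^sup>2 \<le> (1/2)\<^sup>2" using Re_t by (metis abs_ge_zero power2_abs power_mono)
  ultimately have "(Im t)\<^sup>2 \<ge> 3/4" by (simp add: power2_eq_square)
  with Re_t det that show ?thesis unfolding t_eq by blast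
qed


section \<open>Vanishing of cusp forms of weight at most 10\<close>

lemma pi_ge_3: "pi \<ge> 3"
proof -
  have "sin (pi / 6) \<le> pi / 6" by (rule sin_x_le_x) simp
  then show ?thesis by (simp add: sin_30)
qed

text \<open>The powers of |c z + d| from the weight and from the imaginary part cancel, so this
  height can be maximised over reduced points alone.\<close>

lemma modular_height_invariant:
  assumes f: "f \<in> modular_forms (int k)" and det: "a * d - b * c = 1" and z: "z \<in> uhp"
  defines "w \<equiv> (of_int a * z + of_int b) / (of_int c * z + of_int d)"
  shows "(norm (f w))\<^sup>2 * Im w ^ k = (norm (f z))\<^sup>2 * Im z ^ k"
proof -
  define j where "j = norm (of_int c * z + of_int d)"
  have "j > 0" using det_1_denom_nonzero[OF det z] by (simp add: j_def)
  moreover have "norm (f w) = j ^ k * norm (f z)"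
    using modular_transform[OF f det z] by (simp add: w_def j_def norm_mult norm_power)
  moreover have "Im w = Im z / j\<^sup>2" unfolding w_def j_def by (rule Im_moebius[OF det z])
  ultimately show ?thesis by (simp add: power_mult_distrib power_divide power_mult[symmetric] mult_ac)
qed

text \<open>Siegel's argument: $|f|^2 y^k$ attains its maximum at a point with $y \ge \sqrt3/2$, and the
  maximum principle for $f/q$ as a function of $q$ forces $k \ge 4 \pi y$ there unless $f = 0$.\<close>

lemma cusp_form_small_weight_zero:
  assumes f: "f \<in> modular_forms (int k)" and k: "k \<le> 10" and F: "cusp_rep 1 F f" and z1: "z1 \<in> uhp"
  shows "f z1 = 0"
proof (rule ccontr)
  assume nz: "f z1 \<noteq> 0"
  define \<phi> where "\<phi> z = (norm (f z))\<^sup>2 * Im z ^ k" for z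
  have Fhol: "F holomorphic_on ball 0 1" using F by (simp add: cusp_rep_def)
  have fF: "f z = qpar z * F (qpar z)" if "z \<in> uhp" for z using F that by (simp add: cusp_rep_def)
  have \<phi>1: "\<phi> z1 > 0" using nz z1 by (simp add: \<phi>_def uhp_def)
  have red: "\<exists>w. \<phi> w = \<phi> z \<and> \<bar>Re w\<bar> \<le> 1/2 \<and> (Im w)\<^sup>2 \<ge> 3/4 \<and> w \<in> uhp" if z: "z \<in> uhp" for z
  proof -
    obtain a b c d where *: "a * d - b * c = 1" 
      "\<bar>Re ((of_int a * z + of_int b) / (of_int c * z + of_int d))\<bar> \<le> 1/2"
      "(Im ((of_int a * z + of_int b) / (of_int c * z + of_int d)))\<^sup>2 \<ge> 3/4"
      by (rule modular_reduction[OF z])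
    show ?thesis 
    proof (intro exI conjI)
      show "\<phi> ((of_int a * z + of_int b) / (of_int c * z + of_int d)) = \<phi> z"
        unfolding \<phi>_def by (rule modular_height_invariant[OF f *(1) z])
    qed (fact *(2) *(3) moebius_uhp[OF *(1) z])+
  qed
  have "cusp_rep 0 F (\<lambda>z. F (qpar z))" using Fhol by (simp add: cusp_rep_def)
  then obtain B where B: "\<And>z. Im z \<ge> 1/2 \<Longrightarrow> norm (F (qpar z)) \<le> B"
    using cusp_rep_bounded[of F _ "1/2"] by auto
  have "((\<lambda>y. B\<^sup>2 * (y ^ k / exp y)) \<longlongrightarrow> B\<^sup>2 * 0) at_top"
    by (intro tendsto_intros tendsto_power_div_exp_0)
  \<comment> \<open>Near the cusp the height is at most B^2 y^k exp(- y), a crude weakening of the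
    decay exp(- 4 pi y), and falls below its value at z1.\<close>
  then have "eventually (\<lambda>y. B\<^sup>2 * (y ^ k / exp y) < \<phi> z1) at_top"
    by (rule order_tendstoD) (use \<phi>1 in simp)
  then obtain Y where Y: "\<And>y. y \<ge> Y \<Longrightarrow> B\<^sup>2 * (y ^ k / exp y) < \<phi> z1"
    unfolding eventually_at_top_linorder by blast
  have decay: "\<phi> z < \<phi> z1" if "Im z \<ge> Y" "Im z \<ge> 1/2" for z
  proof -
    have "norm (f z) = exp (- 2 * pi * Im z) * norm (F (qpar z))"
      using that fF[of z] by (simp add: uhp_def norm_mult norm_qpar)
    also have "\<dots> \<le> exp (- 2 * pi * Im z) * B" using B that by (intro mult_left_mono) auto
    finally have "(norm (f z))\<^sup>2 \<le> (exp (- 2 * pi * Im z) * B)\<^sup>2" by (intro power_mono) auto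
    also have "\<dots> = exp (- (4 * pi) * Im z) * B\<^sup>2"
      by (simp add: power_mult_distrib exp_double[symmetric])
    also have "\<dots> \<le> exp (- 1 * Im z) * B\<^sup>2"
    proof -
      have "1 * Im z \<le> (4 * pi) * Im z" using that pi_ge_3 by (intro mult_right_mono) auto
      then show ?thesis by (intro mult_right_mono) auto
    qed
    finally have "\<phi> z \<le> exp (- 1 * Im z) * B\<^sup>2 * Im z ^ k"
      unfolding \<phi>_def using that by (intro mult_right_mono) auto
    also have "\<dots> = B\<^sup>2 * (Im z ^ k / exp (Im z))" by (simp add: exp_minus field_simps)
    also have "\<dots> < \<phi> z1" using Y that by simp
    finally show ?thesis .
  qed
  have sq: "Im w \<ge> 1/2" if "(Im w)\<^sup>2 \<ge> 3/4" "w \<in> uhp" for w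
  proof (rule ccontr)
    assume "\<not> ?thesis"
    then have "(Im w)\<^sup>2 \<le> (1/2)\<^sup>2" using that by (intro power_mono) (auto simp: uhp_def)
    with that show False by (simp add: power2_eq_square)
  qed
  \<comment> \<open>The strip of reduced points, truncated. Reduced points above it have smaller
    height than z1, which has a representative in \<open>K\<close>, so the maximum over
    \<open>K\<close> is the maximum over the half plane.\<close>
  define K where "K = {w. \<bar>Re w\<bar> \<le> 1/2 \<and> 1/2 \<le> Im w \<and> Im w \<le> max Y 1 \<and> 3/4 \<le> (Im w)\<^sup>2}"
  have "compact K"
  proof -
    have "K = cbox (Complex (-1/2) (1/2)) (Complex (1/2) (max Y 1)) \<inter> {w. 3/4 \<le> (Im w)\<^sup>2}"
      by (auto simp: K_def in_cbox_complex_iff)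
    moreover have "closed {w. 3/4 \<le> (Im w)\<^sup>2}" by (intro closed_Collect_le continuous_intros)
    ultimately show ?thesis using compact_Int_closed[OF compact_cbox] by simp
  qed
  moreover have "continuous_on K \<phi>"
  proof -
    have "continuous_on uhp f" using modular_holomorphic[OF f] by (rule holomorphic_on_imp_continuous_on)
    then have "continuous_on K f" by (rule continuous_on_subset) (auto simp: K_def uhp_def)
    then show ?thesis unfolding \<phi>_def by (intro continuous_intros)
  qed
  moreover obtain w1 where w1: "w1 \<in> K" "\<phi> w1 = \<phi> z1"
  proof -
    obtain w where w: "\<phi> w = \<phi> z1" "\<bar>Re w\<bar> \<le> 1/2" "(Im w)\<^sup>2 \<ge> 3/4" "w \<in> uhp" using red[OF z1] by blast
    moreover have "Im w \<ge> 1/2" using sq w by blast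
    moreover have "Im w \<le> max Y 1" using decay[of w] w(1) \<open>Im w \<ge> 1/2\<close> by force
    ultimately have "w \<in> K" unfolding K_def by blast
    with w that show ?thesis by blast
  qed
  ultimately obtain z0 where z0: "z0 \<in> K" "\<And>w. w \<in> K \<Longrightarrow> \<phi> w \<le> \<phi> z0"
    using continuous_attains_sup[of K \<phi>] by blast
  have max: "\<phi> z \<le> \<phi> z0" if z: "z \<in> uhp" for z
  proof -
    obtain w where w: "\<phi> w = \<phi> z" "\<bar>Re w\<bar> \<le> 1/2" "(Im w)\<^sup>2 \<ge> 3/4" "w \<in> uhp" using red[OF z] by blast
    show ?thesis
    proof (cases "Im w \<le> max Y 1")
      case True
      then show ?thesis using z0(2)[of w] w sq[of w] by (auto simp: K_def)
    next
      case False
      then have "Y \<le> Im w" by simp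
      then have "\<phi> w < \<phi> z1" using decay sq w by blast
      then show ?thesis using w(1) z0(2)[OF w1(1)] w1(2) by linarith
    qed
  qed
  define y0 where "y0 = Im z0"
  have y0: "y0 \<ge> 1/2" "y0\<^sup>2 \<ge> 3/4" using z0(1) by (auto simp: K_def y0_def)
  \<comment> \<open>1.73 is a rational lower bound for the square root of 3.\<close>
  have "y0 \<ge> 1.73/2"
  proof (rule ccontr)
    assume "\<not> ?thesis"
    then have "y0\<^sup>2 \<le> (1.73/2)\<^sup>2" using y0 by (intro power_mono) auto
    with y0 show False by (simp add: power2_eq_square)
  qed
  \<comment> \<open>Lowering the height of z0 by the factor 1 - t enlarges the circle in q on which
    the maximum principle is applied. The value 3/100 is small enough for (1 + 1.038 t) (1 - t) > 1,
    which is used below.\<close>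
  define t :: real where "t = 3/100"
  define y1 where "y1 = y0 * (1 - t)"
  define r where "r = exp (-2 * pi * y1)"
  have y1: "y1 > 0" "y1 < y0" using y0 by (auto simp: y1_def t_def)
  have r1: "r < 1" using y1 by (simp add: r_def)
  have q0r: "norm (qpar z0) < r" using y1 by (simp add: r_def norm_qpar y0_def[symmetric])
  have "\<exists>q. norm q = r \<and> norm (F (qpar z0)) \<le> norm (F q)"
  proof -
    have sub: "cball 0 r \<subseteq> ball (0::complex) 1" using r1 by (auto simp: dist_norm)
    have "continuous_on (ball 0 1) F" using Fhol by (rule holomorphic_on_imp_continuous_on)
    then have cont: "continuous_on (cball 0 r) F" using sub by (rule continuous_on_subset)
    have "\<exists>q\<in>sphere 0 r. \<forall>x\<in>sphere 0 r. norm (F x) \<le> norm (F q)"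
    proof (rule continuous_attains_sup)
      show "sphere (0::complex) r \<noteq> {}" by (simp add: r_def)
      show "continuous_on (sphere 0 r) (\<lambda>x. norm (F x))"
        by (intro continuous_on_norm continuous_on_subset[OF cont]) auto
    qed auto
    then obtain q where q: "q \<in> sphere 0 r" "\<And>x. x \<in> sphere 0 r \<Longrightarrow> norm (F x) \<le> norm (F q)" by blast
    have "norm (F (qpar z0)) \<le> norm (F q)"
    proof (rule maximum_modulus_frontier[of F "cball 0 r"])
      show "F holomorphic_on interior (cball 0 r)"
        using sub by (intro holomorphic_on_subset[OF Fhol]) auto
      show "continuous_on (closure (cball 0 r)) F" using cont by simp
      show "qpar z0 \<in> cball 0 r" using q0r by simp
      show "norm (F z) \<le> norm (F q)" if "z \<in> frontier (cball 0 r)" for z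
        using that q by (auto simp: frontier_cball)
    qed auto
    with q(1) show ?thesis by auto
  qed
  then obtain q where q: "norm q = r" "norm (F (qpar z0)) \<le> norm (F q)" by blast
  have "norm q > 0" unfolding q(1) r_def by simp
  moreover have "q \<in> ball 0 1" using q(1) r1 by simp
  ultimately obtain z' where z': "z' \<in> uhp" "qpar z' = q" using qpar_surj[of q] by auto
  have "exp (-2 * pi * Im z') = exp (-2 * pi * y1)" using q(1) z'(2) norm_qpar[of z'] by (simp add: r_def)
  then have Imz': "Im z' = y1" by simp
  have z0u: "z0 \<in> uhp" using y0 by (simp add: uhp_def y0_def)
  have form: "\<phi> z = exp (- 4 * pi * Im z) * Im z ^ k * (norm (F (qpar z)))\<^sup>2" if "z \<in> uhp" for z
    using that by (simp add: \<phi>_def fF norm_mult norm_qpar power_mult_distrib exp_double[symmetric])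
  define N where "N = (norm (F (qpar z0)))\<^sup>2"
  have Npos: "N > 0"
  proof -
    have "\<phi> z0 > 0" using \<phi>1 max[OF z1] by linarith
    then show ?thesis unfolding form[OF z0u] N_def by (auto simp: zero_less_mult_iff)
  qed
  have "exp (- 4 * pi * y1) * y1 ^ k * N \<le> \<phi> z'"
    unfolding form[OF z'(1)] Imz' z'(2) N_def using q(2) y1 
    by (intro mult_left_mono power_mono) auto
  also have "\<dots> \<le> exp (- 4 * pi * y0) * y0 ^ k * N"
    using max[OF z'(1)] unfolding form[OF z0u] by (simp add: y0_def N_def)
  finally have "exp (- 4 * pi * y1) * y1 ^ k \<le> exp (- 4 * pi * y0) * y0 ^ k" using Npos by simp
  then have "exp (4 * pi * y0) * (exp (- 4 * pi * y1) * y1 ^ k) \<le> exp (4 * pi * y0) * (exp (- 4 * pi * y0) * y0 ^ k)"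
    by (intro mult_left_mono) auto
  also have "\<dots> = y0 ^ k" by (simp add: exp_minus)
  also have "exp (4 * pi * y0) * (exp (- 4 * pi * y1) * y1 ^ k) = exp (4 * pi * y0 * t) * (1 - t) ^ k * y0 ^ k"
  proof -
    have "4 * pi * y0 + - 4 * pi * y1 = 4 * pi * y0 * t" by (simp add: y1_def algebra_simps)
    then have "exp (4 * pi * y0) * exp (- 4 * pi * y1) = exp (4 * pi * y0 * t)"
      by (simp only: exp_add[symmetric])
    moreover have "y1 ^ k = (1 - t) ^ k * y0 ^ k" by (simp only: y1_def power_mult_distrib mult.commute)
    ultimately show ?thesis by (simp only: mult.assoc[symmetric])
  qed
  finally have le: "exp (4 * pi * y0 * t) * (1 - t) ^ k \<le> 1" using y0 by simp
  \<comment> \<open>Here 10.38 = 12 (1.73 / 2) is a lower bound for 4 pi y0, and a tenth of it still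
    exceeds 1; this gap is what admits weights up to 10.\<close>
  have "(1::real) < ((1 + 1.038 * t) * (1 - t)) ^ 10" by (simp add: t_def one_less_power)
  also have "\<dots> \<le> (exp (1.038 * t) * (1 - t)) ^ 10"
    by (intro power_mono mult_right_mono exp_ge_add_one_self) (auto simp: t_def)
  also have "\<dots> = exp (10.38 * t) * (1 - t) ^ 10"
  proof -
    have "exp (1.038 * t) ^ 10 = exp (10.38 * t)" by (simp add: exp_of_nat_mult[symmetric])
    then show ?thesis by (simp only: power_mult_distrib)
  qed
  also have "\<dots> \<le> exp (4 * pi * y0 * t) * (1 - t) ^ k"
  proof (intro mult_mono power_decreasing)
    have "12 * (1.73 / 2) \<le> (4 * pi) * y0" using pi_ge_3 \<open>y0 \<ge> 1.73/2\<close> by (intro mult_mono) auto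
    then show "exp (10.38 * t) \<le> exp (4 * pi * y0 * t)" by (simp add: t_def)
  qed (use k in \<open>auto simp: t_def\<close>)
  finally show False using le by simp
qed

section \<open>The Lipschitz formula\<close>

lemma summable_int_powr: "(\<lambda>n::int. (1 + \<bar>of_int n\<bar>) powr (- 3/2) :: real) summable_on UNIV"
proof -
  have "summable (\<lambda>n. real n powr (- 3/2))" by (simp add: summable_real_powr_iff)
  then have s: "summable (\<lambda>n. real (Suc n) powr (- 3/2))" by (subst summable_Suc_iff)
  have 1: "(\<lambda>n::int. (1 + \<bar>of_int n\<bar>) powr (- 3/2) :: real) summable_on (range int)"
    by (subst summable_on_reindex) (use s in \<open>auto simp: o_def summable_on_UNIV_nonneg_real_iff add_ac\<close>)
  have 2: "(\<lambda>n::int. (1 + \<bar>of_int n\<bar>) powr (- 3/2) :: real) summable_on (range (\<lambda>n. - int n))"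
    by (subst summable_on_reindex) (use s in \<open>auto simp: o_def summable_on_UNIV_nonneg_real_iff add_ac inj_on_def\<close>)
  have "range int \<union> range (\<lambda>n. - int n) = (UNIV :: int set)"
    by (auto intro: int_cases2)
  then show ?thesis using summable_on_union[OF 1 2] by simp
qed

text \<open>The imaginary part bounds m and the triangle inequality then bounds n, each by a
  multiple of N = |m z + n|. \<open>C\<close> collects the two factors, and the extra 1 costs a
  factor 2 because |m| + |n| >= 1.\<close>

lemma lattice_bound:
  assumes z: "z \<in> uhp"
  obtains \<delta> where "\<delta> > 0"
    "\<And>m n :: int. m \<noteq> 0 \<or> n \<noteq> 0 \<Longrightarrow> \<delta> * (1 + \<bar>of_int m\<bar> + \<bar>of_int n\<bar>) \<le> norm (of_int m * z + of_int n)"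
proof -
  define y where "y = Im z"
  have y: "y > 0" using z by (simp add: y_def uhp_def)
  define C where "C = 1 / y + (1 + norm z / y)"
  have C: "C > 0" using y by (auto simp: C_def intro!: add_pos_nonneg)
  show ?thesis
  proof (rule that[of "1 / (2 * C)"])
    fix m n :: int assume mn: "m \<noteq> 0 \<or> n \<noteq> 0"
    define N where "N = norm (of_int m * z + of_int n)"
    have "\<bar>of_int m * y\<bar> \<le> N" using abs_Im_le_cmod[of "of_int m * z + of_int n"] by (simp add: N_def y_def)
    then have m: "\<bar>of_int m\<bar> \<le> N / y" using y by (simp add: abs_mult field_simps)
    have "norm (of_int n :: complex) \<le> N + norm (of_int m * z)"
      using norm_triangle_ineq4[of "of_int m * z + of_int n" "of_int m * z"] by (simp add: N_def)
    also have "norm (of_int m * z) = \<bar>of_int m\<bar> * norm z" by (simp add: norm_mult)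
    also have "\<dots> \<le> N / y * norm z" using m by (intro mult_right_mono) auto
    finally have n: "\<bar>of_int n\<bar> \<le> N + N / y * norm z" by simp
    have "\<bar>m\<bar> + \<bar>n\<bar> \<ge> 1" using mn by auto
    then have "1 \<le> real_of_int (\<bar>m\<bar> + \<bar>n\<bar>)" by linarith
    then have "1 + \<bar>of_int m\<bar> + \<bar>of_int n\<bar> \<le> 2 * (\<bar>of_int m\<bar> + \<bar>of_int n\<bar> :: real)" by simp
    also have "\<dots> \<le> 2 * (N / y + (N + N / y * norm z))" using m n by simp
    also have "\<dots> = 2 * C * N" by (simp add: C_def algebra_simps)
    finally show "1 / (2 * C) * (1 + \<bar>of_int m\<bar> + \<bar>of_int n\<bar>) \<le> norm (of_int m * z + of_int n)"
      using C by (simp add: N_def field_simps)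
  qed (use C in auto)
qed

text \<open>The exponent 3 is shared equally between the two variables: 3/2 each is still above 1,
  so a double series with cubic decay is dominated by a product of two convergent series.\<close>

lemma powr_three_halves_bounds:
  fixes x y :: real
  assumes "x \<ge> 0" "y \<ge> 0"
  shows "1 / (1 + x + y) ^ 3 \<le> (1 + x) powr (- 3/2) * (1 + y) powr (- 3/2)"
    and "1 / (1 + x) ^ 2 \<le> (1 + x) powr (- 3/2)"
proof -
  have "(1 + x) powr (- 3/2) \<ge> (1 + x + y) powr (- 3/2)" "(1 + y) powr (- 3/2) \<ge> (1 + x + y) powr (- 3/2)"
    using assms by (auto intro!: powr_mono2')
  then have "(1 + x) powr (- 3/2) * (1 + y) powr (- 3/2) \<ge> (1 + x + y) powr (- 3/2) * (1 + x + y) powr (- 3/2)"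
    by (intro mult_mono) auto
  also have "(1 + x + y) powr (- 3/2) * (1 + x + y) powr (- 3/2) = 1 / (1 + x + y) ^ 3"
    using assms by (simp add: powr_add[symmetric] powr_minus powr_realpow' field_simps powr_numeral)
  finally show "1 / (1 + x + y) ^ 3 \<le> (1 + x) powr (- 3/2) * (1 + y) powr (- 3/2)" .
  have "1 / (1 + x) ^ 2 = (1 + x) powr (-2)" using assms by (simp add: powr_minus powr_numeral field_simps)
  also have "\<dots> \<le> (1 + x) powr (- 3/2)" using assms by (intro powr_mono) auto
  finally show "1 / (1 + x) ^ 2 \<le> (1 + x) powr (- 3/2)" .
qed

lemma summable_shifted_inverse_powers:
  assumes z: "z \<in> uhp" and k: "k \<ge> 2"
  shows "(\<lambda>n::int. 1 / (z + of_int n) ^ k) summable_on UNIV"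
proof -
  obtain \<delta> where d: "\<delta> > 0" 
    "\<And>m n :: int. m \<noteq> 0 \<or> n \<noteq> 0 \<Longrightarrow> \<delta> * (1 + \<bar>of_int m\<bar> + \<bar>of_int n\<bar>) \<le> norm (of_int m * z + of_int n)"
    using lattice_bound[OF z] by blast
  have "(\<lambda>n::int. norm (1 / (z + of_int n) ^ k)) summable_on UNIV"
  proof (rule summable_on_comparison_test)
    show "(\<lambda>n::int. (1 / \<delta> ^ k) * (1 + \<bar>of_int n\<bar>) powr (- 3/2)) summable_on UNIV"
      by (intro summable_on_cmult_right summable_int_powr)
    fix n :: int
    have "\<delta> * (1 + \<bar>of_int n\<bar>) \<le> \<delta> * (1 + \<bar>of_int 1\<bar> + \<bar>of_int n\<bar>)" using d(1) by simp
    also have "\<dots> \<le> norm (z + of_int n)" using d(2)[of 1 n] by simp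
    finally have le: "\<delta> * (1 + \<bar>of_int n\<bar>) \<le> norm (z + of_int n)" .
    then have "(\<delta> * (1 + \<bar>of_int n\<bar>)) ^ k \<le> norm (z + of_int n) ^ k"
      using d(1) by (intro power_mono) auto
    then have "1 / norm (z + of_int n) ^ k \<le> 1 / (\<delta> * (1 + \<bar>of_int n\<bar>)) ^ k"
    proof -
      have pos: "0 < \<delta> * (1 + \<bar>real_of_int n\<bar>)" using d(1) by (intro mult_pos_pos) linarith+
      have "0 < norm (z + of_int n)" by (rule less_le_trans[OF pos le])
      then have "0 < norm (z + of_int n) ^ k * (\<delta> * (1 + \<bar>of_int n\<bar>)) ^ k"
        using pos d(1) by (simp del: norm_eq_zero)
      then show ?thesis using \<open>_ \<le> norm (z + of_int n) ^ k\<close> by (intro divide_left_mono) auto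
    qed
    also have "\<dots> = (1 / \<delta> ^ k) * (1 / (1 + \<bar>of_int n\<bar>) ^ k)" by (simp add: power_mult_distrib)
    also have "\<dots> \<le> (1 / \<delta> ^ k) * (1 / (1 + \<bar>of_int n\<bar>) ^ 2)"
      using d(1) k by (intro mult_left_mono divide_left_mono power_increasing) auto
    also have "\<dots> \<le> (1 / \<delta> ^ k) * (1 + \<bar>of_int n\<bar>) powr (- 3/2)"
      using d(1) by (intro mult_left_mono powr_three_halves_bounds) auto
    finally show "norm (1 / (z + of_int n) ^ k) \<le> (1 / \<delta> ^ k) * (1 + \<bar>of_int n\<bar>) powr (- 3/2)"
      by (simp add: norm_divide norm_power)
  qed auto
  then show ?thesis by (rule abs_summable_summable)
qed

text \<open>Cubic decay is the common case: the lattice sums of weight 4 and more are reduced to it,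
  and so is the weight 2 sum after its regularisation.\<close>

lemma summable_lattice_comparison:
  assumes z: "z \<in> uhp" and A: "(0, 0) \<notin> A"
    and le: "\<And>m n. (m, n) \<in> A \<Longrightarrow> norm (f (m, n)) \<le> C / norm (of_int m * z + of_int n) ^ 3"
    and C: "C \<ge> 0"
  shows "(f :: int \<times> int \<Rightarrow> complex) summable_on A"
proof -
  obtain \<delta> where d: "\<delta> > 0" 
    "\<And>m n :: int. m \<noteq> 0 \<or> n \<noteq> 0 \<Longrightarrow> \<delta> * (1 + \<bar>of_int m\<bar> + \<bar>of_int n\<bar>) \<le> norm (of_int m * z + of_int n)"
    using lattice_bound[OF z] by blast
  define a :: "int \<Rightarrow> real" where "a n = (1 + \<bar>of_int n\<bar>) powr (- 3/2)" for n
  have "(\<lambda>(m, n). a m * a n) summable_on UNIV \<times> UNIV"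
  proof (rule summable_on_SigmaI)
    show "((\<lambda>n. case (m, n) of (m, n) \<Rightarrow> a m * a n) has_sum (a m * infsum a UNIV)) UNIV" for m
      unfolding a_def prod.case by (intro has_sum_cmult_right has_sum_infsum summable_int_powr)
    show "(\<lambda>m. a m * infsum a UNIV) summable_on UNIV"
      unfolding a_def by (intro summable_on_cmult_left summable_int_powr)
  qed (auto simp: a_def)
  then have "(\<lambda>(m, n). a m * a n) summable_on A" by (rule summable_on_subset_banach) auto
  then have s: "(\<lambda>p. (C / \<delta> ^ 3) * (case p of (m, n) \<Rightarrow> a m * a n)) summable_on A"
    by (rule summable_on_cmult_right)
  have "(\<lambda>p. norm (f p)) summable_on A"
  proof (rule summable_on_comparison_test[OF s])
    fix p assume "p \<in> A"
    obtain m n where p: "p = (m, n)" by (cases p)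
    have mn: "m \<noteq> 0 \<or> n \<noteq> 0" using \<open>p \<in> A\<close> A p by auto
    define x where "x = 1 + \<bar>real_of_int m\<bar> + \<bar>of_int n\<bar>"
    have x: "x > 0" by (auto simp: x_def)
    have "norm (f p) \<le> C / norm (of_int m * z + of_int n) ^ 3" using le \<open>p \<in> A\<close> p by auto
    also have "\<dots> \<le> C / (\<delta> * x) ^ 3"
    proof -
      have le: "\<delta> * x \<le> norm (of_int m * z + of_int n)" unfolding x_def by (rule d(2)[OF mn])
      have pos: "0 < \<delta> * x" using d(1) x by (rule mult_pos_pos)
      then have "0 < norm (of_int m * z + of_int n)" using le by (rule less_le_trans)
      then have "0 < norm (of_int m * z + of_int n) ^ 3 * (\<delta> * x) ^ 3"
        using d(1) x by simp
      moreover have "(\<delta> * x) ^ 3 \<le> norm (of_int m * z + of_int n) ^ 3" using le pos by (intro power_mono) auto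
      ultimately show ?thesis using C by (intro divide_left_mono)
    qed
    also have "\<dots> = (C / \<delta> ^ 3) * (1 / x ^ 3)" by (simp add: power_mult_distrib)
    also have "\<dots> \<le> (C / \<delta> ^ 3) * (a m * a n)"
      unfolding a_def x_def using d C by (intro mult_left_mono powr_three_halves_bounds) auto
    finally show "norm (f p) \<le> (C / \<delta> ^ 3) * (case p of (m, n) \<Rightarrow> a m * a n)" by (simp add: p)
  qed auto
  then show ?thesis by (rule abs_summable_summable)
qed

text \<open>The polylogarithm of order - s. The summation starts at n = 0, so for s = 0 the
  convention 0 ^ 0 = 1 makes it 1 / (1 - q), while for s >= 1 that term vanishes.\<close>

definition power_polylog :: "nat \<Rightarrow> complex \<Rightarrow> complex" where
  "power_polylog s q = (\<Sum>n. of_nat n ^ s * q ^ n)"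

lemma summable_power_polylog: 
  assumes "norm (q::'a::{real_normed_field,banach}) < 1" 
  shows "summable (\<lambda>n. of_nat n ^ s * q ^ n)"
  using assms
proof (induction s arbitrary: q)
  case (Suc s)
  have "summable (\<lambda>n. diffs (\<lambda>n. of_nat n ^ s) n * q ^ n)"
    by (rule termdiff_converges[OF Suc.prems Suc.IH])
  then have "summable (\<lambda>n. q * (diffs (\<lambda>n. of_nat n ^ s) n * q ^ n))" by (rule summable_mult)
  then have "summable (\<lambda>n. of_nat (Suc n) ^ Suc s * q ^ Suc n)"
    by (simp add: diffs_def mult_ac)
  then show ?case by (subst (asm) summable_Suc_iff)
qed simp

section \<open>Termwise differentiation and the reflection formulas\<close>

lemma has_field_derivative_q_series:
  assumes sm: "\<And>q. norm q < 1 \<Longrightarrow> summable (\<lambda>n. c n * q ^ n)" and z: "z \<in> uhp"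
  shows "((\<lambda>z. \<Sum>n. c n * qpar z ^ n) has_field_derivative (2 * of_real pi * \<i> * (\<Sum>n. of_nat n * c n * qpar z ^ n))) (at z)"
proof -
  have q1: "norm (qpar z) < 1" by (rule norm_qpar_less_1[OF z])
  have d: "((\<lambda>q. \<Sum>n. c n * q ^ n) has_field_derivative (\<Sum>n. diffs c n * qpar z ^ n)) (at (qpar z))"
    by (rule termdiffs_strong'[OF sm q1])
  have "summable (\<lambda>n. diffs c n * qpar z ^ n)" by (rule termdiff_converges[OF q1 sm])
  then have "(\<lambda>n. qpar z * (diffs c n * qpar z ^ n)) sums (qpar z * (\<Sum>n. diffs c n * qpar z ^ n))"
    by (intro sums_mult summable_sums)
  then have "(\<lambda>n. of_nat (Suc n) * c (Suc n) * qpar z ^ Suc n) sums (qpar z * (\<Sum>n. diffs c n * qpar z ^ n))"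
    by (simp add: diffs_def mult_ac)
  then have eq: "(\<Sum>n. of_nat n * c n * qpar z ^ n) = qpar z * (\<Sum>n. diffs c n * qpar z ^ n)"
    using sums_Suc[of "\<lambda>n. of_nat n * c n * qpar z ^ n"] by (auto simp: sums_iff)
  have "((\<lambda>z. \<Sum>n. c n * qpar z ^ n) has_field_derivative
      ((\<Sum>n. diffs c n * qpar z ^ n) * (2 * of_real pi * \<i> * qpar z * 1))) (at z)"
    by (rule DERIV_chain2[OF d has_field_derivative_qpar[OF DERIV_ident]])
  then show ?thesis unfolding eq mult_1_right by (simp only: mult_ac)
qed

text \<open>The derivative of the reflection formula for \<open>rGamma\<close>, which yields the
  cotangent identity in this form without a quotient.\<close>

lemma cot_pi_Digamma:
  fixes z :: complex
  assumes "z \<notin> \<int>"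
  shows "of_real pi * cos (of_real pi * z) = (Digamma (1 - z) - Digamma z) * sin (of_real pi * z)"
proof -
  have nz: "z \<notin> \<int>\<^sub>\<le>\<^sub>0" "1 - z \<notin> \<int>\<^sub>\<le>\<^sub>0" using assms
    by (auto dest: nonpos_Ints_Int)
  have "((\<lambda>z. rGamma z * rGamma (1 - z)) has_field_derivative
     (- rGamma z * Digamma z * rGamma (1 - z) + rGamma z * (rGamma (1 - z) * Digamma (1 - z)))) (at z)"
    using nz by (auto intro!: derivative_eq_intros)
  moreover have "((\<lambda>z. sin (of_real pi * z) / of_real pi) has_field_derivative cos (of_real pi * z)) (at z)"
    by (auto intro!: derivative_eq_intros)
  ultimately have "- rGamma z * Digamma z * rGamma (1 - z) + rGamma z * (rGamma (1 - z) * Digamma (1 - z)) = cos (of_real pi * z)"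
    unfolding rGamma_reflection_complex by (rule DERIV_unique)
  then have "(Digamma (1 - z) - Digamma z) * (rGamma z * rGamma (1 - z)) = cos (of_real pi * z)"
    by (simp add: algebra_simps)
  then show ?thesis unfolding rGamma_reflection_complex by (simp add: field_simps)
qed

lemma uhp_not_Ints: "z \<in> uhp \<Longrightarrow> z \<notin> \<int>"
  by (auto simp: uhp_def elim!: Ints_cases)

lemma Digamma_reflection_uhp:
  assumes z: "z \<in> uhp"
  shows "Digamma (1 - z) - Digamma z = of_real pi * \<i> - 2 * of_real pi * \<i> * power_polylog 0 (qpar z)"
proof -
  define e where "e = exp (\<i> * (of_real pi * z))"
  have e0: "e \<noteq> 0" by (simp add: e_def)
  have q: "qpar z = e\<^sup>2" by (simp add: qpar_def e_def exp_double[symmetric] mult_ac)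
  have q1: "norm (qpar z) < 1" by (rule norm_qpar_less_1[OF z])
  have q1': "e\<^sup>2 \<noteq> 1" using q1 unfolding q by auto
  have s: "sin (of_real pi * z) = (e - inverse e) / (2 * \<i>)" and c: "cos (of_real pi * z) = (e + inverse e) / 2"
    by (simp_all add: sin_exp_eq cos_exp_eq e_def exp_minus)
  define D where "D = Digamma (1 - z) - Digamma z"
  have eq: "of_real pi * ((e + inverse e) / 2) = D * ((e - inverse e) / (2 * \<i>))"
    using cot_pi_Digamma[OF uhp_not_Ints[OF z]] unfolding s c D_def .
  have "\<i> * of_real pi * (e\<^sup>2 + 1) = D * (e\<^sup>2 - 1)"
  proof -
    have "\<i> * of_real pi * (e\<^sup>2 + 1) = (of_real pi * ((e + inverse e) / 2)) * (2 * \<i> * e)"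
      using e0 by (simp add: field_simps power2_eq_square)
    also have "\<dots> = D * ((e - inverse e) / (2 * \<i>)) * (2 * \<i> * e)" by (simp only: eq)
    also have "\<dots> = D * (e\<^sup>2 - 1)" using e0 by (simp add: field_simps power2_eq_square)
    finally show ?thesis .
  qed
  then have D: "D = \<i> * of_real pi * (e\<^sup>2 + 1) / (e\<^sup>2 - 1)" using q1' by (simp add: field_simps)
  have p: "power_polylog 0 (qpar z) = 1 / (1 - qpar z)"
    using suminf_geometric[OF q1] by (simp add: power_polylog_def)
  show ?thesis unfolding D_def[symmetric] D p unfolding q using q1' by (simp add: field_simps)
qed

text \<open>Each differentiation of the case s = 0 multiplies the n-th term by 2 pi i n and kills
  the constant pi i, whence the case distinction.\<close>

lemma Polygamma_reflection_uhp:
  assumes z: "z \<in> uhp"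
  shows "(-1) ^ s * Polygamma s (1 - z) - Polygamma s z
     = (if s = 0 then of_real pi * \<i> else 0) - (2 * of_real pi * \<i>) ^ Suc s * power_polylog s (qpar z)"
  using z
proof (induction s arbitrary: z)
  case 0
  then show ?case using Digamma_reflection_uhp by simp
next
  case (Suc s)
  have nz: "z \<notin> \<int>\<^sub>\<le>\<^sub>0" "1 - z \<notin> \<int>\<^sub>\<le>\<^sub>0" 
    using uhp_not_Ints[OF Suc.prems] nonpos_Ints_Int Ints_diff[OF Ints_1, of "1 - z"] by auto
  have "((\<lambda>z. (-1) ^ s * Polygamma s (1 - z) - Polygamma s z) has_field_derivative
     ((-1) ^ Suc s * Polygamma (Suc s) (1 - z) - Polygamma (Suc s) z)) (at z)"
    using nz by (auto intro!: derivative_eq_intros)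
  moreover have "((\<lambda>z. (if s = 0 then of_real pi * \<i> else 0) - (2 * of_real pi * \<i>) ^ Suc s * power_polylog s (qpar z)) has_field_derivative
     (0 - (2 * of_real pi * \<i>) ^ Suc s * (2 * of_real pi * \<i> * (\<Sum>n. of_nat n * of_nat n ^ s * qpar z ^ n)))) (at z)"
    unfolding power_polylog_def
    by (intro DERIV_diff DERIV_const DERIV_cmult has_field_derivative_q_series summable_power_polylog Suc.prems)
  then have "((\<lambda>z. (-1) ^ s * Polygamma s (1 - z) - Polygamma s z) has_field_derivative
     (0 - (2 * of_real pi * \<i>) ^ Suc s * (2 * of_real pi * \<i> * (\<Sum>n. of_nat n * of_nat n ^ s * qpar z ^ n)))) (at z)"
    by (rule has_field_derivative_transform_within_open[OF _ open_uhp Suc.prems]) (rule Suc.IH[symmetric])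
  ultimately have "(-1) ^ Suc s * Polygamma (Suc s) (1 - z) - Polygamma (Suc s) z
     = 0 - (2 * of_real pi * \<i>) ^ Suc s * (2 * of_real pi * \<i> * (\<Sum>n. of_nat n * of_nat n ^ s * qpar z ^ n))"
    by (rule DERIV_unique)
  then show ?case by (simp add: power_polylog_def mult_ac)
qed

lemma has_sum_int_split:
  fixes f :: "int \<Rightarrow> 'a :: topological_comm_monoid_add"
  assumes "((\<lambda>n. f (int n)) has_sum a) UNIV" "((\<lambda>n. f (- int (Suc n))) has_sum b) UNIV"
  shows "(f has_sum (a + b)) UNIV"
proof -
  have "(f has_sum a) (range int)" using assms(1) by (subst has_sum_reindex) (auto simp: o_def)
  moreover have "(f has_sum b) (range (\<lambda>n. - int (Suc n)))" 
    using assms(2) by (subst has_sum_reindex) (auto simp: o_def inj_on_def)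
  ultimately have "(f has_sum (a + b)) (range int \<union> range (\<lambda>n. - int (Suc n)))"
    by (rule has_sum_Un_disjoint) auto
  also have "range int \<union> range (\<lambda>n. - int (Suc n)) = UNIV"
  proof -
    have "n \<in> range int \<union> range (\<lambda>n. - int (Suc n))" for n by (cases n rule: int_cases) blast+
    then show ?thesis by blast
  qed
  finally show ?thesis .
qed

text \<open>Up to sign and factorial, \<open>Polygamma s z\<close> and
  \<open>Polygamma s (1 - z)\<close> are the sums over n >= 0 and over n < 0, and the reflection
  formula adds them. Absolute convergence is secured beforehand, since the Polygamma series only
  give ordered sums.\<close>

lemma Lipschitz_formula:
  assumes z: "z \<in> uhp" and s: "s \<ge> 1"
  shows "((\<lambda>n::int. 1 / (z + of_int n) ^ Suc s) has_sum
     ((- 2 * of_real pi * \<i>) ^ Suc s / fact s * power_polylog s (qpar z))) UNIV"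
proof -
  have sm: "(\<lambda>n::int. 1 / (z + of_int n) ^ Suc s) summable_on UNIV"
    by (rule summable_shifted_inverse_powers[OF z]) (use s in simp)
  have sm1: "(\<lambda>n. 1 / (z + of_nat n) ^ Suc s) summable_on UNIV"
  proof -
    have "(\<lambda>n::int. 1 / (z + of_int n) ^ Suc s) summable_on range int"
      by (rule summable_on_subset_banach[OF sm]) auto
    then show ?thesis by (subst (asm) summable_on_reindex) (auto simp: o_def)
  qed
  have sm2: "(\<lambda>n. 1 / (z + of_int (- int (Suc n))) ^ Suc s) summable_on UNIV"
  proof -
    have "(\<lambda>n::int. 1 / (z + of_int n) ^ Suc s) summable_on range (\<lambda>n. - int (Suc n))"
      by (rule summable_on_subset_banach[OF sm]) auto
    then show ?thesis by (subst (asm) summable_on_reindex) (auto simp: o_def inj_on_def)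
  qed
  define A where "A = (\<Sum>k. inverse ((z + of_nat k) ^ Suc s))"
  define B where "B = (\<Sum>k. inverse ((1 - z + of_nat k) ^ Suc s))"
  have "z \<noteq> 0" "1 - z \<noteq> 0" using z by (auto simp: uhp_def)
  then have "(\<lambda>k. inverse ((z + of_nat k) ^ Suc s)) sums A" "(\<lambda>k. inverse ((1 - z + of_nat k) ^ Suc s)) sums B"
    unfolding A_def B_def by (intro summable_sums Polygamma_converges'; use s in simp)+
  then have sA: "(\<lambda>k. 1 / (z + of_nat k) ^ Suc s) sums A" 
    and sB: "(\<lambda>k. (-1) ^ Suc s * inverse ((1 - z + of_nat k) ^ Suc s)) sums ((-1) ^ Suc s * B)"
    by (simp only: inverse_eq_divide, intro sums_mult)
  have m: "(-1) ^ Suc s * inverse ((1 - z + of_nat k) ^ Suc s) = 1 / (z + of_int (- int (Suc k))) ^ Suc s" for k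
  proof -
    have "z + of_int (- int (Suc k)) = (-1) * (1 - z + of_nat k)" by simp
    then have "(z + of_int (- int (Suc k))) ^ Suc s = (-1) ^ Suc s * (1 - z + of_nat k) ^ Suc s"
      by (simp only: power_mult_distrib)
    moreover have "(-1) ^ Suc s * inverse V = 1 / ((-1) ^ Suc s * V)" for V :: complex
      by (simp add: minus_one_power_iff inverse_eq_divide)
    ultimately show ?thesis by (simp only:)
  qed
  have hA: "((\<lambda>n. 1 / (z + of_int (int n)) ^ Suc s) has_sum A) UNIV"
    using has_sum_infsum[OF sm1] has_sum_imp_sums[OF has_sum_infsum[OF sm1]] sums_unique2[OF sA] by simp
  have hB: "((\<lambda>n. 1 / (z + of_int (- int (Suc n))) ^ Suc s) has_sum ((-1) ^ Suc s * B)) UNIV"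
    using has_sum_infsum[OF sm2] sums_unique2[OF sB[unfolded m] has_sum_imp_sums[OF has_sum_infsum[OF sm2]]] by simp
  have "(-1) ^ s * Polygamma s (1 - z) - Polygamma s z = - ((2 * of_real pi * \<i>) ^ Suc s * power_polylog s (qpar z))"
    using Polygamma_reflection_uhp[OF z, of s] s by simp
  moreover have "Polygamma s z = (-1) ^ Suc s * fact s * A" "Polygamma s (1 - z) = (-1) ^ Suc s * fact s * B"
    using s by (simp_all add: Polygamma_def A_def B_def)
  ultimately have "fact s * (A + (-1) ^ Suc s * B) = (-1) ^ Suc s * ((2 * of_real pi * \<i>) ^ Suc s * power_polylog s (qpar z))"
    by (simp add: minus_one_power_iff algebra_simps split: if_splits)
  also have "\<dots> = (- 2 * of_real pi * \<i>) ^ Suc s * power_polylog s (qpar z)"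
  proof -
    have "- 2 * of_real pi * \<i> = (-1) * (2 * of_real pi * \<i>)" by simp
    then show ?thesis by (simp only: power_mult_distrib mult.assoc)
  qed
  finally have "A + (-1) ^ Suc s * B = (- 2 * of_real pi * \<i>) ^ Suc s / fact s * power_polylog s (qpar z)"
    by (simp add: field_simps)
  with has_sum_int_split[OF hA hB] show ?thesis by simp
qed

section \<open>Lattice sums\<close>

definition sigma_series :: "nat \<Rightarrow> complex \<Rightarrow> complex" where
  "sigma_series s q = (\<Sum>n. of_nat (divisor_power_sum s n) * q ^ n)"

text \<open>Every number divides 0, and a sum over an infinite set is 0 by default; so
  \<open>sigma_series\<close> has no constant term.\<close>

lemma divisor_power_sum_0 [simp]: "divisor_power_sum s 0 = 0"
  by (simp add: divisor_power_sum_def)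

lemma finite_divisors_Suc: "finite {d. d dvd Suc n}"
  by (rule finite_subset[of _ "{..Suc n}"]) (auto dest: dvd_imp_le)

text \<open>The exponent (m + 1) (r + 1) is at least m + r, so the double series is dominated by the
  product of a geometric and a polynomially weighted geometric series.\<close>

lemma Lambert_summable:
  assumes q: "norm (q::complex) < 1"
  shows "(\<lambda>(m, r). of_nat (Suc r) ^ s * q ^ (Suc m * Suc r)) summable_on UNIV \<times> (UNIV :: nat set)"
proof -
  define x where "x = norm q"
  have x: "0 \<le> x" "x < 1" using q by (auto simp: x_def)
  have s1: "summable (\<lambda>m. x ^ m)" using x by simp
  have "summable (\<lambda>n. of_nat (Suc n) ^ s * x ^ n)"
  proof (cases "x = 0")
    case True
    have "summable (\<lambda>n. real (Suc n) ^ s * 0 ^ n)" by (rule summable_finite[of "{0}"]) auto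
    then show ?thesis using True by simp
  next
    case False
    have "summable (\<lambda>n. of_nat (Suc n) ^ s * x ^ Suc n)"
      using summable_power_polylog[of x s] x by (subst summable_Suc_iff[of "\<lambda>n. of_nat n ^ s * x ^ n"]) simp
    then have "summable (\<lambda>n. (1 / x) * (of_nat (Suc n) ^ s * x ^ Suc n))" by (rule summable_mult)
    moreover have "(1 / x) * (of_nat (Suc n) ^ s * x ^ Suc n) = of_nat (Suc n) ^ s * x ^ n" for n
      using False by simp
    ultimately show ?thesis by simp
  qed
  then have s2: "(\<lambda>n. of_nat (Suc n) ^ s * x ^ n) summable_on UNIV"
    using x by (subst summable_on_UNIV_nonneg_real_iff) auto
  have s1': "(\<lambda>m. x ^ m) summable_on UNIV"
    using x s1 by (subst summable_on_UNIV_nonneg_real_iff) auto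
  have main: "(\<lambda>(m, r). x ^ m * (of_nat (Suc r) ^ s * x ^ r)) summable_on UNIV \<times> (UNIV::nat set)"
  proof (rule summable_on_SigmaI)
    show "((\<lambda>r. case (m, r) of (m, r) \<Rightarrow> x ^ m * (of_nat (Suc r) ^ s * x ^ r)) has_sum 
      (x ^ m * infsum (\<lambda>r. of_nat (Suc r) ^ s * x ^ r) UNIV)) UNIV" for m
      unfolding prod.case by (intro has_sum_cmult_right has_sum_infsum s2)
    show "(\<lambda>m. x ^ m * infsum (\<lambda>r. of_nat (Suc r) ^ s * x ^ r) UNIV) summable_on UNIV"
      by (intro summable_on_cmult_left s1')
  qed (use x in auto)
  have "(\<lambda>p. norm (case p of (m, r) \<Rightarrow> of_nat (Suc r) ^ s * q ^ (Suc m * Suc r))) summable_on UNIV \<times> UNIV"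
  proof (rule summable_on_comparison_test[OF main])
    fix p :: "nat \<times> nat"
    obtain m r where p: "p = (m, r)" by (cases p)
    have "x ^ (Suc m * Suc r) \<le> x ^ (m + r)" using x by (intro power_decreasing) auto
    then have "of_nat (Suc r) ^ s * x ^ (Suc m * Suc r) \<le> of_nat (Suc r) ^ s * x ^ (m + r)"
      by (intro mult_left_mono) auto
    then have "norm (of_nat (Suc r) ^ s * q ^ (Suc m * Suc r)) \<le> of_nat (Suc r) ^ s * x ^ (m + r)"
      by (simp only: norm_mult norm_power norm_of_nat x_def)
    then show "norm (case p of (m, r) \<Rightarrow> of_nat (Suc r) ^ s * q ^ (Suc m * Suc r))
       \<le> (case p of (m, r) \<Rightarrow> x ^ m * (of_nat (Suc r) ^ s * x ^ r))"
      by (simp add: p power_add mult_ac)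
  qed auto
  then show ?thesis by (rule abs_summable_summable)
qed

text \<open>The absolutely convergent sum over pairs is taken once row by row and once along the
  fibres of (m + 1) (r + 1), on which d = r + 1 runs through the divisors.\<close>

lemma Lambert_has_sum:
  assumes q: "norm (q::complex) < 1" and s: "s \<ge> 1"
  shows "((\<lambda>m. power_polylog s (q ^ Suc m)) has_sum sigma_series s q) UNIV"
    and "summable (\<lambda>n. of_nat (divisor_power_sum s n) * q ^ n)"
proof -
  define f where "f = (\<lambda>(m::nat, r::nat). of_nat (Suc r) ^ s * q ^ (Suc m * Suc r))"
  define S where "S = infsum f (UNIV \<times> UNIV)"
  have fs: "(f has_sum S) (UNIV \<times> UNIV)"
    unfolding S_def f_def by (intro has_sum_infsum Lambert_summable q)
  have row: "((\<lambda>r. f (m, r)) has_sum power_polylog s (q ^ Suc m)) UNIV" for m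
  proof -
    have q': "norm (q ^ Suc m) < 1" using q by (simp add: norm_power power_less_one_iff del: power_Suc)
    have a: "summable (\<lambda>n. norm (of_nat (Suc n) ^ s * (q ^ Suc m) ^ Suc n))"
      using summable_power_polylog[of "norm (q ^ Suc m)" s] q' 
      by (subst summable_Suc_iff[of "\<lambda>n. norm (of_nat n ^ s * (q ^ Suc m) ^ n)"]) (simp add: norm_mult norm_power)
    have "(\<lambda>n. of_nat n ^ s * (q ^ Suc m) ^ n) sums power_polylog s (q ^ Suc m)"
      unfolding power_polylog_def by (rule summable_sums[OF summable_power_polylog[OF q']])
    moreover have "of_nat 0 ^ s * (q ^ Suc m) ^ 0 = (0::complex)" using s by (simp add: power_0_left)
    ultimately have "(\<lambda>n. of_nat (Suc n) ^ s * (q ^ Suc m) ^ Suc n) sums power_polylog s (q ^ Suc m)"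
      by (subst sums_Suc_iff) (simp only: add_0_right)
    from norm_summable_imp_has_sum[OF a this] show ?thesis 
      by (simp add: f_def power_mult[symmetric] del: power_Suc mult_Suc mult_Suc_right)
  qed
  have polylog: "((\<lambda>m. power_polylog s (q ^ Suc m)) has_sum S) UNIV"
    by (rule has_sum_Sigma'[OF fs row])
  \<comment> \<open>All indices are shifted by one: the pair (n, d) stands for a divisor d of n +
    1.\<close>
  let ?j = "\<lambda>(m, r). (Suc m * Suc r - 1, Suc r)" and ?i = "\<lambda>(n, d). (Suc n div d - 1, d - 1)"
  have "(f has_sum S) (UNIV \<times> UNIV) \<longleftrightarrow>
    ((\<lambda>(n, d). of_nat d ^ s * q ^ Suc n) has_sum S) (Sigma UNIV (\<lambda>n. {d. d dvd Suc n}))"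
  proof (rule has_sum_reindex_bij_witness[where i = ?i and j = ?j])
    show "?i (?j a) = a" if "a \<in> UNIV \<times> UNIV" for a
    proof -
      obtain m r where a: "a = (m, r)" by (cases a)
      have e: "Suc (Suc m * Suc r - 1) = Suc m * Suc r" by simp
      have "Suc (Suc m * Suc r - 1) div Suc r = Suc m"
        unfolding e by (rule nonzero_mult_div_cancel_right) simp
      then show ?thesis by (simp only: a prod.case diff_Suc_1)
    qed
    show "?j a \<in> Sigma UNIV (\<lambda>n. {d. d dvd Suc n})" if "a \<in> UNIV \<times> UNIV" for a 
    proof -
      obtain m r where a: "a = (m, r)" by (cases a)
      have e: "Suc (Suc m * Suc r - 1) = Suc m * Suc r" by simp
      have "Suc r dvd Suc (Suc m * Suc r - 1)" unfolding e by (rule dvd_triv_right)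
      then show ?thesis by (simp only: a prod.case) blast
    qed
    show "?i b \<in> UNIV \<times> UNIV" for b by (cases b) simp
    show "?j (?i b) = b" if b: "b \<in> Sigma UNIV (\<lambda>n. {d. d dvd Suc n})" for b
    proof -
      obtain n d where nd: "b = (n, d)" by (cases b)
      then obtain e where e: "Suc n = d * e" using b by (auto elim: dvdE)
      then have "d > 0" "e > 0" by (auto intro: ccontr)
      then have "Suc n div d = e" "Suc (e - 1) = e" "Suc (d - 1) = d" using e by simp_all
      moreover have "e * d - 1 = n" using e by (metis diff_Suc_1 mult.commute)
      ultimately show ?thesis by (simp only: nd prod.case)
    qed
    show "(case ?j a of (n, d) \<Rightarrow> of_nat d ^ s * q ^ Suc n) = f a" if "a \<in> UNIV \<times> UNIV" for a
      by (cases a) (simp add: f_def)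
  qed simp
  with fs have "((\<lambda>(n, d). of_nat d ^ s * q ^ Suc n) has_sum S) (Sigma UNIV (\<lambda>n. {d. d dvd Suc n}))"
    by blast
  moreover have "((\<lambda>d. case (n, d) of (n, d) \<Rightarrow> of_nat d ^ s * q ^ Suc n) has_sum 
      (of_nat (divisor_power_sum s (Suc n)) * q ^ Suc n)) {d. d dvd Suc n}" for n
  proof (rule has_sum_finiteI)
    show "of_nat (divisor_power_sum s (Suc n)) * q ^ Suc n = (\<Sum>d | d dvd Suc n. case (n, d) of (n, d) \<Rightarrow> of_nat d ^ s * q ^ Suc n)"
      by (simp add: divisor_power_sum_def sum_distrib_right)
  qed (rule finite_divisors_Suc)
  ultimately have "((\<lambda>n. of_nat (divisor_power_sum s (Suc n)) * q ^ Suc n) has_sum S) UNIV"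
    by (rule has_sum_Sigma')
  then have "(\<lambda>n. of_nat (divisor_power_sum s (Suc n)) * q ^ Suc n) sums S" by (rule has_sum_imp_sums)
  then have sm: "(\<lambda>n. of_nat (divisor_power_sum s n) * q ^ n) sums S"
    by (subst (asm) sums_Suc_iff) simp
  then show "summable (\<lambda>n. of_nat (divisor_power_sum s n) * q ^ n)" by (rule sums_summable)
  show "((\<lambda>m. power_polylog s (q ^ Suc m)) has_sum sigma_series s q) UNIV"
    using polylog sm by (simp add: sigma_series_def sums_iff)
qed

section \<open>Fourier expansion of the absolutely convergent lattice sums\<close>

lemma has_sum_int_nonzero_even:
  fixes h :: "int \<Rightarrow> complex"
  assumes even: "\<And>n. h (- n) = h n" and S: "((\<lambda>n. h (int (Suc n))) has_sum S) UNIV"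
  shows "(h has_sum (2 * S)) (- {0})"
proof -
  have "(h has_sum S) (range (\<lambda>n. int (Suc n)))" 
    using S by (subst has_sum_reindex) (auto simp: o_def inj_on_def)
  moreover have "(h has_sum S) (range (\<lambda>n. - int (Suc n)))" 
    using S by (subst has_sum_reindex) (auto simp: o_def inj_on_def even simp del: of_nat_Suc)
  ultimately have "(h has_sum (S + S)) (range (\<lambda>n. int (Suc n)) \<union> range (\<lambda>n. - int (Suc n)))"
    by (rule has_sum_Un_disjoint) auto
  also have "range (\<lambda>n. int (Suc n)) \<union> range (\<lambda>n. - int (Suc n)) = - {0}"
  proof -
    have "n \<in> range (\<lambda>n. int (Suc n)) \<union> range (\<lambda>n. - int (Suc n))" if "n \<noteq> 0" for n :: int
    proof (cases n rule: int_cases)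
      case (nonneg k)
      with that show ?thesis by (cases k) auto
    qed blast
    then show ?thesis by auto
  qed
  finally show ?thesis by simp
qed

text \<open>For m > 0 this is the Lipschitz formula at m z; for m < 0 the sign of m is undone by n
  -> - n, the exponent s + 1 being even.\<close>

lemma lattice_row_has_sum:
  assumes z: "z \<in> uhp" and s: "odd s" and m: "m \<noteq> 0"
  shows "((\<lambda>n::int. 1 / (of_int m * z + of_int n) ^ Suc s) has_sum
     ((- 2 * of_real pi * \<i>) ^ Suc s / fact s * power_polylog s (qpar z ^ nat \<bar>m\<bar>))) UNIV"
proof -
  have zm: "of_nat (nat \<bar>m\<bar>) * z \<in> uhp" using z m by (simp add: uhp_def)
  have L: "((\<lambda>n::int. 1 / (of_nat (nat \<bar>m\<bar>) * z + of_int n) ^ Suc s) has_sum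
     ((- 2 * of_real pi * \<i>) ^ Suc s / fact s * power_polylog s (qpar z ^ nat \<bar>m\<bar>))) UNIV"
    using Lipschitz_formula[OF zm, of s] s unfolding qpar_of_nat_mult by (auto elim: oddE)
  show ?thesis
  proof (cases "m > 0")
    case True
    then show ?thesis using L by simp
  next
    case False
    have "bij (uminus :: int \<Rightarrow> int)" by (rule bij_uminus)
    have eq: "1 / (of_nat (nat \<bar>m\<bar>) * z + of_int (- n)) ^ Suc s = 1 / (of_int m * z + of_int n) ^ Suc s" for n
    proof -
      have "of_nat (nat \<bar>m\<bar>) * z + of_int (- n) = - (of_int m * z + of_int n)" using False by simp
      moreover have "even (Suc s)" using s by simp
      ultimately show ?thesis by (simp only: power_minus_even)
    qed
    show ?thesis using L
      by (subst (asm) has_sum_reindex_bij_betw[OF \<open>bij uminus\<close>, symmetric]) (simp only: eq)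
  qed
qed

text \<open>The row m = 0 gives the constant term; every other row is a polylogarithm at a power of
  q, and the two signs of m give the factor 2.\<close>

lemma lattice_sum_Fourier:
  assumes z: "z \<in> uhp" and s: "odd s" "s \<ge> 3"
  shows "((\<lambda>(m::int, n::int). 1 / (of_int m * z + of_int n) ^ Suc s) has_sum
     (infsum (\<lambda>n::int. 1 / of_int n ^ Suc s) (- {0}) + 
       2 * ((- 2 * of_real pi * \<i>) ^ Suc s / fact s) * sigma_series s (qpar z))) (- {(0, 0)})"
proof -
  define f where "f = (\<lambda>(m::int, n::int). 1 / (of_int m * z + of_int n) ^ Suc s)"
  define c where "c = (- 2 * of_real pi * \<i>) ^ Suc s / fact s"
  obtain \<delta> where d: "\<delta> > 0" 
    "\<And>m n :: int. m \<noteq> 0 \<or> n \<noteq> 0 \<Longrightarrow> \<delta> * (1 + \<bar>of_int m\<bar> + \<bar>of_int n\<bar>) \<le> norm (of_int m * z + of_int n)"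
    using lattice_bound[OF z] by blast
  have sm: "f summable_on (- {(0, 0)})"
  proof (rule summable_lattice_comparison[OF z])
    fix m n :: int assume "(m, n) \<in> - {(0, 0)}"
    then have mn: "m \<noteq> 0 \<or> n \<noteq> 0" by auto
    define x where "x = norm (of_int m * z + of_int n)"
    have "\<delta> * 1 \<le> \<delta> * (1 + \<bar>of_int m\<bar> + \<bar>of_int n\<bar>)" using d(1) by (intro mult_left_mono) auto
    also have "\<dots> \<le> x" unfolding x_def using d(2)[OF mn] .
    finally have x: "\<delta> \<le> x" by simp
    \<comment> \<open>Three of the s + 1 powers give the cubic decay; the remaining s - 2 are
      bounded by powers of \<delta>.\<close>
    have "1 / x ^ Suc s = 1 / x ^ (s - 2) * (1 / x ^ 3)"
      using s by (simp add: power_add[symmetric])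
    also have "\<dots> \<le> 1 / \<delta> ^ (s - 2) * (1 / x ^ 3)"
      using x d(1) by (intro mult_right_mono divide_left_mono power_mono mult_pos_pos zero_less_power) auto
    finally show "norm (f (m, n)) \<le> (1 / \<delta> ^ (s - 2)) / norm (of_int m * z + of_int n) ^ 3"
      by (simp add: f_def norm_divide norm_power x_def del: power_Suc)
  qed (use d in auto)
  have s1: "f summable_on ({0} \<times> (- {0}))" and s2: "f summable_on ((- {0}) \<times> UNIV)"
    by (rule summable_on_subset_banach[OF sm]; auto)+
  have h2: "(f has_sum (2 * c * sigma_series s (qpar z))) ((- {0}) \<times> UNIV)"
  proof -
    have fs: "(f has_sum infsum f ((- {0}) \<times> UNIV)) ((- {0}) \<times> UNIV)" using s2 by (rule has_sum_infsum)
    have "((\<lambda>m. c * power_polylog s (qpar z ^ nat \<bar>m\<bar>)) has_sum infsum f ((- {0}) \<times> UNIV)) (- {0})"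
    proof (rule has_sum_Sigma'[OF fs])
      show "((\<lambda>n. f (m, n)) has_sum c * power_polylog s (qpar z ^ nat \<bar>m\<bar>)) UNIV" if "m \<in> - {0}" for m
        using lattice_row_has_sum[OF z s(1), of m] that by (simp add: f_def c_def)
    qed
    moreover have "((\<lambda>m. c * power_polylog s (qpar z ^ nat \<bar>m\<bar>)) has_sum 2 * (c * sigma_series s (qpar z))) (- {0})"
    proof (rule has_sum_int_nonzero_even)
      have "((\<lambda>n. c * power_polylog s (qpar z ^ Suc n)) has_sum c * sigma_series s (qpar z)) UNIV"
        using s by (intro has_sum_cmult_right Lambert_has_sum norm_qpar_less_1 z) auto
      moreover have "nat \<bar>int (Suc n)\<bar> = Suc n" for n by simp
      ultimately show "((\<lambda>n. c * power_polylog s (qpar z ^ nat \<bar>int (Suc n)\<bar>)) has_sum c * sigma_series s (qpar z)) UNIV"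
        by (simp only:)
    qed simp
    ultimately have "infsum f ((- {0}) \<times> UNIV) = 2 * (c * sigma_series s (qpar z))" by (rule has_sum_unique)
    then show ?thesis using fs by (simp add: mult_ac)
  qed
  have h1: "(f has_sum infsum (\<lambda>n::int. 1 / of_int n ^ Suc s) (- {0})) ({0} \<times> (- {0}))"
  proof -
    have "infsum f ({0} \<times> (- {0})) = infsum (f \<circ> Pair 0) (- {0})"
      by (subst infsum_reindex[symmetric]) (auto simp: inj_on_def intro!: arg_cong[of _ _ "infsum f"])
    also have "f \<circ> Pair 0 = (\<lambda>n::int. 1 / of_int n ^ Suc s)" by (auto simp: f_def)
    finally show ?thesis using has_sum_infsum[OF s1] by simp
  qed
  have "(f has_sum (infsum (\<lambda>n::int. 1 / of_int n ^ Suc s) (- {0}) + 2 * c * sigma_series s (qpar z)))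
     (({0} \<times> (- {0})) \<union> ((- {0}) \<times> UNIV))"
    by (rule has_sum_Un_disjoint[OF h1 h2]) auto
  also have "({0} \<times> (- {0})) \<union> ((- {0}) \<times> UNIV) = - {(0::int, 0::int)}" by auto
  finally show ?thesis by (simp add: f_def c_def)
qed

text \<open>The lattice sum for - 1 / z is a permutation of that for z, by (m, n) -> (- n, m). The
  constant A stays unevaluated: it is a rational multiple of a zeta value over a power of pi, and
  \<open>sigma_series_identify\<close> recovers it from q-coefficients.\<close>

lemma sigma_series_modular:
  assumes s: "odd s" "s \<ge> 3"
  obtains A where "\<And>z. z \<in> uhp \<Longrightarrow> A + sigma_series s (qpar (- 1 / z)) = z ^ Suc s * (A + sigma_series s (qpar z))"
proof -
  define c where "c = 2 * ((- 2 * of_real pi * \<i>) ^ Suc s / fact s)"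
  define A where "A = infsum (\<lambda>n::int. 1 / complex_of_int n ^ Suc s) (- {0})"
  have c: "c \<noteq> 0" by (simp add: c_def)
  have "A / c + sigma_series s (qpar (- 1 / z)) = z ^ Suc s * (A / c + sigma_series s (qpar z))" if z: "z \<in> uhp" for z
  proof -
    have z0: "z \<noteq> 0" using z uhp_nonzero by auto
    define f where "f z = (\<lambda>(m::int, n::int). 1 / (of_int m * z + of_int n) ^ Suc s)" for z :: complex
    have h: "(f z has_sum (A + c * sigma_series s (qpar z))) (- {(0, 0)})" if "z \<in> uhp" for z
      using lattice_sum_Fourier[OF that s] by (simp add: f_def A_def c_def)
    have "((\<lambda>p. z ^ Suc s * f z p) has_sum (z ^ Suc s * (A + c * sigma_series s (qpar z)))) (- {(0, 0)})"
      by (intro has_sum_cmult_right h z)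
    also have "?this \<longleftrightarrow> (f (- 1 / z) has_sum (z ^ Suc s * (A + c * sigma_series s (qpar z)))) (- {(0, 0)})"
    proof (rule has_sum_reindex_bij_witness[of _ "\<lambda>(m, n). (n, - m)" "\<lambda>(m, n). (- n, m)"])
      fix p :: "int \<times> int"
      obtain m n where p: "p = (m, n)" by (cases p)
      have "of_int (- n) * (- 1 / z) + of_int m = (of_int m * z + of_int n) / z"
        using z0 by (simp add: field_simps)
      then show "f (- 1 / z) (case p of (m, n) \<Rightarrow> (- n, m)) = z ^ Suc s * f z p"
        by (simp only: p f_def prod.case power_divide) (simp del: power_Suc)
    qed auto
    finally have "A + c * sigma_series s (qpar (- 1 / z)) = z ^ Suc s * (A + c * sigma_series s (qpar z))"
      using has_sum_unique[OF h[OF uhp_minus_inverse[OF z]]] by blast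
    then have "(A + c * sigma_series s (qpar (- 1 / z))) / c = z ^ Suc s * (A + c * sigma_series s (qpar z)) / c"
      by simp
    then show ?thesis using c by (simp add: add_divide_distrib distrib_left)
  qed
  then show ?thesis using that by blast
qed

section \<open>The transformation of the quasimodular Eisenstein series\<close>

lemma has_sum_diff:
  fixes f g :: "'a \<Rightarrow> 'b :: real_normed_vector"
  assumes "(f has_sum a) A" "(g has_sum b) A"
  shows "((\<lambda>x. f x - g x) has_sum (a - b)) A"
proof -
  have "((\<lambda>x. - g x) has_sum (- b)) A" using assms(2) by (simp add: has_sum_uminus)
  from has_sum_add[OF assms(1) this] show ?thesis by simp
qed

lemma has_sum_sum:
  fixes f :: "'i \<Rightarrow> 'a \<Rightarrow> 'b :: real_normed_vector"
  assumes "\<And>i. i \<in> I \<Longrightarrow> (f i has_sum s i) A"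
  shows "((\<lambda>x. \<Sum>i\<in>I. f i x) has_sum (\<Sum>i\<in>I. s i)) A"
  using assms
proof (induction I rule: infinite_finite_induct)
  case (insert i I)
  then have "(f i has_sum s i) A" "((\<lambda>x. \<Sum>i\<in>I. f i x) has_sum (\<Sum>i\<in>I. s i)) A" by auto
  from has_sum_add[OF this] insert(1,2) show ?case by simp
qed auto

text \<open>Both halves telescope, to 1 / w and - 1 / w, as 1 / (w + n) tends to 0 in both
  directions.\<close>

lemma has_sum_int_shift_telescope:
  fixes w :: complex
  assumes w: "Im w \<noteq> 0" and sm: "(\<lambda>n::int. 1 / (w + of_int n) - 1 / (w + of_int n + 1)) summable_on UNIV"
  shows "((\<lambda>n::int. 1 / (w + of_int n) - 1 / (w + of_int n + 1)) has_sum 0) UNIV"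
proof -
  define f where "f n = 1 / (w + of_int n) - 1 / (w + of_int n + 1)" for n :: int
  have "f summable_on (range int)" "f summable_on (range (\<lambda>n. - int (Suc n)))"
    by (rule summable_on_subset_banach[OF sm[folded f_def]]; simp)+
  then have "(\<lambda>n. f (int n)) summable_on UNIV" "(\<lambda>n. f (- int (Suc n))) summable_on UNIV"
    by (subst (asm) summable_on_reindex; auto simp: o_def inj_on_def)+
  then obtain a b where ab: "((\<lambda>n. f (int n)) has_sum a) UNIV" "((\<lambda>n. f (- int (Suc n))) has_sum b) UNIV"
    using has_sum_infsum by blast
  have lim: "(\<lambda>n. 1 / (w + of_nat n)) \<longlonglongrightarrow> 0" "(\<lambda>n. 1 / (w - of_nat n)) \<longlonglongrightarrow> 0"
  proof -
    show "(\<lambda>n. 1 / (w + of_nat n)) \<longlonglongrightarrow> 0"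
      by (intro tendsto_divide_0[OF tendsto_const] tendsto_add_filterlim_at_infinity[OF tendsto_const] tendsto_of_nat)
    have "(\<lambda>n. - (1 / (- w + of_nat n))) \<longlonglongrightarrow> - 0"
      by (intro tendsto_minus tendsto_divide_0[OF tendsto_const] tendsto_add_filterlim_at_infinity[OF tendsto_const] tendsto_of_nat)
    moreover have "- (1 / (- w + of_nat n)) = 1 / (w - of_nat n)" for n 
      by (metis add.commute minus_diff_eq minus_divide_right uminus_add_conv_diff)
    ultimately show "(\<lambda>n. 1 / (w - of_nat n)) \<longlonglongrightarrow> 0" by simp
  qed
  have "(\<lambda>n. 1 / (w + of_nat n) - 1 / (w + of_nat (Suc n))) sums (1 / (w + of_nat 0) - 0)"
    by (rule telescope_sums'[OF lim(1)])
  then have "(\<lambda>n. f (int n)) sums (1 / w)" by (simp add: f_def add_ac)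
  then have a: "a = 1 / w" using has_sum_imp_sums[OF ab(1)] sums_unique2 by blast
  have "(\<lambda>n. 1 / (w - of_nat (Suc n)) - 1 / (w - of_nat n)) sums (0 - 1 / (w - of_nat 0))"
    by (rule telescope_sums[OF lim(2)])
  moreover have "1 / (w - of_nat (Suc n)) - 1 / (w - of_nat n) = f (- int (Suc n))" for n
    by (simp add: f_def algebra_simps)
  ultimately have "(\<lambda>n. f (- int (Suc n))) sums (- (1 / w))" by simp
  then have b: "b = - (1 / w)" using has_sum_imp_sums[OF ab(2)] sums_unique2 by blast
  show ?thesis using has_sum_int_split[of f, OF ab] by (simp add: f_def[abs_def] a b)
qed

lemma has_sum_inverse_squares_int: "((\<lambda>n::int. 1 / (of_int n)\<^sup>2) has_sum (of_real pi ^ 2 / 3 :: complex)) (- {0})"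
proof -
  have "(\<lambda>n. 1 / (real n + 1)\<^sup>2) sums (pi\<^sup>2 / 6)"
    using inverse_squares_sums by (simp add: add_ac)
  then have "((\<lambda>n. 1 / (real n + 1)\<^sup>2) has_sum (pi\<^sup>2 / 6)) UNIV"
    by (rule sums_nonneg_imp_has_sum) simp
  then have "((\<lambda>n. complex_of_real (1 / (real n + 1)\<^sup>2)) has_sum of_real (pi\<^sup>2 / 6)) UNIV"
    by (rule has_sum_of_real)
  then have "((\<lambda>n. 1 / (of_int (int (Suc n)))\<^sup>2 :: complex) has_sum of_real (pi\<^sup>2 / 6)) UNIV"
    by (simp add: add_ac)
  from has_sum_int_nonzero_even[OF _ this] show ?thesis by simp
qed

text \<open>The partial fraction expansion of pi cot(pi y) without its term 1 / y, doubled because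
  both signs of m occur. The Digamma series give it as an ordered sum, and the assumed summability
  makes the order irrelevant.\<close>

lemma symmetric_partial_fractions:
  assumes y: "y \<in> uhp" and sm: "(\<lambda>m::int. 1 / (y + of_int m) + 1 / (y - of_int m)) summable_on (- {0})"
  shows "((\<lambda>m::int. 1 / (y + of_int m) + 1 / (y - of_int m)) has_sum
     (2 * (of_real pi * \<i> - 2 * of_real pi * \<i> * power_polylog 0 (qpar y) - 1 / y))) (- {0})"
proof -
  define f where "f m = 1 / (y + of_int m) + 1 / (y - of_int m)" for m :: int
  have y0: "y \<noteq> 0" using y uhp_nonzero by auto
  have nz: "1 + y \<noteq> 0" "1 - y \<noteq> 0" using y by (auto simp: uhp_def complex_eq_iff)
  have "(\<lambda>k. inverse (of_nat (Suc k)) - inverse (1 + y + of_nat k)) sums (Digamma (1 + y) + euler_mascheroni)"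
    "(\<lambda>k. inverse (of_nat (Suc k)) - inverse (1 - y + of_nat k)) sums (Digamma (1 - y) + euler_mascheroni)"
    using summable_Digamma[OF nz(1)] summable_Digamma[OF nz(2)] by (simp_all add: Digamma_def sums_iff)
  from sums_diff[OF this(2,1)] have "(\<lambda>k. inverse (1 + y + of_nat k) - inverse (1 - y + of_nat k)) sums (Digamma (1 - y) - Digamma (1 + y))"
    by simp
  moreover have "inverse (1 + y + of_nat k) - inverse (1 - y + of_nat k) = f (int (Suc k))" for k
  proof -
    have "y - of_int (int (Suc k)) = - (1 - y + of_nat k)" by simp
    then have "1 / (y - of_int (int (Suc k))) = - inverse (1 - y + of_nat k)" by (simp only: minus_divide_right[symmetric] inverse_eq_divide)
    then show ?thesis by (simp add: f_def inverse_eq_divide add_ac)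
  qed
  moreover have "Digamma (1 - y) - Digamma (1 + y) = of_real pi * \<i> - 2 * of_real pi * \<i> * power_polylog 0 (qpar y) - 1 / y"
    using Digamma_reflection_uhp[OF y] Digamma_plus1[OF y0] by (simp add: add.commute)
  ultimately have sums: "(\<lambda>k. f (int (Suc k))) sums (of_real pi * \<i> - 2 * of_real pi * \<i> * power_polylog 0 (qpar y) - 1 / y)"
    by simp
  have "f summable_on (range (\<lambda>k. int (Suc k)))"
    by (rule summable_on_subset_banach[OF sm[folded f_def]]) auto
  then have "(\<lambda>k. f (int (Suc k))) summable_on UNIV"
    by (subst (asm) summable_on_reindex) (auto simp: o_def inj_on_def)
  then have "((\<lambda>k. f (int (Suc k))) has_sum infsum (\<lambda>k. f (int (Suc k))) UNIV) UNIV" by (rule has_sum_infsum)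
  moreover from has_sum_imp_sums[OF this] sums 
  have "infsum (\<lambda>k. f (int (Suc k))) UNIV = (of_real pi * \<i> - 2 * of_real pi * \<i> * power_polylog 0 (qpar y) - 1 / y)"
    by (rule sums_unique2)
  ultimately have "((\<lambda>k. f (int (Suc k))) has_sum (of_real pi * \<i> - 2 * of_real pi * \<i> * power_polylog 0 (qpar y) - 1 / y)) UNIV"
    by simp
  then have "(f has_sum (2 * (of_real pi * \<i> - 2 * of_real pi * \<i> * power_polylog 0 (qpar y) - 1 / y))) (- {0})"
    by (rule has_sum_int_nonzero_even[rotated]) (simp add: f_def add.commute)
  then show ?thesis unfolding f_def[abs_def] .
qed

lemma lattice_row_has_sum_2:
  assumes z: "z \<in> uhp" and m: "m \<noteq> 0"
  shows "((\<lambda>n::int. 1 / (of_int m * z + of_int n)\<^sup>2) has_sum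
     (- 4 * of_real pi ^ 2 * power_polylog 1 (qpar z ^ nat \<bar>m\<bar>))) UNIV"
proof -
  have "(- 2 * of_real pi * \<i>)\<^sup>2 / fact 1 = - 4 * complex_of_real pi ^ 2"
    by (simp add: power_mult_distrib)
  then show ?thesis using lattice_row_has_sum[OF z _ m, of 1] by (simp only: Suc_1 odd_one simp_thms)
qed

text \<open>Factoring out z turns the column of n into the row of n for - 1 / z, from which the term
  m = 0 is then removed.\<close>

lemma column_has_sum:
  assumes z: "z \<in> uhp" and n: "n \<noteq> 0"
  shows "((\<lambda>m::int. 1 / (of_int m * z + of_int n)\<^sup>2) has_sum
     (- 4 * of_real pi ^ 2 * power_polylog 1 (qpar (- 1 / z) ^ nat \<bar>n\<bar>) / z\<^sup>2 - 1 / (of_int n)\<^sup>2)) (- {0})"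
proof -
  have z0: "z \<noteq> 0" using z uhp_nonzero by auto
  define L where "L = - 4 * of_real pi ^ 2 * power_polylog 1 (qpar (- 1 / z) ^ nat \<bar>n\<bar>)"
  have "((\<lambda>m::int. 1 / (of_int n * (- 1 / z) + of_int m)\<^sup>2) has_sum L) UNIV"
    unfolding L_def by (rule lattice_row_has_sum_2[OF uhp_minus_inverse[OF z] n])
  then have "((\<lambda>m::int. 1 / z\<^sup>2 * (1 / (of_int n * (- 1 / z) + of_int m)\<^sup>2)) has_sum (1 / z\<^sup>2 * L)) UNIV"
    by (rule has_sum_cmult_right)
  moreover have "1 / z\<^sup>2 * (1 / (of_int n * (- 1 / z) + of_int (- m))\<^sup>2) = 1 / (of_int m * z + of_int n)\<^sup>2" for m
  proof -
    have "of_int m * z + of_int n = - z * (of_int n * (- 1 / z) + of_int (- m))" using z0 by (simp add: field_simps)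
    then show ?thesis by (simp add: power_mult_distrib)
  qed
  ultimately have all: "((\<lambda>m::int. 1 / (of_int m * z + of_int n)\<^sup>2) has_sum (1 / z\<^sup>2 * L)) UNIV"
    by (subst (asm) has_sum_reindex_bij_betw[OF bij_uminus, symmetric]) simp
  have "((\<lambda>m::int. 1 / (of_int m * z + of_int n)\<^sup>2) has_sum (1 / z\<^sup>2 * L - (1 / (of_int n)\<^sup>2))) (UNIV - {0})"
    by (rule has_sum_Diff[OF all]) (auto simp: has_sum_finite_iff)
  then show ?thesis by (simp add: L_def Compl_eq_Diff_UNIV)
qed

lemma column_0_has_sum:
  assumes z: "z \<in> uhp"
  shows "((\<lambda>m::int. 1 / (of_int m * z + of_int 0)\<^sup>2) has_sum (of_real pi ^ 2 / 3 / z\<^sup>2)) (- {0})"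
proof -
  have "((\<lambda>m::int. 1 / z\<^sup>2 * (1 / (of_int m)\<^sup>2)) has_sum (1 / z\<^sup>2 * (of_real pi ^ 2 / 3))) (- {0})"
    by (intro has_sum_cmult_right has_sum_inverse_squares_int)
  then show ?thesis by (simp add: power_mult_distrib mult.commute)
qed

text \<open>The double series over $(mz+n)^{-2}$, $m \neq 0$, converges only conditionally. Subtracting the
  telescoping terms makes it absolutely convergent without changing the row sums; the column sums
  then produce the defect $6 / (\pi i z)$.\<close>

lemma sigma_series_1_transform:
  assumes z: "z \<in> uhp"
  shows "1 - 24 * sigma_series 1 (qpar (- 1 / z)) = z\<^sup>2 * (1 - 24 * sigma_series 1 (qpar z)) + 6 * z / (of_real pi * \<i>)"
proof -
  define T where "T = (\<lambda>(m::int, n::int). 1 / (of_int m * z + of_int n)\<^sup>2 - (1 / (of_int m * z + of_int n) - 1 / (of_int m * z + of_int n + 1)))"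
  define Q where "Q = qpar (- 1 / z)"
  have z0: "z \<noteq> 0" and Imz: "Im z > 0" using z uhp_nonzero by (auto simp: uhp_def)
  have Q1: "norm Q < 1" unfolding Q_def by (intro norm_qpar_less_1 uhp_minus_inverse z)
  have nz: "of_int m * z + of_int n \<noteq> 0" if "m \<noteq> 0" for m n :: int
    using that Imz by (auto simp: complex_eq_iff)
  have nz1: "of_int m * z + of_int n + 1 \<noteq> 0" if "m \<noteq> 0" for m n :: int
    using nz[OF that, of "n + 1"] by (simp add: add.assoc)
  \<comment> \<open>With u = m z + n the summand is 1 / (u^2 (u + 1)), and |u| <= (1 + 1 / Im z) |u
    + 1| because |Im u| >= Im z; hence cubic decay.\<close>
  have Tsum: "T summable_on ((- {0}) \<times> UNIV)"
  proof (rule summable_lattice_comparison[OF z])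
    fix m n :: int assume "(m, n) \<in> (- {0}) \<times> UNIV"
    then have m: "m \<noteq> 0" by auto
    define u where "u = of_int m * z + of_int n"
    have u: "u \<noteq> 0" "u + 1 \<noteq> 0" using nz[OF m] nz1[OF m] by (auto simp: u_def)
    have "1 * Im z \<le> \<bar>of_int m\<bar> * Im z" using Imz m by (intro mult_right_mono) auto
    also have "\<dots> = \<bar>Im (u + 1)\<bar>" using Imz by (simp add: u_def abs_mult)
    also have "\<dots> \<le> norm (u + 1)" by (rule abs_Im_le_cmod)
    finally have "1 \<le> norm (u + 1) / Im z" using Imz by simp
    moreover have "norm u \<le> norm (u + 1) + 1" using norm_triangle_ineq4[of "u + 1" 1] by simp
    ultimately have "norm u \<le> (1 + 1 / Im z) * norm (u + 1)" by (simp add: algebra_simps)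
    then have "1 / norm (u + 1) \<le> (1 + 1 / Im z) / norm u" using u by (simp add: field_simps)
    then have "1 / norm u ^ 2 * (1 / norm (u + 1)) \<le> 1 / norm u ^ 2 * ((1 + 1 / Im z) / norm u)"
      by (intro mult_left_mono) auto
    moreover have "T (m, n) = 1 / u\<^sup>2 * (1 / (u + 1))"
    proof -
      have "1 / u\<^sup>2 - (1 / u - 1 / v) = (v - u * (v - u)) / (u\<^sup>2 * v)" if "v \<noteq> 0" for v
        using u(1) that by (simp add: field_simps power2_eq_square)
      from this[OF u(2)] have "1 / u\<^sup>2 - (1 / u - 1 / (u + 1)) = 1 / u\<^sup>2 * (1 / (u + 1))" by simp
      then show ?thesis by (simp add: T_def u_def)
    qed
    ultimately show "norm (T (m, n)) \<le> (1 + 1 / Im z) / norm (of_int m * z + of_int n) ^ 3"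
      by (simp add: norm_mult norm_divide norm_power u_def[symmetric] power2_eq_square power3_eq_cube)
  qed (use Imz in auto)
  define A where "A = infsum T ((- {0}) \<times> UNIV)"
  have TA: "(T has_sum A) ((- {0}) \<times> UNIV)" unfolding A_def by (rule has_sum_infsum[OF Tsum])
  \<comment> \<open>Along rows the correction sums to 0, so A is the uncorrected iterated sum with n
    innermost.\<close>
  have A1: "A = 2 * (- 4 * of_real pi ^ 2 * sigma_series 1 (qpar z))"
  proof -
    have row: "((\<lambda>n. T (m, n)) has_sum (- 4 * of_real pi ^ 2 * power_polylog 1 (qpar z ^ nat \<bar>m\<bar>))) UNIV" if "m \<in> - {0}" for m
    proof -
      have r: "((\<lambda>n::int. 1 / (of_int m * z + of_int n)\<^sup>2) has_sum (- 4 * of_real pi ^ 2 * power_polylog 1 (qpar z ^ nat \<bar>m\<bar>))) UNIV"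
        using that by (intro lattice_row_has_sum_2 z) simp
      have "T summable_on ({m} \<times> UNIV)" using that by (intro summable_on_subset_banach[OF Tsum]) auto
      moreover have "{m} \<times> (UNIV :: int set) = range (Pair m)" by auto
      ultimately have "T summable_on (range (Pair m))" by (simp only:)
      then have Tm: "(\<lambda>n. T (m, n)) summable_on UNIV"
        by (subst (asm) summable_on_reindex) (auto simp: inj_on_def o_def)
      have "(\<lambda>n. 1 / (of_int m * z + of_int n)\<^sup>2 - T (m, n)) summable_on UNIV"
        by (rule has_sum_imp_summable[OF has_sum_diff[OF r has_sum_infsum[OF Tm]]])
      then have "(\<lambda>n. 1 / (of_int m * z + of_int n) - 1 / (of_int m * z + of_int n + 1)) summable_on UNIV"
        by (simp add: T_def)
      then have "((\<lambda>n. 1 / (of_int m * z + of_int n) - 1 / (of_int m * z + of_int n + 1)) has_sum 0) UNIV"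
        by (rule has_sum_int_shift_telescope[rotated]) (use that Imz in auto)
      from has_sum_diff[OF r this] show ?thesis by (simp add: T_def)
    qed
    have "((\<lambda>m. - 4 * of_real pi ^ 2 * power_polylog 1 (qpar z ^ nat \<bar>m\<bar>)) has_sum A) (- {0})"
      by (rule has_sum_Sigma'[OF TA row])
    moreover have "((\<lambda>m. - 4 * of_real pi ^ 2 * power_polylog 1 (qpar z ^ nat \<bar>m\<bar>)) has_sum 2 * (- 4 * of_real pi ^ 2 * sigma_series 1 (qpar z))) (- {0})"
    proof (rule has_sum_int_nonzero_even)
      have "((\<lambda>n. - 4 * of_real pi ^ 2 * power_polylog 1 (qpar z ^ Suc n)) has_sum - 4 * of_real pi ^ 2 * sigma_series 1 (qpar z)) UNIV"
        by (intro has_sum_cmult_right Lambert_has_sum norm_qpar_less_1 z) auto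
      moreover have "nat \<bar>int (Suc n)\<bar> = Suc n" for n by simp
      ultimately show "((\<lambda>n. - 4 * of_real pi ^ 2 * power_polylog 1 (qpar z ^ nat \<bar>int (Suc n)\<bar>)) has_sum - 4 * of_real pi ^ 2 * sigma_series 1 (qpar z)) UNIV"
        by (simp only:)
    qed simp
    ultimately show ?thesis by (rule has_sum_unique)
  qed
  define D where "D n = infsum (\<lambda>m. T (m, n)) (- {0})" for n
  have Tcol: "((\<lambda>m. T (m, n)) has_sum D n) (- {0})" for n
  proof -
    have "T summable_on ((- {0}) \<times> {n})" by (intro summable_on_subset_banach[OF Tsum]) auto
    moreover have "(- {0 :: int}) \<times> {n} = (\<lambda>m. (m, n)) ` (- {0})" by auto
    ultimately have "T summable_on ((\<lambda>m. (m, n)) ` (- {0}))" by (simp only:)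
    then have "(\<lambda>m. T (m, n)) summable_on (- {0})"
      by (subst (asm) summable_on_reindex) (auto simp: inj_on_def o_def)
    then show ?thesis unfolding D_def by (rule has_sum_infsum)
  qed
  have DA: "(D has_sum A) UNIV"
  proof (rule has_sum_Sigma'[where f = "\<lambda>(n, m). T (m, n)" and B = "\<lambda>_. - {0}"])
    show "((\<lambda>(n, m). T (m, n)) has_sum A) (UNIV \<times> (- {0}))"
      using TA by (subst has_sum_reindex_bij_witness[of _ prod.swap prod.swap]) (auto intro: refl)
    show "((\<lambda>m. case (n, m) of (n, m) \<Rightarrow> T (m, n)) has_sum D n) (- {0})" for n using Tcol by simp
  qed
  \<comment> \<open>The column sums before the correction; the defect is the limit of the partial
    sums of \<open>B\<close> minus those of \<open>D\<close>.\<close>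
  define B where "B n = (if n = 0 then of_real pi ^ 2 / 3 / z\<^sup>2 
     else - 4 * of_real pi ^ 2 * power_polylog 1 (Q ^ nat \<bar>n\<bar>) / z\<^sup>2 - 1 / (of_int n)\<^sup>2)" for n :: int
  have Bsum: "((\<lambda>m::int. 1 / (of_int m * z + of_int n)\<^sup>2) has_sum B n) (- {0})" for n
    using column_has_sum[OF z, of n] column_0_has_sum[OF z] by (auto simp: B_def Q_def)
  \<comment> \<open>The correction summed over - N <= n < N telescopes to 1 / (m z - N) - 1 / (m z +
    N); \<open>U N\<close> is the sum of this over m, in closed form by the cotangent expansion at -
    N / z.\<close>
  define U where "U N = 2 * (of_real pi * \<i> - 2 * of_real pi * \<i> * power_polylog 0 (Q ^ N) - 1 / (of_nat N * (- 1 / z))) / z" for N :: nat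
  have fin: "(\<Sum>k<N. B (int k) + B (- int (Suc k)) - (D (int k) + D (- int (Suc k)))) = U N" if N: "N > 0" for N
  proof -
    have "((\<lambda>m::int. \<Sum>k<N. 1 / (of_int m * z + of_int (int k))\<^sup>2 + 1 / (of_int m * z + of_int (- int (Suc k)))\<^sup>2 
        - (T (m, int k) + T (m, - int (Suc k)))) has_sum
       (\<Sum>k<N. B (int k) + B (- int (Suc k)) - (D (int k) + D (- int (Suc k))))) (- {0})"
      by (intro has_sum_sum has_sum_diff has_sum_add Bsum Tcol)
    moreover have "(\<Sum>k<N. 1 / (of_int m * z + of_int (int k))\<^sup>2 + 1 / (of_int m * z + of_int (- int (Suc k)))\<^sup>2 
        - (T (m, int k) + T (m, - int (Suc k)))) = 1 / (of_int m * z - of_nat N) - 1 / (of_int m * z + of_nat N)" for m :: int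
      by (induction N) (simp_all add: T_def algebra_simps)
    ultimately have h: "((\<lambda>m::int. 1 / (of_int m * z - of_nat N) - 1 / (of_int m * z + of_nat N)) has_sum
       (\<Sum>k<N. B (int k) + B (- int (Suc k)) - (D (int k) + D (- int (Suc k))))) (- {0})" by simp
    define y where "y = of_nat N * (- 1 / z)"
    have "Im (of_nat N * x) = of_nat N * Im x" for x :: complex by simp
    then have "Im y = of_nat N * Im (- 1 / z)" unfolding y_def .
    moreover have "0 < of_nat N * Im (- 1 / z)"
      using N uhp_minus_inverse[OF z] unfolding uhp_iff by (intro mult_pos_pos) auto
    ultimately have y: "y \<in> uhp" by (simp only: uhp_iff)
    have eq: "1 / (of_int m * z - of_nat N) - 1 / (of_int m * z + of_nat N) = 1 / z * (1 / (y + of_int m) + 1 / (y - of_int m))" for m :: int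
    proof -
      have "of_int m * z - of_nat N = z * (y + of_int m)" "of_int m * z + of_nat N = - (z * (y - of_int m))"
        using z0 by (simp_all add: y_def field_simps)
      moreover have "1 / (z * a) - 1 / (- (z * b)) = 1 / z * (1 / a + 1 / b)" for a b
        by (simp add: distrib_left)
      ultimately show ?thesis by (simp only:)
    qed
    have "(\<lambda>m::int. 1 / z * (1 / (y + of_int m) + 1 / (y - of_int m))) summable_on (- {0})"
      using has_sum_imp_summable[OF h] by (simp only: eq)
    then have "(\<lambda>m::int. z * (1 / z * (1 / (y + of_int m) + 1 / (y - of_int m)))) summable_on (- {0})"
      by (rule summable_on_cmult_right)
    then have "(\<lambda>m::int. 1 / (y + of_int m) + 1 / (y - of_int m)) summable_on (- {0})"
      using z0 by simp
    from has_sum_cmult_right[OF symmetric_partial_fractions[OF y this], of "1 / z"]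
    have "((\<lambda>m::int. 1 / (of_int m * z - of_nat N) - 1 / (of_int m * z + of_nat N)) has_sum
       (1 / z * (2 * (of_real pi * \<i> - 2 * of_real pi * \<i> * power_polylog 0 (qpar y) - 1 / y)))) (- {0})"
      by (simp only: eq)
    moreover have qy: "qpar y = Q ^ N" unfolding y_def Q_def by (rule qpar_of_nat_mult)
    ultimately show ?thesis using has_sum_unique[OF h] unfolding U_def y_def[symmetric] qy by simp
  qed
  have Dlim: "(\<lambda>N. \<Sum>k<N. D (int k) + D (- int (Suc k))) \<longlonglongrightarrow> A"
  proof -
    have "D summable_on (range int)" "D summable_on (range (\<lambda>n. - int (Suc n)))"
      by (rule summable_on_subset_banach[OF has_sum_imp_summable[OF DA]]; simp)+
    then have "(\<lambda>n. D (int n)) summable_on UNIV" "(\<lambda>n. D (- int (Suc n))) summable_on UNIV"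
      by (subst (asm) summable_on_reindex; auto simp: o_def inj_on_def)+
    then obtain a b where ab: "((\<lambda>n. D (int n)) has_sum a) UNIV" "((\<lambda>n. D (- int (Suc n))) has_sum b) UNIV"
      using has_sum_infsum by blast
    have "A = a + b" using has_sum_unique[OF DA has_sum_int_split[of D, OF ab]] .
    moreover have "(\<lambda>k. D (int k) + D (- int (Suc k))) sums (a + b)"
      by (intro sums_add has_sum_imp_sums ab)
    ultimately show ?thesis by (simp add: sums_def)
  qed
  define S where "S = - 4 * of_real pi ^ 2 * sigma_series 1 Q / z\<^sup>2 - of_real pi ^ 2 / 6"
  have Bsums: "(\<lambda>k. B (int (Suc k))) sums S"
  proof -
    have "((\<lambda>n. - 4 * of_real pi ^ 2 * power_polylog 1 (Q ^ Suc n)) has_sum - 4 * of_real pi ^ 2 * sigma_series 1 Q) UNIV"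
      by (intro has_sum_cmult_right Lambert_has_sum Q1) auto
    then have 1: "(\<lambda>n. - 4 * of_real pi ^ 2 * power_polylog 1 (Q ^ Suc n) / z\<^sup>2) sums (- 4 * of_real pi ^ 2 * sigma_series 1 Q / z\<^sup>2)"
      by (intro sums_divide has_sum_imp_sums)
    have "(\<lambda>n. complex_of_real (1 / (real n + 1)\<^sup>2)) sums of_real (pi\<^sup>2 / 6)"
      by (intro sums_of_real) (use inverse_squares_sums in \<open>simp add: add_ac\<close>)
    then have 2: "(\<lambda>n. 1 / (of_nat (Suc n))\<^sup>2) sums (of_real pi ^ 2 / 6 :: complex)"
      by (simp add: add_ac)
    have "B (int (Suc k)) = - 4 * of_real pi ^ 2 * power_polylog 1 (Q ^ Suc k) / z\<^sup>2 - 1 / (of_nat (Suc k))\<^sup>2" for k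
    proof -
      have "int (Suc k) \<noteq> 0" "nat \<bar>int (Suc k)\<bar> = Suc k" by simp_all
      then show ?thesis unfolding B_def by (simp only: if_False of_int_of_nat_eq)
    qed
    then show ?thesis using sums_diff[OF 1 2] by (simp only: S_def)
  qed
  have Blim: "(\<lambda>N. \<Sum>k<N. B (int k) + B (- int (Suc k))) \<longlonglongrightarrow> B 0 + S + S"
  proof -
    have "(\<lambda>k. B (int k)) sums (S + B (int 0))" using Bsums by (subst (asm) sums_Suc_iff) (simp add: algebra_simps)
    moreover have "B (- n) = B n" for n by (simp add: B_def)
    then have "(\<lambda>k. B (- int (Suc k))) sums S" using Bsums by (simp only:)
    ultimately have "(\<lambda>k. B (int k) + B (- int (Suc k))) sums ((S + B (int 0)) + S)" 
      by (rule sums_add)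
    then show ?thesis by (simp add: sums_def add_ac)
  qed
  \<comment> \<open>As Q^N tends to 0 the polylogarithm tends to its constant term 1, so pi i - 2 pi
    i remains: the origin of the defect - 2 pi i / z.\<close>
  have Ulim: "U \<longlonglongrightarrow> 2 * (of_real pi * \<i> - 2 * of_real pi * \<i> * 1 - 0) / z"
  proof -
    have "(\<lambda>N. Q ^ N) \<longlonglongrightarrow> 0" using Q1 by (rule LIMSEQ_power_zero)
    then have "(\<lambda>N. 1 / (1 - Q ^ N)) \<longlonglongrightarrow> 1 / (1 - 0)"
      by (intro tendsto_divide tendsto_diff tendsto_const) simp_all
    moreover have "eventually (\<lambda>N. 1 / (1 - Q ^ N) = power_polylog 0 (Q ^ N)) sequentially"
      using eventually_gt_at_top[of 0]
    proof eventually_elim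
      case (elim N)
      have "norm (Q ^ N) < 1" using Q1 elim by (simp add: norm_power power_less_one_iff)
      then show ?case using suminf_geometric[of "Q ^ N"] by (simp add: power_polylog_def)
    qed
    ultimately have p: "(\<lambda>N. power_polylog 0 (Q ^ N)) \<longlonglongrightarrow> 1" by (auto elim: Lim_transform_eventually)
    have "(\<lambda>N. - z * (1 / of_nat N)) \<longlonglongrightarrow> - z * 0" by (intro tendsto_intros lim_1_over_n)
    moreover have "- z * (1 / of_nat N) = 1 / (of_nat N * (- 1 / z))" for N using z0 by simp
    ultimately have r: "(\<lambda>N. 1 / (of_nat N * (- 1 / z))) \<longlonglongrightarrow> 0" by simp
    show ?thesis unfolding U_def by (intro tendsto_divide tendsto_mult tendsto_diff tendsto_const p r z0)
  qed
  have "(\<lambda>N. (\<Sum>k<N. B (int k) + B (- int (Suc k))) - (\<Sum>k<N. D (int k) + D (- int (Suc k)))) \<longlonglongrightarrow> (B 0 + S + S) - A"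
    by (intro tendsto_diff Blim Dlim)
  moreover have "eventually (\<lambda>N. (\<Sum>k<N. B (int k) + B (- int (Suc k))) - (\<Sum>k<N. D (int k) + D (- int (Suc k))) = U N) sequentially"
    using eventually_gt_at_top[of 0] by eventually_elim (simp only: fin sum_subtractf[symmetric])
  ultimately have "U \<longlonglongrightarrow> (B 0 + S + S) - A" by (rule Lim_transform_eventually)
  then have "(B 0 + S + S) - A = 2 * (of_real pi * \<i> - 2 * of_real pi * \<i> * 1 - 0) / z"
    using Ulim by (rule LIMSEQ_unique)
  then have eq: "of_real pi ^ 2 / 3 / z\<^sup>2 + 2 * (- 4 * of_real pi ^ 2 * sigma_series 1 Q / z\<^sup>2 - of_real pi ^ 2 / 6)
     + 8 * of_real pi ^ 2 * sigma_series 1 (qpar z) = - 2 * of_real pi * \<i> / z"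
    by (simp add: B_def S_def A1 algebra_simps)
  define p where "p = complex_of_real pi"
  have p0: "p \<noteq> 0" by (simp add: p_def)
  \<comment> \<open>The factor 3 z^2 / pi^2 normalises the constant term of the column side to
    1.\<close>
  have "(3 * z\<^sup>2 / p\<^sup>2) * (p ^ 2 / 3 / z\<^sup>2 + 2 * (- 4 * p ^ 2 * sigma_series 1 Q / z\<^sup>2 - p ^ 2 / 6)
     + 8 * p ^ 2 * sigma_series 1 (qpar z)) = (3 * z\<^sup>2 / p\<^sup>2) * (- 2 * p * \<i> / z)"
    using eq by (simp only: p_def)
  also have "(3 * z\<^sup>2 / p\<^sup>2) * (- 2 * p * \<i> / z) = 6 * z / (p * \<i>)"
    using z0 p0 by (simp add: field_simps power2_eq_square)
  also have "(3 * z\<^sup>2 / p\<^sup>2) * (p ^ 2 / 3 / z\<^sup>2 + 2 * (- 4 * p ^ 2 * sigma_series 1 Q / z\<^sup>2 - p ^ 2 / 6)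
     + 8 * p ^ 2 * sigma_series 1 (qpar z)) = 1 - 24 * sigma_series 1 Q - z\<^sup>2 * (1 - 24 * sigma_series 1 (qpar z))"
    using z0 p0 by (simp add: field_simps)
  finally show ?thesis by (simp add: Q_def p_def algebra_simps)
qed

section \<open>Eisenstein series and the discriminant\<close>

text \<open>\<open>E2\<close> abbreviates \<open>eisenstein 1\<close>, which this rule would rewrite.\<close>

declare One_nat_def [simp del]

lemma normalized_deriv_eqI:
  assumes "(f has_field_derivative (2 * of_real pi * \<i> * d)) (at z)"
  shows "normalized_deriv f z = d"
  using DERIV_imp_deriv[OF assms] by (simp add: normalized_deriv_def)

lemma has_normalized_deriv:
  assumes "f holomorphic_on uhp" "z \<in> uhp"
  shows "(f has_field_derivative (2 * of_real pi * \<i> * normalized_deriv f z)) (at z)"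
  using holomorphic_derivI[OF assms(1) open_uhp assms(2)] by (simp add: normalized_deriv_def)

lemma normalized_deriv_cong:
  assumes "\<And>z. z \<in> uhp \<Longrightarrow> f z = g z" "f holomorphic_on uhp" "z \<in> uhp"
  shows "normalized_deriv f z = normalized_deriv g z"
proof -
  have "(g has_field_derivative (2 * of_real pi * \<i> * normalized_deriv f z)) (at z)"
    by (rule has_field_derivative_transform_within_open[OF has_normalized_deriv[OF assms(2,3)] open_uhp assms(3,1)])
  then show ?thesis by (simp add: normalized_deriv_eqI)
qed

lemma normalized_deriv_holomorphic [holomorphic_intros]:
  "f holomorphic_on uhp \<Longrightarrow> normalized_deriv f holomorphic_on uhp"
  unfolding normalized_deriv_def[abs_def]
  by (intro holomorphic_intros holomorphic_deriv open_uhp) auto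

lemma normalized_deriv_add:
  assumes "f holomorphic_on uhp" "g holomorphic_on uhp" "z \<in> uhp"
  shows "normalized_deriv (\<lambda>z. f z + g z) z = normalized_deriv f z + normalized_deriv g z"
  by (rule normalized_deriv_eqI)
     (use assms in \<open>auto intro!: derivative_eq_intros has_normalized_deriv simp: algebra_simps\<close>)

lemma normalized_deriv_mult:
  assumes "f holomorphic_on uhp" "g holomorphic_on uhp" "z \<in> uhp"
  shows "normalized_deriv (\<lambda>z. f z * g z) z = normalized_deriv f z * g z + f z * normalized_deriv g z"
  by (rule normalized_deriv_eqI)
     (use assms in \<open>auto intro!: derivative_eq_intros has_normalized_deriv simp: algebra_simps\<close>)

lemma normalized_deriv_cmult:
  assumes "f holomorphic_on uhp" "z \<in> uhp"
  shows "normalized_deriv (\<lambda>z. c * f z) z = c * normalized_deriv f z"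
  by (rule normalized_deriv_eqI)
     (use assms in \<open>auto intro!: derivative_eq_intros has_normalized_deriv simp: algebra_simps\<close>)

lemma normalized_deriv_power:
  assumes "f holomorphic_on uhp" "z \<in> uhp"
  shows "normalized_deriv (\<lambda>z. f z ^ n) z = of_nat n * f z ^ (n - 1) * normalized_deriv f z"
  by (rule normalized_deriv_eqI)
     (use assms in \<open>auto intro!: derivative_eq_intros has_normalized_deriv simp: algebra_simps One_nat_def\<close>)

lemma has_field_derivative_minus_inverse:
  "z \<noteq> 0 \<Longrightarrow> ((\<lambda>z. - 1 / z :: complex) has_field_derivative 1 / z\<^sup>2) (at z)"
  by (auto intro!: derivative_eq_intros simp: power2_eq_square field_simps)

lemma has_field_derivative_compose_minus_inverse:
  assumes "f holomorphic_on uhp" "z \<in> uhp"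
  shows "((\<lambda>z. f (- 1 / z)) has_field_derivative (2 * of_real pi * \<i> * normalized_deriv f (- 1 / z) / z\<^sup>2)) (at z)"
proof -
  have "((\<lambda>z. f (- 1 / z)) has_field_derivative (2 * of_real pi * \<i> * normalized_deriv f (- 1 / z)) * (1 / z\<^sup>2)) (at z)"
    by (rule DERIV_chain2[OF has_normalized_deriv[OF assms(1) uhp_minus_inverse] has_field_derivative_minus_inverse])
       (use assms uhp_nonzero in auto)
  then show ?thesis by simp
qed

lemma cusp_rep_normalized_deriv:
  assumes "cusp_rep 0 F f"
  shows "cusp_rep 0 (\<lambda>q. q * deriv F q) (normalized_deriv f)"
proof -
  have F: "F holomorphic_on ball 0 1" using assms by (simp add: cusp_rep_def)
  have "normalized_deriv f z = qpar z * deriv F (qpar z)" if z: "z \<in> uhp" for z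
  proof (rule normalized_deriv_eqI)
    have "(F has_field_derivative deriv F (qpar z)) (at (qpar z))"
      by (rule holomorphic_derivI[OF F _ qpar_in_ball[OF z]]) simp
    from DERIV_chain2[OF this has_field_derivative_qpar[OF DERIV_ident]]
    have "((\<lambda>z. F (qpar z)) has_field_derivative (2 * of_real pi * \<i> * (qpar z * deriv F (qpar z)))) (at z)"
      by (simp add: mult_ac)
    then show "(f has_field_derivative (2 * of_real pi * \<i> * (qpar z * deriv F (qpar z)))) (at z)"
      by (rule has_field_derivative_transform_within_open[OF _ open_uhp z]) (use assms in \<open>simp add: cusp_rep_def\<close>)
  qed
  moreover have "(\<lambda>q. q * deriv F q) holomorphic_on ball 0 1"
    by (intro holomorphic_intros holomorphic_deriv F) auto
  ultimately show ?thesis by (simp add: cusp_rep_def)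
qed

lemma cusp_rep_add: "cusp_rep l F f \<Longrightarrow> cusp_rep l G g \<Longrightarrow> cusp_rep l (\<lambda>q. F q + G q) (\<lambda>z. f z + g z)"
  by (auto simp: cusp_rep_def distrib_left intro!: holomorphic_intros)

lemma cusp_rep_cmult: "cusp_rep k F f \<Longrightarrow> cusp_rep k (\<lambda>q. c * F q) (\<lambda>z. c * f z)"
  by (auto simp: cusp_rep_def intro!: holomorphic_intros)

lemma cusp_rep_mult: "cusp_rep k F f \<Longrightarrow> cusp_rep l G g \<Longrightarrow> cusp_rep (k + l) (\<lambda>q. F q * G q) (\<lambda>z. f z * g z)"
  by (auto simp: cusp_rep_def power_int_add intro!: holomorphic_intros)

lemma cusp_rep_const: "cusp_rep 0 (\<lambda>_. c) (\<lambda>_. c)"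
  by (simp add: cusp_rep_def)

lemma cusp_rep_power: "cusp_rep 0 F f \<Longrightarrow> cusp_rep 0 (\<lambda>q. F q ^ n) (\<lambda>z. f z ^ n)"
  by (auto simp: cusp_rep_def intro!: holomorphic_intros)

text \<open>The quotient F(q) / q extends over 0 with value F'(0); keeping that value records the
  leading coefficient of \<Delta>.\<close>

lemma cusp_rep_factor:
  assumes "cusp_rep 0 F f" "F 0 = 0"
  shows "\<exists>G. cusp_rep 1 G f \<and> G 0 = deriv F 0"
proof -
  have F: "F holomorphic_on ball 0 1" using assms by (simp add: cusp_rep_def)
  define G where "G q = (if q = 0 then deriv F 0 else (F q - F 0) / (q - 0))" for q
  have "G holomorphic_on ball 0 1" unfolding G_def[abs_def] by (rule pole_lemma[OF F]) simp
  moreover have "f z = qpar z powi 1 * G (qpar z)" if "z \<in> uhp" for z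
    using assms that by (simp add: cusp_rep_def G_def)
  ultimately have "cusp_rep 1 G f" by (simp add: cusp_rep_def)
  moreover have "G 0 = deriv F 0" by (simp add: G_def)
  ultimately show ?thesis by blast
qed

lemma small_weight_zero:
  assumes k: "even k" "k \<le> 10" and F: "cusp_rep 0 F f" and F0: "F 0 = 0"
    and S: "\<And>z. z \<in> uhp \<Longrightarrow> f (- 1 / z) = z ^ k * f z" and z: "z \<in> uhp"
  shows "f z = 0"
proof -
  have "restrict_uhp f \<in> modular_forms (int k)"
    by (rule modular_formsI[OF _ _ _ F]) (use k S cusp_rep_periodic[OF F] in auto)
  moreover obtain G where "cusp_rep 1 G f" using cusp_rep_factor[OF F F0] by blast
  then have "cusp_rep 1 G (restrict_uhp f)" by (simp add: cusp_rep_def restrict_uhp_eq)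
  ultimately have "restrict_uhp f z = 0" using cusp_form_small_weight_zero k(2) z by blast
  then show ?thesis using z by (simp add: restrict_uhp_eq)
qed

section \<open>The q-expansions of E2, E4 and E6 and the slash operator\<close>

lemma sigma_series_sums:
  assumes "norm q < 1" "s \<ge> 1"
  shows "(\<lambda>n. of_nat (divisor_power_sum s n) * q ^ n) sums sigma_series s q"
  unfolding sigma_series_def using assms by (intro summable_sums Lambert_has_sum)

lemma sigma_series_holomorphic:
  assumes "s \<ge> 1"
  shows "sigma_series s holomorphic_on ball 0 1"
  by (rule power_series_holomorphic[where a = "\<lambda>n. of_nat (divisor_power_sum s n)"])
     (use sigma_series_sums assms in auto)

lemma sigma_series_0 [simp]: "sigma_series s 0 = 0"
  using powser_zero[of "\<lambda>n. of_nat (divisor_power_sum s n) :: complex"] by (simp add: sigma_series_def)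

lemma sigma_series_deriv_0:
  assumes s: "s \<ge> 1"
  shows "deriv (sigma_series s) 0 = 1"
proof -
  have "((\<lambda>q. \<Sum>n. of_nat (divisor_power_sum s n) * q ^ n) has_field_derivative 
      (\<Sum>n. diffs (\<lambda>n. of_nat (divisor_power_sum s n)) n * 0 ^ n)) (at (0::complex))"
    by (rule termdiffs_strong'[where K = 1]) (use sums_summable[OF sigma_series_sums] s in auto)
  moreover have "(\<Sum>n. diffs (\<lambda>n. of_nat (divisor_power_sum s n)) n * 0 ^ n) = (1::complex)"
    using powser_zero[of "diffs (\<lambda>n. of_nat (divisor_power_sum s n) :: complex)"]
    by (simp add: diffs_def divisor_power_sum_def)
  ultimately show ?thesis unfolding sigma_series_def[abs_def] by (simp add: DERIV_imp_deriv)
qed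

lemma bernoulli_numbers:
  "bernoulli_number 2 = 1 / 6" "bernoulli_number 4 = - 1 / 30" "bernoulli_number 6 = 1 / 42"
proof -
  have b1: "bernoulli_number 1 = - 1 / 2" by (simp add: numeral_eq_Suc One_nat_def)
  have b2: "bernoulli_number 2 = 1 / 6" using b1 by (simp add: numeral_eq_Suc One_nat_def)
  have b3: "bernoulli_number 3 = 0" using b1 b2 by (simp add: numeral_eq_Suc One_nat_def)
  have b4: "bernoulli_number 4 = - 1 / 30" using b1 b2 b3 by (simp add: numeral_eq_Suc One_nat_def)
  have b5: "bernoulli_number 5 = 0" using b1 b2 b3 b4 by (simp add: numeral_eq_Suc One_nat_def)
  have b6: "bernoulli_number 6 = 1 / 42" using b1 b2 b3 b4 b5 by (simp add: numeral_eq_Suc One_nat_def)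
  show "bernoulli_number 2 = 1 / 6" "bernoulli_number 4 = - 1 / 30" "bernoulli_number 6 = 1 / 42"
    by (fact b2 b4 b6)+
qed

lemma eisenstein_sigma_series:
  assumes "z \<in> uhp" "k \<ge> 1"
  shows "eisenstein k z = 1 - 4 * of_nat k / bernoulli_number (2 * k) * sigma_series (2 * k - 1) (qpar z)"
proof -
  have "(\<lambda>n. of_nat (divisor_power_sum (2 * k - 1) n) * qpar z ^ n) sums sigma_series (2 * k - 1) (qpar z)"
    using assms by (intro sigma_series_sums norm_qpar_less_1) auto
  then have "(\<lambda>n. of_nat (divisor_power_sum (2 * k - 1) (Suc n)) * qpar z ^ Suc n) sums sigma_series (2 * k - 1) (qpar z)"
    by (subst sums_Suc_iff) simp
  then show ?thesis by (simp only: eisenstein_def sums_iff)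
qed

lemma E2_eq: "z \<in> uhp \<Longrightarrow> E2 z = 1 - 24 * sigma_series 1 (qpar z)"
  and E4_eq: "z \<in> uhp \<Longrightarrow> E4 z = 1 + 240 * sigma_series 3 (qpar z)"
  and E6_eq: "z \<in> uhp \<Longrightarrow> E6 z = 1 - 504 * sigma_series 5 (qpar z)"
  using eisenstein_sigma_series[of z 1] eisenstein_sigma_series[of z 2] eisenstein_sigma_series[of z 3]
  by (simp_all add: bernoulli_numbers flip: One_nat_def)

definition "E2q q = 1 - 24 * sigma_series 1 q"
definition "E4q q = 1 + 240 * sigma_series 3 q"
definition "E6q q = 1 - 504 * sigma_series 5 q"

lemma cusp_rep_E2: "cusp_rep 0 E2q E2" and cusp_rep_E4: "cusp_rep 0 E4q E4" and cusp_rep_E6: "cusp_rep 0 E6q E6"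
  by (auto simp: cusp_rep_def E2_eq E4_eq E6_eq E2q_def E4q_def E6q_def E2q_def[abs_def] E4q_def[abs_def] E6q_def[abs_def] 
      intro!: holomorphic_intros sigma_series_holomorphic)

lemma Eq_0 [simp]: "E2q 0 = 1" "E4q 0 = 1" "E6q 0 = 1"
  by (simp_all add: E2q_def E4q_def E6q_def)

lemma sigma_series_has_deriv_0: "s \<ge> 1 \<Longrightarrow> (sigma_series s has_field_derivative 1) (at 0)"
  using holomorphic_derivI[OF sigma_series_holomorphic, of s 0] sigma_series_deriv_0[of s] by simp

lemma Eq_deriv_0:
  "(E2q has_field_derivative (- 24)) (at 0)" "(E4q has_field_derivative 240) (at 0)" "(E6q has_field_derivative (- 504)) (at 0)"
  unfolding E2q_def[abs_def] E4q_def[abs_def] E6q_def[abs_def]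
  by (rule derivative_eq_intros refl sigma_series_has_deriv_0 | simp)+

lemmas E_holomorphic = cusp_rep_E2[THEN cusp_rep_holomorphic] cusp_rep_E4[THEN cusp_rep_holomorphic]
  cusp_rep_E6[THEN cusp_rep_holomorphic]

lemma E2_transform: "z \<in> uhp \<Longrightarrow> E2 (- 1 / z) = z\<^sup>2 * E2 z + 6 * z / (of_real pi * \<i>)"
  using sigma_series_1_transform[of z] by (simp only: E2_eq uhp_minus_inverse)

text \<open>The action of z -> -1/z in weight k. For odd k its square is - 1, which is the case of
  interest for solutions; see \<open>slash_transform\<close>.\<close>

definition slash :: "int \<Rightarrow> (complex \<Rightarrow> complex) \<Rightarrow> complex \<Rightarrow> complex" where
  "slash k f z = z powi (- k) * f (- 1 / z)"

lemma has_field_derivative_slash: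
  assumes f: "f holomorphic_on uhp" and z: "z \<in> uhp"
  shows "(slash k f has_field_derivative (2 * of_real pi * \<i> *
     (z powi (- k - 2) * normalized_deriv f (- 1 / z) - of_int k / (2 * of_real pi * \<i>) * z powi (- k - 1) * f (- 1 / z)))) (at z)"
proof -
  have z0: "z \<noteq> 0" using z uhp_nonzero by auto
  have "((\<lambda>z. z powi (- k) * f (- 1 / z)) has_field_derivative
     (of_int (- k) * z powi (- k - 1) * 1 * f (- 1 / z) + (2 * of_real pi * \<i> * normalized_deriv f (- 1 / z) / z\<^sup>2) * z powi (- k))) (at z)"
    by (rule DERIV_mult[OF DERIV_power_int[OF DERIV_ident disjI2[OF z0]] has_field_derivative_compose_minus_inverse[OF f z]])
  moreover have "of_int (- k) * z powi (- k - 1) * 1 * f (- 1 / z) + (P * N / z\<^sup>2) * z powi (- k)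
     = P * (z powi (- k - 2) * N - of_int k / P * z powi (- k - 1) * f (- 1 / z))" if "P \<noteq> 0" for P N
  proof -
    have "z powi (- k) = z powi (- k - 2) * z\<^sup>2" using z0 by (simp add: power_int_diff)
    then show ?thesis using z0 that by (simp add: right_diff_distrib)
  qed
  ultimately show ?thesis unfolding slash_def[abs_def] by simp
qed

lemma slash_holomorphic:
  assumes "f holomorphic_on uhp" shows "slash k f holomorphic_on uhp"
  by (rule holomorphic_onI)
     (use has_field_derivative_slash[OF assms] in \<open>auto simp: field_differentiable_def intro: has_field_derivative_at_within\<close>)

text \<open>Differentiating the factor z^(-k) produces - k / (2 pi i z), which is exactly k / 12
  times the defect 6 / (pi i z) of \<open>E2\<close>.\<close>

lemma serre_deriv_slash:
  assumes f: "f holomorphic_on uhp" and z: "z \<in> uhp"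
  shows "serre_deriv k (slash k f) z = slash (k + 2) (serre_deriv k f) z"
proof -
  have z0: "z \<noteq> 0" using z uhp_nonzero by auto
  have d: "normalized_deriv (slash k f) z = z powi (- k - 2) * normalized_deriv f (- 1 / z) - of_int k / (2 * of_real pi * \<i>) * z powi (- k - 1) * f (- 1 / z)"
    by (rule normalized_deriv_eqI[OF has_field_derivative_slash[OF f z]])
  have p: "z powi (- k) = z powi (- k - 2) * z\<^sup>2" "z powi (- k - 1) = z powi (- k - 2) * z"
    using z0 by (simp_all add: power_int_diff power2_eq_square)
  have p': "- (k + 2) = - k - 2" by simp
  show ?thesis
    unfolding serre_deriv_def d unfolding slash_def E2_transform[OF z] p p' by (simp add: field_simps)
qed

lemma serre_deriv_cong:
  assumes "\<And>z. z \<in> uhp \<Longrightarrow> f z = g z" "f holomorphic_on uhp" "z \<in> uhp"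
  shows "serre_deriv k f z = serre_deriv k g z"
  using normalized_deriv_cong[OF assms] assms by (simp add: serre_deriv_def)

lemma serre_deriv_holomorphic: "f holomorphic_on uhp \<Longrightarrow> serre_deriv k f holomorphic_on uhp"
  unfolding serre_deriv_def[abs_def] by (intro holomorphic_intros E_holomorphic) auto

lemma slash_eq_iff: "z \<in> uhp \<Longrightarrow> slash k f z = f z \<longleftrightarrow> f (- 1 / z) = z powi k * f z"
  using uhp_nonzero[of z] by (auto simp: slash_def power_int_minus field_simps)

lemma serre_deriv_modular:
  assumes "f holomorphic_on uhp" "\<And>z. z \<in> uhp \<Longrightarrow> f (- 1 / z) = z powi k * f z" "z \<in> uhp"
  shows "serre_deriv k f (- 1 / z) = z powi (k + 2) * serre_deriv k f z"
proof -
  have "serre_deriv k (slash k f) z = serre_deriv k f z"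
    by (rule serre_deriv_cong[OF _ slash_holomorphic[OF assms(1)] assms(3)]) (use assms(2) slash_eq_iff in blast)
  then have "slash (k + 2) (serre_deriv k f) z = serre_deriv k f z"
    using serre_deriv_slash[OF assms(1,3)] by simp
  then show ?thesis using slash_eq_iff[OF assms(3)] by blast
qed

text \<open>Both f and A + sigma_series are forms of the same small weight, so A + sigma_series = A
  f, the difference having no constant term. Comparing the coefficients of q gives A c = 1, which
  determines the constant of the lattice sum without evaluating a zeta function.\<close>

lemma sigma_series_identify:
  assumes s: "odd s" "s \<ge> 3" "Suc s \<le> 10" and F: "cusp_rep 0 F f" and F0: "F 0 = 1" 
    and F1: "(F has_field_derivative c) (at 0)" and c: "c \<noteq> 0"
    and S: "\<And>z. z \<in> uhp \<Longrightarrow> f (- 1 / z) = z ^ Suc s * f z" and z: "z \<in> uhp"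
  shows "f z = 1 + c * sigma_series s (qpar z)"
proof -
  obtain A where A: "\<And>z. z \<in> uhp \<Longrightarrow> A + sigma_series s (qpar (- 1 / z)) = z ^ Suc s * (A + sigma_series s (qpar z))"
    using sigma_series_modular[OF s(1,2)] by blast
  have rs: "cusp_rep 0 (\<lambda>q. A + sigma_series s q) (\<lambda>z. A + sigma_series s (qpar z))"
    using s by (auto simp: cusp_rep_def intro!: holomorphic_intros sigma_series_holomorphic)
  have r: "cusp_rep 0 (\<lambda>q. (A + sigma_series s q) + (- A) * F q) (\<lambda>z. (A + sigma_series s (qpar z)) + (- A) * f z)"
    by (intro cusp_rep_add cusp_rep_cmult rs F)
  have zero: "(A + sigma_series s (qpar z)) + (- A) * f z = 0" if "z \<in> uhp" for z
    by (rule small_weight_zero[OF _ s(3) r _ _ that])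
       (use s A S F0 in \<open>auto simp: algebra_simps simp del: power_Suc\<close>)
  then have eq: "A + sigma_series s (qpar z) = A * f z" if "z \<in> uhp" for z using that by (simp add: add_eq_0_iff)
  have "cusp_rep 0 (\<lambda>q. A * F q) (\<lambda>z. A + sigma_series s (qpar z))"
    using cusp_rep_cmult[OF F, of A] eq by (simp add: cusp_rep_def)
  then have eqF: "A + sigma_series s q = A * F q" if "q \<in> ball 0 1" for q
    using cusp_rep_unique[OF rs] that by blast
  have "((\<lambda>q. A + sigma_series s q) has_field_derivative 0 + 1) (at 0)"
    by (rule DERIV_add[OF DERIV_const sigma_series_has_deriv_0]) (use s in auto)
  then have "((\<lambda>q. A * F q) has_field_derivative 1) (at 0)"
    using has_field_derivative_transform_within_open[OF _ open_ball, of _ _ 0 0 1] eqF by fastforce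
  moreover have "((\<lambda>q. A * F q) has_field_derivative (A * c)) (at 0)" by (rule DERIV_cmult[OF F1])
  ultimately have "A * c = 1" using DERIV_unique by blast
  have "f z = (A * c) * f z" by (simp add: \<open>A * c = 1\<close>)
  also have "\<dots> = c * (A * f z)" by simp
  also have "\<dots> = c * (A + sigma_series s (qpar z))" by (simp only: eq[OF z])
  also have "\<dots> = A * c + c * sigma_series s (qpar z)" by (simp add: distrib_left)
  finally show ?thesis by (simp only: \<open>A * c = 1\<close>)
qed

section \<open>The differential equations of Ramanujan and the modularity of E4 and E6\<close>

lemma cusp_rep_E2_deriv: "cusp_rep 0 (\<lambda>q. q * deriv E2q q) (normalized_deriv E2)"
  and cusp_rep_E4_deriv: "cusp_rep 0 (\<lambda>q. q * deriv E4q q) (normalized_deriv E4)"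
  and cusp_rep_E6_deriv: "cusp_rep 0 (\<lambda>q. q * deriv E6q q) (normalized_deriv E6)"
  by (intro cusp_rep_normalized_deriv cusp_rep_E2 cusp_rep_E4 cusp_rep_E6)+

lemma times_deriv_at_0:
  assumes "F holomorphic_on ball 0 1" "(F has_field_derivative c) (at 0)"
  shows "((\<lambda>q. q * deriv F q) has_field_derivative c) (at (0::complex))"
proof -
  have "deriv F holomorphic_on ball 0 1" by (intro holomorphic_deriv assms) simp
  then have "(deriv F has_field_derivative deriv (deriv F) 0) (at 0)" by (rule holomorphic_derivI) auto
  then have "((\<lambda>q. q * deriv F q) has_field_derivative (1 * deriv F 0 + deriv (deriv F) 0 * 0)) (at 0)"
    by (intro DERIV_mult DERIV_ident)
  then show ?thesis using assms(2) by (simp add: DERIV_imp_deriv)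
qed

text \<open>The defects of E2^2 and 12 E2' agree, so f = E2^2 - 12 E2' is a form of weight 4 with
  q-coefficient - 48 + 288 = 240. Identifying f with \<open>E4\<close> proves the differential
  equation and the modularity of \<open>E4\<close> at once.\<close>

lemma
  assumes z: "z \<in> uhp"
  shows Ramanujan_E2: "normalized_deriv E2 z = ((E2 z)\<^sup>2 - E4 z) / 12"
    and E4_transform: "E4 (- 1 / z) = z ^ 4 * E4 z"
proof -
  define f where "f z = (E2 z)\<^sup>2 + (- 12) * normalized_deriv E2 z" for z
  have F: "cusp_rep 0 (\<lambda>q. (E2q q)\<^sup>2 + (- 12) * (q * deriv E2q q)) f"
    unfolding f_def by (intro cusp_rep_add cusp_rep_cmult cusp_rep_power cusp_rep_E2 cusp_rep_E2_deriv)
  have "((\<lambda>q. (E2q q)\<^sup>2 + (- 12) * (q * deriv E2q q)) has_field_derivative (of_nat 2 * ((- 24) * E2q 0 ^ (2 - Suc 0)) + (- 12) * (- 24))) (at 0)"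
    using cusp_rep_E2 by (intro DERIV_add DERIV_power DERIV_cmult times_deriv_at_0 Eq_deriv_0) (auto simp: cusp_rep_def)
  then have F1: "((\<lambda>q. (E2q q)\<^sup>2 + (- 12) * (q * deriv E2q q)) has_field_derivative 240) (at 0)" by simp
  have S: "f (- 1 / z) = z ^ Suc 3 * f z" if z: "z \<in> uhp" for z
  proof -
    define p where "p = complex_of_real pi * \<i>"
    have p0: "p \<noteq> 0" by (simp add: p_def)
    have z0: "z \<noteq> 0" using z uhp_nonzero by auto
    have "((\<lambda>z. z\<^sup>2 * E2 z + 6 * z / p) has_field_derivative
       (2 * z * E2 z + z\<^sup>2 * (2 * p * normalized_deriv E2 z) + 6 / p)) (at z)"
      using has_normalized_deriv[OF E_holomorphic(1) z] p0
      by (auto intro!: derivative_eq_intros simp: p_def[symmetric] mult.assoc[of 2 _ \<i>])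
    moreover have "((\<lambda>z. z\<^sup>2 * E2 z + 6 * z / p) has_field_derivative (2 * of_real pi * \<i> * normalized_deriv E2 (- 1 / z) / z\<^sup>2)) (at z)"
      by (rule has_field_derivative_transform_within_open[OF has_field_derivative_compose_minus_inverse[OF E_holomorphic(1) z] open_uhp z])
         (use E2_transform in \<open>simp add: p_def\<close>)
    ultimately have "2 * of_real pi * \<i> * normalized_deriv E2 (- 1 / z) / z\<^sup>2 = 2 * z * E2 z + z\<^sup>2 * (2 * p * normalized_deriv E2 z) + 6 / p"
      using DERIV_unique by blast
    then have "2 * p * normalized_deriv E2 (- 1 / z) = z\<^sup>2 * (2 * z * E2 z + z\<^sup>2 * (2 * p * normalized_deriv E2 z) + 6 / p)"
      using z0 by (simp add: p_def field_simps)
    moreover have alg: "z\<^sup>2 * (2 * z * e + z\<^sup>2 * (2 * p * d) + 6 / p) / (2 * p) = z\<^sup>2 * (z * e / p + z\<^sup>2 * d + 3 / p\<^sup>2)" for e d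
      using p0 by (simp add: field_simps power2_eq_square)
    ultimately have "normalized_deriv E2 (- 1 / z) = z\<^sup>2 * (2 * z * E2 z + z\<^sup>2 * (2 * p * normalized_deriv E2 z) + 6 / p) / (2 * p)"
      using p0 by (subst eq_divide_eq) (simp add: mult.commute)
    then have D: "normalized_deriv E2 (- 1 / z) = z\<^sup>2 * (z * E2 z / p + z\<^sup>2 * normalized_deriv E2 z + 3 / p\<^sup>2)"
      using p0 by (simp only: alg)
    have E: "E2 (- 1 / z) = z\<^sup>2 * E2 z + 6 * z / p" using E2_transform[OF z] by (simp add: p_def)
    \<comment> \<open>A polynomial identity in r = 1 / p, stated without division so that it can be
      decided algebraically.\<close>
    have "(z\<^sup>2 * e + 6 * z * r)\<^sup>2 + (- 12) * (z\<^sup>2 * (z * e * r + z\<^sup>2 * d + 3 * r\<^sup>2)) = z ^ 4 * (e\<^sup>2 + (- 12) * d)" for e d r :: complex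
      by algebra
    from this[of "E2 z" "1 / p"] show ?thesis unfolding f_def D E by (simp add: power_divide)
  qed
  have f: "f z = E4 z" if z: "z \<in> uhp" for z
    unfolding E4_eq[OF z] by (rule sigma_series_identify[OF _ _ _ F _ F1 _ S z]) auto
  show "normalized_deriv E2 z = ((E2 z)\<^sup>2 - E4 z) / 12"
    using f[OF z] by (simp add: f_def field_simps)
  show "E4 (- 1 / z) = z ^ 4 * E4 z"
    using S[OF z] f z uhp_minus_inverse by (simp del: power_Suc)
qed

text \<open>The form is now - 3 times the Serre derivative of \<open>E4\<close>, of weight 6, with
  q-coefficient - 24 + 240 - 720 = - 504.\<close>

lemma
  assumes z: "z \<in> uhp"
  shows Ramanujan_E4: "normalized_deriv E4 z = (E2 z * E4 z - E6 z) / 3"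
    and E6_transform: "E6 (- 1 / z) = z ^ 6 * E6 z"
proof -
  define f where "f z = E2 z * E4 z + (- 3) * normalized_deriv E4 z" for z
  have F: "cusp_rep 0 (\<lambda>q. E2q q * E4q q + (- 3) * (q * deriv E4q q)) f"
    unfolding f_def using cusp_rep_mult[OF cusp_rep_E2 cusp_rep_E4] 
    by (intro cusp_rep_add cusp_rep_cmult cusp_rep_E4_deriv) simp
  have "((\<lambda>q. E2q q * E4q q + (- 3) * (q * deriv E4q q)) has_field_derivative (((- 24) * E4q 0 + 240 * E2q 0) + (- 3) * 240)) (at 0)"
    using cusp_rep_E4 by (intro DERIV_add DERIV_mult DERIV_cmult times_deriv_at_0 Eq_deriv_0) (auto simp: cusp_rep_def)
  then have F1: "((\<lambda>q. E2q q * E4q q + (- 3) * (q * deriv E4q q)) has_field_derivative (- 504)) (at 0)" by simp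
  have fs: "f z = (- 3) * serre_deriv 4 E4 z" for z by (simp add: f_def serre_deriv_def)
  have S: "f (- 1 / z) = z ^ Suc 5 * f z" if z: "z \<in> uhp" for z
    unfolding fs using serre_deriv_modular[OF E_holomorphic(2) _ z, of 4] E4_transform by (simp del: power_Suc)
  have f: "f z = E6 z" if z: "z \<in> uhp" for z
    unfolding E6_eq[OF z] using sigma_series_identify[OF _ _ _ F _ F1 _ S z] by simp
  show "normalized_deriv E4 z = (E2 z * E4 z - E6 z) / 3"
    using f[OF z] by (simp add: f_def field_simps)
  show "E6 (- 1 / z) = z ^ 6 * E6 z"
    using S[OF z] f z uhp_minus_inverse by (simp del: power_Suc)
qed

text \<open>The difference of the two sides is a form of weight 8 whose constant term - 1/2 + 1/2
  vanishes, so it is 0.\<close>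

lemma Ramanujan_E6:
  assumes z: "z \<in> uhp"
  shows "normalized_deriv E6 z = (E2 z * E6 z - (E4 z)\<^sup>2) / 2"
proof -
  define f where "f z = normalized_deriv E6 z + ((- 1 / 2) * (E2 z * E6 z) + (1 / 2) * (E4 z)\<^sup>2)" for z
  have F: "cusp_rep 0 (\<lambda>q. q * deriv E6q q + ((- 1 / 2) * (E2q q * E6q q) + (1 / 2) * (E4q q)\<^sup>2)) f"
    unfolding f_def using cusp_rep_mult[OF cusp_rep_E2 cusp_rep_E6] 
    by (intro cusp_rep_add cusp_rep_cmult cusp_rep_E6_deriv cusp_rep_power cusp_rep_E4) simp
  have fs: "f z = serre_deriv 6 E6 z + (1 / 2) * (E4 z)\<^sup>2" for z by (simp add: f_def serre_deriv_def)
  have S: "f (- 1 / z) = z ^ 8 * f z" if z: "z \<in> uhp" for z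
    unfolding fs using serre_deriv_modular[OF E_holomorphic(3) _ z, of 6] E6_transform E4_transform[OF z]
    by (simp add: power_mult_distrib distrib_left)
  have "f z = 0" by (rule small_weight_zero[OF _ _ F _ S z]) auto
  then show ?thesis by (simp add: f_def field_simps)
qed

abbreviation "\<Delta> \<equiv> modular_discriminant"

section \<open>The discriminant has no zero on the half plane and a simple one at the cusp\<close>

lemma Delta_holomorphic: "\<Delta> holomorphic_on uhp"
  unfolding modular_discriminant_def[abs_def] by (intro holomorphic_intros E_holomorphic) auto

lemma Delta_transform:
  assumes z: "z \<in> uhp" shows "\<Delta> (- 1 / z) = z ^ 12 * \<Delta> z"
  unfolding modular_discriminant_def E4_transform[OF z] E6_transform[OF z]
  by (simp add: power_mult_distrib power_mult[symmetric] right_diff_distrib)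

lemma Ramanujan_Delta:
  assumes z: "z \<in> uhp" shows "normalized_deriv \<Delta> z = E2 z * \<Delta> z"
proof (rule normalized_deriv_eqI)
  have "(\<Delta> has_field_derivative ((of_nat 3 * (2 * of_real pi * \<i> * normalized_deriv E4 z * E4 z ^ (3 - Suc 0)) 
      - of_nat 2 * (2 * of_real pi * \<i> * normalized_deriv E6 z * E6 z ^ (2 - Suc 0))) / 1728)) (at z)"
    unfolding modular_discriminant_def[abs_def]
    by (intro DERIV_cdivide DERIV_diff DERIV_power has_normalized_deriv E_holomorphic z)
  then show "(\<Delta> has_field_derivative (2 * of_real pi * \<i> * (E2 z * \<Delta> z))) (at z)"
    by (rule back_subst[of "\<lambda>x. (\<Delta> has_field_derivative x) (at z)"])
      (simp add: Ramanujan_E4[OF z] Ramanujan_E6[OF z] modular_discriminant_def field_simps power2_eq_square power3_eq_cube)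
qed

lemma Delta_cusp_rep: "\<exists>G. cusp_rep 1 G \<Delta> \<and> G 0 = 1"
proof -
  define F where "F q = (1 / 1728) * (E4q q ^ 3 + (- 1) * E6q q ^ 2)" for q
  have F: "cusp_rep 0 F \<Delta>"
  proof -
    have "cusp_rep 0 F (\<lambda>z. (1 / 1728) * (E4 z ^ 3 + (- 1) * E6 z ^ 2))"
      unfolding F_def by (intro cusp_rep_add cusp_rep_cmult cusp_rep_power cusp_rep_E4 cusp_rep_E6)
    then show ?thesis by (simp add: modular_discriminant_def[abs_def])
  qed
  \<comment> \<open>At q = 0 this derivative is (720 + 1008) / 1728 = 1.\<close>
  have "(F has_field_derivative ((1 / 1728) * (of_nat 3 * (240 * E4q 0 ^ (3 - Suc 0)) + (- 1) * (of_nat 2 * ((- 504) * E6q 0 ^ (2 - Suc 0)))))) (at 0)"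
    unfolding F_def[abs_def] by (intro DERIV_cmult DERIV_add DERIV_power Eq_deriv_0)
  then have "deriv F 0 = 1" by (simp add: DERIV_imp_deriv)
  moreover have "F 0 = 0" by (simp add: F_def)
  ultimately show ?thesis using cusp_rep_factor[OF F] by metis
qed

lemma cusp_rep_not_zero:
  assumes "cusp_rep l F f" "F 0 \<noteq> 0"
  shows "\<exists>z\<in>uhp. f z \<noteq> 0"
proof (rule ccontr)
  assume *: "\<not> ?thesis"
  have "cusp_rep l (\<lambda>_. 0) f" using * by (auto simp: cusp_rep_def)
  then show False using cusp_rep_unique[OF assms(1), of "\<lambda>_. 0" 0] assms(2) by simp
qed

text \<open>\<open>\<Delta>\<close> solves a first order linear equation, so a single zero would make it vanish identically.\<close>

lemma Delta_nonzero:
  assumes "z \<in> uhp" shows "\<Delta> z \<noteq> 0"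
proof -
  have "(\<lambda>z. 2 * of_real pi * \<i> * E2 z) holomorphic_on uhp" by (intro holomorphic_intros E_holomorphic)
  then obtain h where h: "\<And>z. z \<in> uhp \<Longrightarrow> (h has_field_derivative (2 * of_real pi * \<i> * E2 z)) (at z)"
    using holomorphic_convex_primitive'[OF convex_uhp open_uhp] by (metis open_uhp at_within_open)
  have "((\<lambda>z. \<Delta> z * exp (- h z)) has_field_derivative 0) (at z)" if z: "z \<in> uhp" for z
    by (rule derivative_eq_intros has_normalized_deriv[OF Delta_holomorphic z] h[OF z] refl)+
       (simp add: Ramanujan_Delta[OF z])
  then obtain c where c: "\<And>z. z \<in> uhp \<Longrightarrow> \<Delta> z * exp (- h z) = c"
    using has_field_derivative_zero_constant[OF convex_uhp, of "\<lambda>z. \<Delta> z * exp (- h z)"] has_field_derivative_at_within by metis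
  obtain G where "cusp_rep 1 G \<Delta>" "G 0 = 1" using Delta_cusp_rep by blast
  then obtain z0 where "z0 \<in> uhp" "\<Delta> z0 \<noteq> 0" using cusp_rep_not_zero[of 1 G \<Delta>] by auto
  then have "c \<noteq> 0" using c[of z0] by auto
  then show ?thesis using c[OF assms] by auto
qed

lemma E4_not_zero: "\<exists>z\<in>uhp. E4 z \<noteq> 0"
  by (rule cusp_rep_not_zero[OF cusp_rep_E4]) simp

section \<open>Dimensions\<close>

lemma modular_forms_memI:
  fixes k :: int
  assumes "even k" "cusp_rep 0 F f" "\<And>z. z \<in> uhp \<Longrightarrow> f (- 1 / z) = z powi k * f z" "\<And>z. z \<notin> uhp \<Longrightarrow> f z = 0"
  shows "f \<in> modular_forms k"
proof -
  have "restrict_uhp f \<in> modular_forms k"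
    by (rule modular_formsI[OF assms(1) _ assms(3) assms(2)]) (use cusp_rep_periodic[OF assms(2)] in auto)
  moreover have "restrict_uhp f = f" using assms(4) by (auto simp: restrict_uhp_def)
  ultimately show ?thesis by simp
qed

lemma modular_forms_subspace:
  assumes "even k"
  shows "fun_space.subspace (modular_forms k)"
proof (rule fun_space.subspaceI)
  show "0 \<in> modular_forms k"
    by (rule modular_forms_memI[OF assms cusp_rep_const[of 0, folded zero_fun_def]]) (auto simp: zero_fun_def)
next
  fix f g assume fg: "f \<in> modular_forms k" "g \<in> modular_forms k"
  obtain F G where F: "cusp_rep 0 F f" and G: "cusp_rep 0 G g" using modular_cusp_rep fg by metis
  have "f + g = (\<lambda>z. f z + g z)" by (rule ext) simp
  then have R: "cusp_rep 0 (\<lambda>q. F q + G q) (f + g)" using cusp_rep_add[OF F G] by (simp only:)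
  show "f + g \<in> modular_forms k"
  proof (rule modular_forms_memI[OF assms R])
    fix z assume z: "z \<in> uhp"
    have "f (- 1 / z) + g (- 1 / z) = z powi k * f z + z powi k * g z"
      by (simp only: modular_minus_inverse[OF fg(1) z] modular_minus_inverse[OF fg(2) z])
    then show "(f + g) (- 1 / z) = z powi k * (f + g) z"
      by (simp only: plus_fun_apply distrib_left)
  qed (use modular_outside[OF fg(1)] modular_outside[OF fg(2)] in simp)
next
  fix c f assume f: "f \<in> modular_forms k"
  obtain F where F: "cusp_rep 0 F f" using modular_cusp_rep f by metis
  have R: "cusp_rep 0 (\<lambda>q. c * F q) (scale_fun c f)"
    unfolding scale_fun_def by (rule cusp_rep_cmult[OF F])
  show "scale_fun c f \<in> modular_forms k"
  proof (rule modular_forms_memI[OF assms R])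
    fix z assume z: "z \<in> uhp"
    have "c * f (- 1 / z) = z powi k * (c * f z)"
      by (simp only: modular_minus_inverse[OF f z] mult.left_commute)
    then show "scale_fun c f (- 1 / z) = z powi k * scale_fun c f z"
      by (simp only: scale_fun_def)
  qed (use modular_outside[OF f] in \<open>simp add: scale_fun_def\<close>)
qed

text \<open>In contrast to \<open>fun_space.dim\<close>, which is 0 when no finite basis exists,
  this certifies a finite basis and also that S is a subspace.\<close>

definition has_dim :: "(complex \<Rightarrow> complex) set \<Rightarrow> nat \<Rightarrow> bool" where
  "has_dim S d \<longleftrightarrow> (\<exists>B. finite B \<and> card B = d \<and> fun_space.independent B \<and> fun_space.span B = S)"

lemma has_dim_imp_dim: "has_dim S d \<Longrightarrow> fun_space.dim S = d"
  unfolding has_dim_def using fun_space.dim_eq_card fun_space.span_span by metis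

lemma has_dim_imp_subspace: "has_dim S d \<Longrightarrow> fun_space.subspace S"
  unfolding has_dim_def using fun_space.subspace_span by metis

lemma has_dim_zero: "has_dim {0} 0"
  unfolding has_dim_def by (intro exI[of _ "{}"]) (auto simp: fun_space.independent_empty)

text \<open>Applied with N the forms vanishing at the cusp and G a form with constant term 1:
  subtracting a multiple of G removes the constant term.\<close>

lemma has_dim_insert:
  assumes N: "has_dim N d" and S: "fun_space.subspace S" and sub: "N \<subseteq> S" and G: "G \<in> S" "G \<notin> N"
    and ex: "\<And>f. f \<in> S \<Longrightarrow> \<exists>c. f - scale_fun c G \<in> N"
  shows "has_dim S (Suc d)"
proof -
  obtain B where B: "finite B" "card B = d" "fun_space.independent B" "fun_space.span B = N"
    using N by (auto simp: has_dim_def)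
  have "G \<notin> B" using B(4) G(2) fun_space.span_base by blast
  have "fun_space.span (insert G B) = S"
  proof
    have "B \<subseteq> S" using B(4) fun_space.span_superset sub by blast
    then show "fun_space.span (insert G B) \<subseteq> S" using G S by (intro fun_space.span_minimal) auto
    show "S \<subseteq> fun_space.span (insert G B)"
      using ex by (auto simp: fun_space.span_breakdown_eq B(4))
  qed
  moreover have "fun_space.independent (insert G B)" using B G(2) by (intro fun_space.independent_insertI) auto
  ultimately show ?thesis unfolding has_dim_def using B \<open>G \<notin> B\<close> by (intro exI[of _ "insert G B"]) auto
qed

lemma has_dim_image_times:
  assumes V: "has_dim V d" and nz: "\<And>f. f \<in> V \<Longrightarrow> (\<lambda>z. u z * f z) = 0 \<Longrightarrow> f = 0"
  shows "has_dim ((\<lambda>f z. u z * f z) ` V) d"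
proof -
  interpret P: vector_space_pair scale_fun scale_fun by unfold_locales
  define T where "T f = (\<lambda>z. u z * f z)" for f :: "complex \<Rightarrow> complex"
  have lin: "Vector_Spaces.linear scale_fun scale_fun T"
    by unfold_locales (auto simp: T_def scale_fun_def fun_eq_iff algebra_simps)
  obtain B where B: "finite B" "card B = d" "fun_space.independent B" "fun_space.span B = V"
    using V by (auto simp: has_dim_def)
  have sub: "fun_space.subspace V" by (rule has_dim_imp_subspace[OF V])
  have inj: "inj_on T V"
  proof (rule inj_onI)
    fix f g assume fg: "f \<in> V" "g \<in> V" "T f = T g"
    have "f - g \<in> V" using fg sub by (intro fun_space.subspace_diff)
    moreover have "(\<lambda>z. u z * (f - g) z) = 0" using fg(3) by (auto simp: T_def fun_eq_iff algebra_simps)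
    ultimately have "f - g = 0" by (rule nz)
    then show "f = g" by simp
  qed
  have "fun_space.independent (T ` B)"
    using P.linear_independent_injective_image[OF lin B(3)] inj B(4) by simp
  moreover have "fun_space.span (T ` B) = T ` V"
    using P.linear_span_image[OF lin, of B] B(4) by simp
  moreover have "B \<subseteq> V" using B(4) fun_space.span_superset by blast
  then have "card (T ` B) = d" using B(2) inj by (simp add: card_image inj_on_subset)
  ultimately have "has_dim (T ` V) d" unfolding has_dim_def using B(1) by (intro exI[of _ "T ` B"]) auto
  then show ?thesis by (simp add: T_def[abs_def])
qed

lemma has_dim_direct_sum:
  assumes V: "has_dim V a" and W: "has_dim W b" and int: "V \<inter> W \<subseteq> {0}"
  shows "has_dim {v + w | v w. v \<in> V \<and> w \<in> W} (a + b)"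
proof -
  obtain C where C: "finite C" "card C = b" "fun_space.independent C" "fun_space.span C = W"
    using W by (auto simp: has_dim_def)
  have subV: "fun_space.subspace V" by (rule has_dim_imp_subspace[OF V])
  have "has_dim {v + w | v w. v \<in> V \<and> w \<in> fun_space.span C} (a + card C)"
    if "finite C" "fun_space.independent C" "V \<inter> fun_space.span C \<subseteq> {0}" for C
    using that
  proof (induction C rule: finite_induct)
    case empty
    have "{v + w | v w. v \<in> V \<and> w \<in> fun_space.span {}} = V" by auto
    then show ?case using V by simp
  next
    case (insert c C)
    have indep: "fun_space.independent C" "c \<notin> fun_space.span C"
      using insert.prems(1) insert.hyps(2) by (auto simp: fun_space.independent_insert)
    have "fun_space.span C \<subseteq> fun_space.span (insert c C)" by (rule fun_space.span_mono) auto
    then have N: "has_dim {v + w | v w. v \<in> V \<and> w \<in> fun_space.span C} (a + card C)" (is "has_dim ?N _")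
      using insert.IH indep insert.prems(2) by blast
    have "has_dim {v + w | v w. v \<in> V \<and> w \<in> fun_space.span (insert c C)} (Suc (a + card C))" (is "has_dim ?S _")
    proof (rule has_dim_insert[OF N])
      show "fun_space.subspace ?S" by (rule fun_space.subspace_sums[OF subV fun_space.subspace_span])
      show "?N \<subseteq> ?S" using fun_space.span_mono[of C "insert c C"] by blast
      have "c = 0 + c" by simp
      moreover have "0 \<in> V" by (rule fun_space.subspace_0[OF subV])
      moreover have "c \<in> fun_space.span (insert c C)" by (simp add: fun_space.span_base)
      ultimately show "c \<in> ?S" by blast
      show "c \<notin> ?N"
      proof
        assume "c \<in> ?N"
        then obtain v w where vw: "c = v + w" "v \<in> V" "w \<in> fun_space.span C" by blast
        have "w \<in> fun_space.span (insert c C)" using vw(3) fun_space.span_mono[of C "insert c C"] by blast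
        then have "c - w \<in> fun_space.span (insert c C)" by (intro fun_space.span_diff) (simp_all add: fun_space.span_base)
        moreover have "c - w = v" using vw(1) by simp
        ultimately have "v \<in> {0}" using insert.prems(2) vw(2) by blast
        then have "v = 0" by blast
        then show False using vw indep(2) by simp
      qed
      show "\<exists>k. f - scale_fun k c \<in> ?N" if "f \<in> ?S" for f
      proof -
        obtain v w where vw: "f = v + w" "v \<in> V" "w \<in> fun_space.span (insert c C)" using \<open>f \<in> ?S\<close> by blast
        then obtain k where "w - scale_fun k c \<in> fun_space.span C" by (auto simp: fun_space.span_breakdown_eq)
        moreover have "f - scale_fun k c = v + (w - scale_fun k c)" using vw(1) by simp
        ultimately show ?thesis using vw(2) by blast
      qed
    qed
    moreover have "a + card (insert c C) = Suc (a + card C)" using insert.hyps by simp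
    ultimately show ?case by (simp only:)
  qed
  from this[OF C(1,3)] show ?thesis using C(2,4) int by simp
qed

section \<open>Dimensions of the spaces of modular forms\<close>

lemma E46_monomial:
  "restrict_uhp (\<lambda>z. E4 z ^ a * E6 z ^ b) \<in> modular_forms (int (4 * a + 6 * b))"
  "cusp_rep 0 (\<lambda>q. E4q q ^ a * E6q q ^ b) (restrict_uhp (\<lambda>z. E4 z ^ a * E6 z ^ b))"
proof -
  have F: "cusp_rep 0 (\<lambda>q. E4q q ^ a * E6q q ^ b) (\<lambda>z. E4 z ^ a * E6 z ^ b)"
    using cusp_rep_mult[OF cusp_rep_power[OF cusp_rep_E4, of a] cusp_rep_power[OF cusp_rep_E6, of b]] by simp
  then show "cusp_rep 0 (\<lambda>q. E4q q ^ a * E6q q ^ b) (restrict_uhp (\<lambda>z. E4 z ^ a * E6 z ^ b))"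
    by (simp add: cusp_rep_def restrict_uhp_eq)
  have S: "E4 (- 1 / z) ^ a * E6 (- 1 / z) ^ b = z powi int (4 * a + 6 * b) * (E4 z ^ a * E6 z ^ b)" if z: "z \<in> uhp" for z
    unfolding E4_transform[OF z] E6_transform[OF z] power_int_of_nat
    by (simp add: power_mult_distrib power_mult[symmetric] power_add)
  have ev: "even (int (4 * a + 6 * b))" by simp
  show "restrict_uhp (\<lambda>z. E4 z ^ a * E6 z ^ b) \<in> modular_forms (int (4 * a + 6 * b))"
    by (rule modular_formsI[OF ev cusp_rep_periodic[OF F] S F])
qed

lemma modular_form_small_weight_zero:
  assumes f: "f \<in> modular_forms (int k)" and k: "even k" "k \<le> 10" and F: "cusp_rep 0 F f" "F 0 = 0"
  shows "f = 0"
proof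
  fix z
  show "f z = 0 z"
  proof (cases "z \<in> uhp")
    case True
    then show ?thesis using small_weight_zero[OF k F _ True] modular_minus_inverse[OF f] by simp
  qed (use modular_outside[OF f] in simp)
qed

lemma cusp_rep_diff_scale:
  assumes "cusp_rep 0 F f" "cusp_rep 0 G g"
  shows "cusp_rep 0 (\<lambda>q. F q + (- c) * G q) (f - scale_fun c g)"
proof -
  have "f - scale_fun c g = (\<lambda>z. f z + (- c) * g z)" by (auto simp: scale_fun_def)
  then show ?thesis using cusp_rep_add[OF assms(1) cusp_rep_cmult[OF assms(2), of "- c"]] by simp
qed

lemma has_dim_small_weight:
  assumes k: "even k" "k \<le> 10" and G: "g \<in> modular_forms (int k)" "cusp_rep 0 G g" "G 0 = 1"
  shows "has_dim (modular_forms (int k)) 1"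
proof -
  have sub: "fun_space.subspace (modular_forms (int k))" using k by (intro modular_forms_subspace) simp
  have "has_dim (modular_forms (int k)) (Suc 0)"
  proof (rule has_dim_insert[OF has_dim_zero sub _ G(1)])
    show "{0} \<subseteq> modular_forms (int k)" using fun_space.subspace_0[OF sub] by simp
    show "g \<notin> {0}" using cusp_rep_not_zero[OF G(2)] G(3) by auto
    fix f assume f: "f \<in> modular_forms (int k)"
    then obtain F where F: "cusp_rep 0 F f" using modular_cusp_rep by blast
    have "f - scale_fun (F 0) g \<in> modular_forms (int k)"
      using f G(1) sub by (intro fun_space.subspace_diff fun_space.subspace_scale)
    then have "f - scale_fun (F 0) g = 0"
      by (rule modular_form_small_weight_zero[OF _ k cusp_rep_diff_scale[OF F G(2)]]) (simp add: G(3))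
    then show "\<exists>c. f - scale_fun c g \<in> {0}" by blast
  qed
  then show ?thesis by (simp add: One_nat_def)
qed

text \<open>No form with constant term 1 is available in weight 2. With a the constant term of f,
  the square and cube of f lie in weights 4 and 6, hence equal a^2 E4 and a^3 E6; then a^6 (E4^3 -
  E6^2) = f^6 - f^6 = 0 and the nonvanishing of \<Delta> gives a = 0.\<close>

lemma modular_forms_2: "modular_forms 2 = {0}"
proof -
  have "f = 0" if f: "f \<in> modular_forms 2" for f
  proof -
    obtain F where F: "cusp_rep 0 F f" using modular_cusp_rep[OF f] by blast
    define a where "a = F 0"
    have S: "f (- 1 / z) = z\<^sup>2 * f z" if "z \<in> uhp" for z using modular_minus_inverse[OF f that] by simp
    have 4: "f z ^ 2 + (- (a ^ 2)) * E4 z = 0" if z: "z \<in> uhp" for z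
      by (rule small_weight_zero[OF _ _ cusp_rep_add[OF cusp_rep_power[OF F, of 2] cusp_rep_cmult[OF cusp_rep_E4, of "- (a ^ 2)"]] _ _ z, of 4])
         (simp_all only: S E4_transform, simp_all add: a_def algebra_simps flip: power_mult)
    have 6: "f z ^ 3 + (- (a ^ 3)) * E6 z = 0" if z: "z \<in> uhp" for z
      by (rule small_weight_zero[OF _ _ cusp_rep_add[OF cusp_rep_power[OF F, of 3] cusp_rep_cmult[OF cusp_rep_E6, of "- (a ^ 3)"]] _ _ z, of 6])
         (simp_all only: S E6_transform, simp_all add: a_def algebra_simps flip: power_mult)
    have i: "\<i> \<in> uhp" by (simp add: uhp_def)
    have "a ^ 6 * (E4 \<i> ^ 3 - E6 \<i> ^ 2) = (f \<i> ^ 2) ^ 3 - (f \<i> ^ 3) ^ 2"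
    proof -
      have "f \<i> ^ 2 = a ^ 2 * E4 \<i>" "f \<i> ^ 3 = a ^ 3 * E6 \<i>" using 4[OF i] 6[OF i] by (simp_all add: add_eq_0_iff)
      then show ?thesis by (simp only:) (simp add: power_mult_distrib algebra_simps flip: power_mult)
    qed
    also have "\<dots> = 0" by (simp flip: power_mult)
    finally have "a = 0" using Delta_nonzero[OF i] by (simp add: modular_discriminant_def)
    then show ?thesis using modular_form_small_weight_zero[OF _ _ _ F, of 2] f by (simp add: a_def)
  qed
  then show ?thesis using fun_space.subspace_0[OF modular_forms_subspace[of 2]] by auto
qed

lemma Delta_cusp_rep_nonzero:
  obtains G where "cusp_rep 1 G \<Delta>" "G 0 = 1" "\<And>q. q \<in> ball 0 1 \<Longrightarrow> G q \<noteq> 0"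
proof -
  obtain G where G: "cusp_rep 1 G \<Delta>" "G 0 = 1" using Delta_cusp_rep by blast
  have "G q \<noteq> 0" if q: "q \<in> ball 0 1" for q
  proof (cases "q = 0")
    case False
    then obtain z where "z \<in> uhp" "qpar z = q" using qpar_surj q by metis
    then show ?thesis using Delta_nonzero[of z] G(1) by (auto simp: cusp_rep_def)
  qed (use G in simp)
  with G that show ?thesis by blast
qed

text \<open>Division is harmless because \<Delta> has no zeros on the half plane and its zero at the
  cusp is simple.\<close>

lemma cusp_form_div_Delta:
  assumes f: "f \<in> modular_forms (k + 12)" and k: "even k" and F: "cusp_rep 0 F f" "F 0 = 0"
  shows "\<exists>h\<in>modular_forms k. f = (\<lambda>z. \<Delta> z * h z)"
proof
  obtain G where G: "cusp_rep 1 G \<Delta>" "\<And>q. q \<in> ball 0 1 \<Longrightarrow> G q \<noteq> 0"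
    using Delta_cusp_rep_nonzero by metis
  obtain H where H: "cusp_rep 1 H f" using cusp_rep_factor[OF F] by blast
  define h where "h z = f z / \<Delta> z" for z
  show "f = (\<lambda>z. \<Delta> z * h z)"
  proof
    show "f z = \<Delta> z * h z" for z
      using Delta_nonzero[of z] modular_outside[OF f, of z] by (cases "z \<in> uhp") (auto simp: h_def)
  qed
  have "cusp_rep 0 (\<lambda>q. H q / G q) h"
    using H G by (auto simp: cusp_rep_def h_def intro!: holomorphic_intros)
  then show "h \<in> modular_forms k"
  proof (rule modular_forms_memI[OF k])
    fix z assume z: "z \<in> uhp"
    have "z \<noteq> 0" using z uhp_nonzero by auto
    then show "h (- 1 / z) = z powi k * h z"
      unfolding h_def modular_minus_inverse[OF f z] Delta_transform[OF z] by (simp add: power_int_add)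
  qed (use modular_outside[OF f] in \<open>simp add: h_def\<close>)
qed

lemma Delta_times_modular:
  assumes h: "h \<in> modular_forms k" and k: "even k"
  shows "(\<lambda>z. \<Delta> z * h z) \<in> modular_forms (k + 12)"
    and "\<exists>F. cusp_rep 0 F (\<lambda>z. \<Delta> z * h z) \<and> F 0 = 0"
proof -
  obtain G where G: "cusp_rep 1 G \<Delta>" using Delta_cusp_rep by blast
  obtain H where H: "cusp_rep 0 H h" using modular_cusp_rep[OF h] by blast
  have R: "cusp_rep 0 (\<lambda>q. q * G q * H q) (\<lambda>z. \<Delta> z * h z)"
    using G H by (auto simp: cusp_rep_def intro!: holomorphic_intros)
  show "(\<lambda>z. \<Delta> z * h z) \<in> modular_forms (k + 12)"
  proof (rule modular_forms_memI[OF _ R])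
    fix z assume z: "z \<in> uhp"
    have "z \<noteq> 0" using z uhp_nonzero by auto
    then show "\<Delta> (- 1 / z) * h (- 1 / z) = z powi (k + 12) * (\<Delta> z * h z)"
      unfolding modular_minus_inverse[OF h z] Delta_transform[OF z] by (simp add: power_int_add)
  qed (use k modular_outside[OF h] in auto)
  show "\<exists>F. cusp_rep 0 F (\<lambda>z. \<Delta> z * h z) \<and> F 0 = 0" using R by (intro exI[of _ "\<lambda>q. q * G q * H q"]) simp
qed

text \<open>Forms of weight k + 12 are \<Delta> times forms of weight k, plus the multiples of one
  form with constant term 1.\<close>

lemma has_dim_plus_12:
  assumes V: "has_dim (modular_forms k) d" and k: "even k"
    and G: "g \<in> modular_forms (k + 12)" "cusp_rep 0 G g" "G 0 = 1"
  shows "has_dim (modular_forms (k + 12)) (Suc d)"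
proof -
  have N: "has_dim ((\<lambda>f z. \<Delta> z * f z) ` modular_forms k) d"
  proof (rule has_dim_image_times[OF V])
    fix f assume f: "f \<in> modular_forms k" "(\<lambda>z. \<Delta> z * f z) = 0"
    then have "\<Delta> z * f z = 0" for z by (metis zero_fun_apply)
    then show "f = 0" using Delta_nonzero modular_outside[OF f(1)] by (fastforce simp: fun_eq_iff)
  qed
  have sub: "fun_space.subspace (modular_forms (k + 12))" using k by (intro modular_forms_subspace) simp
  show ?thesis
  proof (rule has_dim_insert[OF N sub _ G(1)])
    show "(\<lambda>f z. \<Delta> z * f z) ` modular_forms k \<subseteq> modular_forms (k + 12)"
      using Delta_times_modular(1) k by blast
    show "g \<notin> (\<lambda>f z. \<Delta> z * f z) ` modular_forms k"
    proof
      assume "g \<in> (\<lambda>f z. \<Delta> z * f z) ` modular_forms k"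
      then obtain F where "cusp_rep 0 F g" "F 0 = 0" using Delta_times_modular(2) k by blast
      then show False using cusp_rep_unique[OF G(2), of F 0] G(3) by simp
    qed
    fix f assume f: "f \<in> modular_forms (k + 12)"
    then obtain F where F: "cusp_rep 0 F f" using modular_cusp_rep by blast
    have "f - scale_fun (F 0) g \<in> modular_forms (k + 12)"
      using f G(1) sub by (intro fun_space.subspace_diff fun_space.subspace_scale)
    then have "\<exists>h\<in>modular_forms k. f - scale_fun (F 0) g = (\<lambda>z. \<Delta> z * h z)"
      by (rule cusp_form_div_Delta[OF _ k cusp_rep_diff_scale[OF F G(2)]]) (simp add: G(3))
    then show "\<exists>c. f - scale_fun c g \<in> (\<lambda>f z. \<Delta> z * f z) ` modular_forms k" by blast
  qed
qed

text \<open>The numbers 6 m + 4 r with r <= 2 are the nonnegative even weights other than 2, each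
  obtained once, and E4^r E6^m is a form of that weight with constant term 1. Adding 12 to the
  weight raises m by 2 and the dimension by 1.\<close>

lemma has_dim_modular_forms:
  assumes "r \<in> {0, 1, 2}"
  shows "has_dim (modular_forms (int (6 * m + 4 * r))) (m div 2 + 1)"
proof (induction m rule: nat_less_induct)
  case (1 m)
  have G: "restrict_uhp (\<lambda>z. E4 z ^ r * E6 z ^ m) \<in> modular_forms (int (6 * m + 4 * r))"
    "cusp_rep 0 (\<lambda>q. E4q q ^ r * E6q q ^ m) (restrict_uhp (\<lambda>z. E4 z ^ r * E6 z ^ m))"
    using E46_monomial[of r m] by (simp_all add: add.commute)
  show ?case
  proof (cases "6 * m + 4 * r \<le> 10")
    case True
    then show ?thesis using has_dim_small_weight[OF _ True G] by simp
  next
    case False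
    show ?thesis
    proof (cases "m \<ge> 2")
      case True
      then obtain n where n: "m = n + 2" by (metis le_iff_add add.commute)
      have "has_dim (modular_forms (int (6 * n + 4 * r))) (n div 2 + 1)" using 1 n by simp
      moreover have "restrict_uhp (\<lambda>z. E4 z ^ r * E6 z ^ m) \<in> modular_forms (int (6 * n + 4 * r) + 12)"
        using G(1) by (simp add: n add_ac)
      ultimately have "has_dim (modular_forms (int (6 * n + 4 * r) + 12)) (Suc (n div 2 + 1))"
        using has_dim_plus_12[OF _ _ _ G(2), of "int (6 * n + 4 * r)"] by simp
      then show ?thesis using n by (simp add: add_ac)
    next
      case m: False
      \<comment> \<open>Weight 14 is the only one above 10 with m < 2; subtracting 12 leads to the
        exceptional weight 2.\<close>
      then have "m = 1 \<and> r = 2" using False assms by auto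
      moreover have "has_dim (modular_forms (2 + 12)) (Suc 0)"
      proof (rule has_dim_plus_12[OF _ _ _ G(2)])
        show "has_dim (modular_forms 2) 0" unfolding modular_forms_2 by (rule has_dim_zero)
        show "restrict_uhp (\<lambda>z. E4 z ^ r * E6 z ^ m) \<in> modular_forms (2 + 12)"
          using G(1) \<open>m = 1 \<and> r = 2\<close> by simp
      qed simp_all
      ultimately show ?thesis by (simp add: One_nat_def)
    qed
  qed
qed

section \<open>Quasimodular forms of depth one\<close>

lemma quasimodular_forms_1:
  "quasimodular_forms w 1 = {v + u | v u. v \<in> modular_forms w \<and> u \<in> (\<lambda>h z. E2 z * h z) ` modular_forms (w - 2)}"
proof -
  have all: "(\<forall>l\<le>1. P l) \<longleftrightarrow> P 0 \<and> P 1" for P :: "nat \<Rightarrow> bool" by (auto simp: le_Suc_eq One_nat_def)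
  have sum: "(\<Sum>l\<le>1. f l) = f 0 + f 1" for f :: "nat \<Rightarrow> complex" by (simp add: One_nat_def)
  show ?thesis
  proof (intro equalityI subsetI)
    fix f assume "f \<in> quasimodular_forms w 1"
    then obtain h where h: "f = (\<lambda>z. \<Sum>l\<le>1. E2 z ^ l * h l z)" "h 0 \<in> modular_forms w" "h 1 \<in> modular_forms (w - 2)"
      unfolding quasimodular_forms_def all by auto
    have "f = h 0 + (\<lambda>z. E2 z * h 1 z)" unfolding h(1) sum by (auto simp: fun_eq_iff)
    then show "f \<in> {v + u | v u. v \<in> modular_forms w \<and> u \<in> (\<lambda>h z. E2 z * h z) ` modular_forms (w - 2)}"
      using h by blast
  next
    fix f assume "f \<in> {v + u | v u. v \<in> modular_forms w \<and> u \<in> (\<lambda>h z. E2 z * h z) ` modular_forms (w - 2)}"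
    then obtain v h where vh: "f = v + (\<lambda>z. E2 z * h z)" "v \<in> modular_forms w" "h \<in> modular_forms (w - 2)" by blast
    define H where "H l = (if l = 0 then v else h)" for l :: nat
    have "f = (\<lambda>z. \<Sum>l\<le>1. E2 z ^ l * H l z)" unfolding vh(1) sum by (auto simp: fun_eq_iff H_def)
    moreover have "\<forall>l\<le>1. H l \<in> modular_forms (w - 2 * int l)" unfolding all using vh by (simp add: H_def)
    ultimately show "f \<in> quasimodular_forms w 1" unfolding quasimodular_forms_def by blast
  qed
qed

text \<open>If both h and E2 h are modular, the defect 6 z / (pi i) of \<open>E2\<close> times h
  must vanish. This makes the sum of the two spaces direct.\<close>

lemma quasimodular_unique:
  assumes v: "v \<in> modular_forms w" and h: "h \<in> modular_forms (w - 2)" and eq: "v = (\<lambda>z. E2 z * h z)"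
  shows "h = 0"
proof
  fix z
  show "h z = 0 z"
  proof (cases "z \<in> uhp")
    case True
    have z0: "z \<noteq> 0" using True uhp_nonzero by auto
    have "v (- 1 / z) = E2 (- 1 / z) * h (- 1 / z)" by (rule fun_cong[OF eq])
    then have "z powi w * (E2 z * h z) = (z\<^sup>2 * E2 z + 6 * z / (of_real pi * \<i>)) * (z powi (w - 2) * h z)"
      unfolding modular_minus_inverse[OF v True] modular_minus_inverse[OF h True] E2_transform[OF True]
      by (simp add: fun_cong[OF eq, of z])
    moreover have "z powi w = z\<^sup>2 * z powi (w - 2)" using z0 by (simp add: power_int_diff)
    ultimately have "6 * z / (of_real pi * \<i>) * (z powi (w - 2) * h z) = 0" by (simp add: algebra_simps)
    then show ?thesis using z0 by simp
  qed (use modular_outside[OF h] in simp)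
qed

lemma has_dim_quasimodular_forms:
  assumes "has_dim (modular_forms w) a" "has_dim (modular_forms (w - 2)) b"
  shows "has_dim (quasimodular_forms w 1) (a + b)"
  unfolding quasimodular_forms_1
proof (rule has_dim_direct_sum[OF assms(1) has_dim_image_times[OF assms(2)]])
  have sub: "0 \<in> modular_forms w" by (rule fun_space.subspace_0[OF has_dim_imp_subspace[OF assms(1)]])
  show "f = 0" if "f \<in> modular_forms (w - 2)" "(\<lambda>z. E2 z * f z) = 0" for f
    using quasimodular_unique[OF sub that(1)] that(2) by simp
  show "modular_forms w \<inter> (\<lambda>h z. E2 z * h z) ` modular_forms (w - 2) \<subseteq> {0}"
  proof
    fix v assume "v \<in> modular_forms w \<inter> (\<lambda>h z. E2 z * h z) ` modular_forms (w - 2)"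
    then obtain h where h: "v \<in> modular_forms w" "h \<in> modular_forms (w - 2)" "v = (\<lambda>z. E2 z * h z)" by blast
    then have "h = 0" by (rule quasimodular_unique)
    then show "v \<in> {0}" using h(3) by (auto simp: fun_eq_iff)
  qed
qed

section \<open>Modular differential equations of second order\<close>

lemma nonzero_ball:
  assumes u: "u holomorphic_on uhp" and nz: "\<exists>z\<in>uhp. u z \<noteq> 0"
  obtains z0 e where "e > 0" "ball z0 e \<subseteq> uhp" "\<And>z. z \<in> ball z0 e \<Longrightarrow> u z \<noteq> 0"
proof -
  obtain z0 where z0: "z0 \<in> uhp" "u z0 \<noteq> 0" using nz by blast
  have "open (uhp \<inter> u -` (- {0}))"
    by (intro continuous_open_preimage holomorphic_on_imp_continuous_on u open_uhp) auto
  then obtain e where "e > 0" "ball z0 e \<subseteq> uhp \<inter> u -` (- {0})" 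
    using z0 by (metis open_contains_ball IntI vimageI ComplI singletonD)
  then show ?thesis by (intro that[of e z0]) auto
qed

lemma holomorphic_eq_on_uhp:
  assumes "f holomorphic_on uhp" "g holomorphic_on uhp" "e > 0" "ball z0 e \<subseteq> uhp"
    "\<And>z. z \<in> ball z0 e \<Longrightarrow> f z = g z" "z \<in> uhp"
  shows "f z = g z"
  by (rule analytic_continuation_open[of "ball z0 e" uhp f g])
     (use assms open_uhp connected_uhp in auto)

text \<open>The substitute for dividing by a function with isolated zeros, such as the leading
  coefficient of an equation.\<close>

lemma holomorphic_product_zero:
  assumes "u holomorphic_on uhp" "p holomorphic_on uhp" "\<exists>z\<in>uhp. u z \<noteq> 0"
    "\<And>z. z \<in> uhp \<Longrightarrow> u z * p z = 0" "z \<in> uhp"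
  shows "p z = 0"
proof -
  obtain z0 e where e: "e > 0" "ball z0 e \<subseteq> uhp" "\<And>z. z \<in> ball z0 e \<Longrightarrow> u z \<noteq> 0"
    using nonzero_ball[OF assms(1,3)] by metis
  show ?thesis
  proof (rule holomorphic_eq_on_uhp[OF assms(2) holomorphic_on_const e(1,2) _ assms(5)])
    fix z assume z: "z \<in> ball z0 e"
    then have "u z * p z = 0" using assms(4) e(2) by blast
    then show "p z = 0" using e(3)[OF z] by simp
  qed
qed

text \<open>The quotient p / u is constant on a disc free of zeros of u, and analytic continuation
  carries the proportionality over the zeros.\<close>

lemma proportional_if_Wronskian_zero:
  assumes u: "u holomorphic_on uhp" and p: "p holomorphic_on uhp" and nz: "\<exists>z\<in>uhp. u z \<noteq> 0"
    and W: "\<And>z. z \<in> uhp \<Longrightarrow> u z * normalized_deriv p z = p z * normalized_deriv u z"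
  obtains c where "\<And>z. z \<in> uhp \<Longrightarrow> p z = c * u z"
proof -
  obtain z0 e where e: "e > 0" "ball z0 e \<subseteq> uhp" "\<And>z. z \<in> ball z0 e \<Longrightarrow> u z \<noteq> 0"
    using nonzero_ball[OF u nz] by metis
  have "((\<lambda>z. p z / u z) has_field_derivative 0) (at z within ball z0 e)" if "z \<in> ball z0 e" for z
  proof -
    have z: "z \<in> uhp" "u z \<noteq> 0" using that e by auto
    have "((\<lambda>z. p z / u z) has_field_derivative 
      (2 * of_real pi * \<i> * normalized_deriv p z * u z - p z * (2 * of_real pi * \<i> * normalized_deriv u z)) / (u z * u z)) (at z)"
      by (rule DERIV_divide[OF has_normalized_deriv[OF p z(1)] has_normalized_deriv[OF u z(1)] z(2)])
    moreover have "2 * of_real pi * \<i> * normalized_deriv p z * u z - p z * (2 * of_real pi * \<i> * normalized_deriv u z) = 0"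
      using W[OF z(1)] by (simp add: mult_ac)
    ultimately show ?thesis by (auto intro: has_field_derivative_at_within)
  qed
  then obtain c where c: "\<And>z. z \<in> ball z0 e \<Longrightarrow> p z / u z = c"
    using has_field_derivative_zero_constant[OF convex_ball, of z0 e "\<lambda>z. p z / u z"] by blast
  have "p z = c * u z" if "z \<in> uhp" for z
  proof (rule holomorphic_eq_on_uhp[OF p _ e(1,2) _ that])
    show "(\<lambda>z. c * u z) holomorphic_on uhp" by (intro holomorphic_intros u)
    show "p z = c * u z" if "z \<in> ball z0 e" for z using c[OF that] e(3)[OF that] by (simp add: field_simps)
  qed
  then show ?thesis using that by blast
qed

section \<open>Wronskians, Serre derivatives and translation\<close>

definition Wronskian :: "(complex \<Rightarrow> complex) \<Rightarrow> (complex \<Rightarrow> complex) \<Rightarrow> complex \<Rightarrow> complex" where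
  "Wronskian f g z = f z * normalized_deriv g z - g z * normalized_deriv f z"

lemma Wronskian_holomorphic:
  "f holomorphic_on uhp \<Longrightarrow> g holomorphic_on uhp \<Longrightarrow> Wronskian f g holomorphic_on uhp"
  unfolding Wronskian_def[abs_def] by (intro holomorphic_intros)

text \<open>The \<open>E2\<close> terms of the two Serre derivatives cancel, so any weight k may be
  chosen.\<close>

lemma Wronskian_serre: "Wronskian f g z = f z * serre_deriv k g z - g z * serre_deriv k f z"
  by (simp add: Wronskian_def serre_deriv_def algebra_simps)

lemma serre_deriv_mult:
  assumes "f holomorphic_on uhp" "g holomorphic_on uhp" "z \<in> uhp"
  shows "serre_deriv (k + l) (\<lambda>z. f z * g z) z = serre_deriv k f z * g z + f z * serre_deriv l g z"
  using normalized_deriv_mult[OF assms] by (simp add: serre_deriv_def algebra_simps add_divide_distrib)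

lemma serre_deriv_add:
  assumes "f holomorphic_on uhp" "g holomorphic_on uhp" "z \<in> uhp"
  shows "serre_deriv k (\<lambda>z. f z + g z) z = serre_deriv k f z + serre_deriv k g z"
  using normalized_deriv_add[OF assms] by (simp add: serre_deriv_def algebra_simps)

lemma serre_deriv_cmult:
  assumes "f holomorphic_on uhp" "z \<in> uhp"
  shows "serre_deriv k (\<lambda>z. c * f z) z = c * serre_deriv k f z"
  using normalized_deriv_cmult[OF assms] by (simp add: serre_deriv_def algebra_simps)

text \<open>Each summand of the Wronskian is a product of weights k and k + 2; after differentiation
  the products of first derivatives cancel.\<close>

lemma serre_deriv_Wronskian:
  assumes f: "f holomorphic_on uhp" and g: "g holomorphic_on uhp" and z: "z \<in> uhp"
  shows "serre_deriv (2 * k + 2) (Wronskian f g) z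
     = f z * serre_deriv (k + 2) (serre_deriv k g) z - g z * serre_deriv (k + 2) (serre_deriv k f) z"
proof -
  have W: "Wronskian f g = (\<lambda>z. f z * serre_deriv k g z + (- 1) * (g z * serre_deriv k f z))"
    by (rule ext) (simp add: Wronskian_serre[of f g _ k])
  have e: "2 * k + 2 = k + (k + 2)" by simp
  have sf: "serre_deriv k f holomorphic_on uhp" and sg: "serre_deriv k g holomorphic_on uhp"
    by (intro serre_deriv_holomorphic f g)+
  have h: "(\<lambda>z. f z * serre_deriv k g z) holomorphic_on uhp" "(\<lambda>z. g z * serre_deriv k f z) holomorphic_on uhp"
     "(\<lambda>z. (- 1) * (g z * serre_deriv k f z)) holomorphic_on uhp"
    by (intro holomorphic_intros f g sf sg)+
  show ?thesis unfolding W e serre_deriv_add[OF h(1,3) z] serre_deriv_cmult[OF h(2) z]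
      serre_deriv_mult[OF f sg z] serre_deriv_mult[OF g sf z] by (simp add: algebra_simps)
qed

lemma normalized_deriv_shift:
  assumes f: "f holomorphic_on uhp" and z: "z \<in> uhp"
  shows "normalized_deriv (\<lambda>z. f (z + 1)) z = normalized_deriv f (z + 1)"
proof (rule normalized_deriv_eqI)
  have "z + 1 \<in> uhp" using uhp_add_int[OF z, of 1] by simp
  have "((\<lambda>z. z + 1) has_field_derivative 1) (at z)" by (auto intro!: derivative_eq_intros)
  from DERIV_chain2[where g = "\<lambda>z. z + 1", OF has_normalized_deriv[OF f \<open>z + 1 \<in> uhp\<close>] this]
  show "((\<lambda>z. f (z + 1)) has_field_derivative (2 * of_real pi * \<i> * normalized_deriv f (z + 1))) (at z)"
    by simp
qed

lemma uhp_plus_1: "z \<in> uhp \<Longrightarrow> z + 1 \<in> uhp"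
  using uhp_add_int[of z 1] by simp

lemma shift_holomorphic:
  assumes "f holomorphic_on uhp"
  shows "(\<lambda>z. f (z + 1)) holomorphic_on uhp"
proof -
  have "(f \<circ> (\<lambda>z. z + 1)) holomorphic_on uhp"
    by (rule holomorphic_on_compose_gen[OF _ assms]) (auto intro!: holomorphic_intros uhp_plus_1)
  then show ?thesis by (simp add: o_def)
qed

lemma serre_deriv_shift:
  assumes f: "f holomorphic_on uhp" and z: "z \<in> uhp"
  shows "serre_deriv k (\<lambda>z. f (z + 1)) z = serre_deriv k f (z + 1)"
  using normalized_deriv_shift[OF f z] cusp_rep_periodic[OF cusp_rep_E2 z] by (simp add: serre_deriv_def)

text \<open>A, B and C are the coefficients of a second order operator acting in weight k, of
  weights a, a + 2 and a + 4, so that the equation is invariant. V is a known solution of the first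
  order equation that Wronskians satisfy (Abel's identity). A is only required not to vanish
  identically, which allows zeros inside the half plane.\<close>

locale modular_ode =
  fixes k a :: int and A B C V :: "complex \<Rightarrow> complex"
  assumes k: "odd k"
    and holomorphic: "A holomorphic_on uhp" "V holomorphic_on uhp"
    and A_nonzero: "\<exists>z\<in>uhp. A z \<noteq> 0"
    and V_nonzero: "\<exists>z\<in>uhp. V z \<noteq> 0"
    and periodic: "\<And>z. z \<in> uhp \<Longrightarrow> A (z + 1) = A z" "\<And>z. z \<in> uhp \<Longrightarrow> B (z + 1) = B z"
      "\<And>z. z \<in> uhp \<Longrightarrow> C (z + 1) = C z" "\<And>z. z \<in> uhp \<Longrightarrow> V (z + 1) = V z"
    and transform: "\<And>z. z \<in> uhp \<Longrightarrow> A (- 1 / z) = z powi a * A z"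
      "\<And>z. z \<in> uhp \<Longrightarrow> B (- 1 / z) = z powi (a + 2) * B z"
      "\<And>z. z \<in> uhp \<Longrightarrow> C (- 1 / z) = z powi (a + 4) * C z"
    and V_eq: "\<And>z. z \<in> uhp \<Longrightarrow> A z * serre_deriv (2 * k + 2) V z + B z * V z = 0"
begin

section \<open>The solution space and its invariance\<close>

definition operator :: "(complex \<Rightarrow> complex) \<Rightarrow> complex \<Rightarrow> complex" where
  "operator f z = A z * serre_deriv (k + 2) (serre_deriv k f) z + B z * serre_deriv k f z + C z * f z"

abbreviation "solution \<equiv> holomorphic_solution operator"

lemma operator_cong:
  assumes "\<And>z. z \<in> uhp \<Longrightarrow> f z = g z" "f holomorphic_on uhp" "z \<in> uhp"
  shows "operator f z = operator g z"
proof -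
  have 1: "serre_deriv k f z = serre_deriv k g z" if "z \<in> uhp" for z
    by (rule serre_deriv_cong[OF assms(1,2) that])
  have "serre_deriv (k + 2) (serre_deriv k f) z = serre_deriv (k + 2) (serre_deriv k g) z"
    by (rule serre_deriv_cong[OF 1 serre_deriv_holomorphic[OF assms(2)] assms(3)])
  then show ?thesis unfolding operator_def using 1 assms by simp
qed

lemma solution_cong:
  assumes eq: "\<And>z. z \<in> uhp \<Longrightarrow> f z = g z" and f: "solution f" 
  shows "solution g"
proof -
  have hf: "f holomorphic_on uhp" using f by (simp add: holomorphic_solution_def)
  have "g holomorphic_on uhp" using hf eq by (rule holomorphic_transform)
  moreover have "operator g z = 0" if "z \<in> uhp" for z
    using operator_cong[OF eq hf that] f that by (simp add: holomorphic_solution_def)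
  ultimately show ?thesis by (simp add: holomorphic_solution_def)
qed

lemma solution_lincomb:
  assumes f: "solution f" and g: "solution g"
  shows "solution (\<lambda>z. c * f z + d * g z)"
proof -
  have hf: "f holomorphic_on uhp" and hg: "g holomorphic_on uhp" using f g by (auto simp: holomorphic_solution_def)
  have hf': "(\<lambda>z. c * f z) holomorphic_on uhp" and hg': "(\<lambda>z. d * g z) holomorphic_on uhp"
    by (intro holomorphic_intros hf hg)+
  have s1: "serre_deriv k (\<lambda>z. c * f z + d * g z) z = c * serre_deriv k f z + d * serre_deriv k g z" if "z \<in> uhp" for z
    by (simp only: serre_deriv_add[OF hf' hg' that] serre_deriv_cmult[OF hf that] serre_deriv_cmult[OF hg that])
  have h: "serre_deriv k f holomorphic_on uhp" "serre_deriv k g holomorphic_on uhp" by (intro serre_deriv_holomorphic hf hg)+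
  have h': "(\<lambda>z. c * serre_deriv k f z) holomorphic_on uhp" "(\<lambda>z. d * serre_deriv k g z) holomorphic_on uhp"
    by (intro holomorphic_intros h)+
  have hol: "(\<lambda>z. c * f z + d * g z) holomorphic_on uhp" by (intro holomorphic_intros hf hg)
  have s2: "serre_deriv (k + 2) (serre_deriv k (\<lambda>z. c * f z + d * g z)) z
    = c * serre_deriv (k + 2) (serre_deriv k f) z + d * serre_deriv (k + 2) (serre_deriv k g) z" if z: "z \<in> uhp" for z
  proof -
    have "serre_deriv (k + 2) (serre_deriv k (\<lambda>z. c * f z + d * g z)) z
      = serre_deriv (k + 2) (\<lambda>z. c * serre_deriv k f z + d * serre_deriv k g z) z"
      by (rule serre_deriv_cong[OF s1 serre_deriv_holomorphic[OF hol] z])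
    then show ?thesis
      by (simp only: serre_deriv_add[OF h' z] serre_deriv_cmult[OF h(1) z] serre_deriv_cmult[OF h(2) z])
  qed
  have "operator (\<lambda>z. c * f z + d * g z) z = c * operator f z + d * operator g z" if "z \<in> uhp" for z
    unfolding operator_def s1[OF that] s2[OF that] by (simp add: algebra_simps)
  then show ?thesis using f g hol by (simp add: holomorphic_solution_def)
qed

text \<open>The Serre derivative intertwines the slash operators of weights k and k + 2, and the
  coefficients bring all three terms to the common factor z^(-(a + k + 4)).\<close>

lemma solution_slash:
  assumes f: "solution f" 
  shows "solution (slash k f)"
proof -
  have hf: "f holomorphic_on uhp" using f by (simp add: holomorphic_solution_def)
  have "operator (slash k f) z = 0" if z: "z \<in> uhp" for z
  proof -
    have z0: "z \<noteq> 0" using z uhp_nonzero by auto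
    have s1: "serre_deriv k (slash k f) z = slash (k + 2) (serre_deriv k f) z" if "z \<in> uhp" for z
      by (rule serre_deriv_slash[OF hf that])
    have "serre_deriv (k + 2) (serre_deriv k (slash k f)) z = serre_deriv (k + 2) (slash (k + 2) (serre_deriv k f)) z"
      by (rule serre_deriv_cong[OF s1 serre_deriv_holomorphic[OF slash_holomorphic[OF hf]] z])
    also have "\<dots> = slash (k + 2 + 2) (serre_deriv (k + 2) (serre_deriv k f)) z"
      by (rule serre_deriv_slash[OF serre_deriv_holomorphic[OF hf] z])
    finally have s2: "serre_deriv (k + 2) (serre_deriv k (slash k f)) z = slash (k + 2 + 2) (serre_deriv (k + 2) (serre_deriv k f)) z" .
    define y where "y = - 1 / z"
    have y: "y \<in> uhp" unfolding y_def by (rule uhp_minus_inverse[OF z])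
    define P where "P = z powi (- (a + k + 4))"
    have A: "A z = z powi (- a) * A y" "B z = z powi (- a - 2) * B y" "C z = z powi (- a - 4) * C y"
      unfolding y_def transform[OF z] using z0 by (simp_all add: power_int_add[symmetric] mult.assoc[symmetric])
    have p: "z powi (- a) * z powi (- (k + 2 + 2)) = P" "z powi (- a - 2) * z powi (- (k + 2)) = P" "z powi (- a - 4) * z powi (- k) = P"
      using z0 by (simp_all add: P_def power_int_add[symmetric] algebra_simps)
    have "operator (slash k f) z
      = (z powi (- a) * z powi (- (k + 2 + 2))) * (A y * serre_deriv (k + 2) (serre_deriv k f) y)
       + (z powi (- a - 2) * z powi (- (k + 2))) * (B y * serre_deriv k f y) + (z powi (- a - 4) * z powi (- k)) * (C y * f y)"
      unfolding operator_def s1[OF z] s2 unfolding slash_def A y_def[symmetric] by (simp only: mult_ac)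
    also have "\<dots> = P * operator f y" unfolding p operator_def by (simp only: distrib_left)
    also have "\<dots> = 0" using f y by (simp add: holomorphic_solution_def)
    finally show ?thesis .
  qed
  then show ?thesis using slash_holomorphic[OF hf] by (simp add: holomorphic_solution_def)
qed

lemma solution_shift:
  assumes f: "solution f" 
  shows "solution (\<lambda>z. f (z + 1))"
proof -
  have hf: "f holomorphic_on uhp" using f by (simp add: holomorphic_solution_def)
  have "operator (\<lambda>z. f (z + 1)) z = 0" if z: "z \<in> uhp" for z
  proof -
    have s1: "serre_deriv k (\<lambda>z. f (z + 1)) z = serre_deriv k f (z + 1)" if "z \<in> uhp" for z
      by (rule serre_deriv_shift[OF hf that])
    have "serre_deriv (k + 2) (serre_deriv k (\<lambda>z. f (z + 1))) z = serre_deriv (k + 2) (\<lambda>z. serre_deriv k f (z + 1)) z"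
      by (rule serre_deriv_cong[OF s1 serre_deriv_holomorphic[OF shift_holomorphic[OF hf]] z])
    also have "\<dots> = serre_deriv (k + 2) (serre_deriv k f) (z + 1)"
      by (rule serre_deriv_shift[OF serre_deriv_holomorphic[OF hf] z])
    finally have "operator (\<lambda>z. f (z + 1)) z = operator f (z + 1)"
      unfolding operator_def s1[OF z] by (simp only: periodic[OF z])
    then show ?thesis using f uhp_plus_1[OF z] by (simp add: holomorphic_solution_def)
  qed
  then show ?thesis using shift_holomorphic[OF hf] by (simp add: holomorphic_solution_def)
qed

text \<open>W and V satisfy the same first order equation, so A times their own Wronskian vanishes;
  the factor A is cancelled by the identity theorem.\<close>

lemma Wronskian_solutions:
  assumes f: "solution f" and g: "solution g"
  obtains c where "\<And>z. z \<in> uhp \<Longrightarrow> Wronskian f g z = c * V z"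
proof -
  have hf: "f holomorphic_on uhp" and hg: "g holomorphic_on uhp" using f g by (auto simp: holomorphic_solution_def)
  define W where "W = Wronskian f g"
  have hW: "W holomorphic_on uhp" unfolding W_def by (rule Wronskian_holomorphic[OF hf hg])
  have W_eq: "A z * serre_deriv (2 * k + 2) W z + B z * W z = 0" if z: "z \<in> uhp" for z
  proof -
    have "A z * serre_deriv (2 * k + 2) W z + B z * W z = f z * operator g z - g z * operator f z"
      unfolding W_def serre_deriv_Wronskian[OF hf hg z] Wronskian_serre[of f g z k] operator_def by (simp add: algebra_simps)
    then show ?thesis using f g z by (simp add: holomorphic_solution_def)
  qed
  have "V z * normalized_deriv W z - W z * normalized_deriv V z = 0" if z: "z \<in> uhp" for z
  proof (rule holomorphic_product_zero[OF holomorphic(1) _ A_nonzero _ z])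
    show "(\<lambda>z. V z * normalized_deriv W z - W z * normalized_deriv V z) holomorphic_on uhp"
      by (intro holomorphic_intros holomorphic hW)
    fix z assume z: "z \<in> uhp"
    have "V z * (A z * serre_deriv (2 * k + 2) W z + B z * W z) - W z * (A z * serre_deriv (2 * k + 2) V z + B z * V z) = 0"
      by (simp add: W_eq[OF z] V_eq[OF z])
    then show "A z * (V z * normalized_deriv W z - W z * normalized_deriv V z) = 0"
      by (simp add: serre_deriv_def algebra_simps)
  qed
  then obtain c where c: "\<And>z. z \<in> uhp \<Longrightarrow> W z = c * V z"
    using proportional_if_Wronskian_zero[OF holomorphic(2) hW V_nonzero] by (metis eq_iff_diff_eq_0)
  show ?thesis by (rule that[of c]) (use c in \<open>simp add: W_def\<close>)
qed

text \<open>All Wronskians are multiples of the same V. With \<beta> the quotient of two of the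
  constants, h - \<beta> v has zero Wronskian with u and is therefore a multiple of u.\<close>

lemma solution_in_span:
  assumes u: "solution u" and v: "solution v" and h: "solution h" and nz: "\<exists>z\<in>uhp. Wronskian u v z \<noteq> 0"
  obtains \<alpha> \<beta> where "\<And>z. z \<in> uhp \<Longrightarrow> h z = \<alpha> * u z + \<beta> * v z"
proof -
  have hu: "u holomorphic_on uhp" and hv: "v holomorphic_on uhp" and hh: "h holomorphic_on uhp" 
    using u v h by (auto simp: holomorphic_solution_def)
  obtain c where c: "\<And>z. z \<in> uhp \<Longrightarrow> Wronskian u v z = c * V z" using Wronskian_solutions[OF u v] by blast
  obtain d where d: "\<And>z. z \<in> uhp \<Longrightarrow> Wronskian u h z = d * V z" using Wronskian_solutions[OF u h] by blast
  have "c \<noteq> 0" using nz c by auto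
  define \<beta> where "\<beta> = d / c"
  define p where "p z = h z + (- \<beta>) * v z" for z
  have hv': "(\<lambda>z. (- \<beta>) * v z) holomorphic_on uhp" by (intro holomorphic_intros hv)
  have hp: "p holomorphic_on uhp" unfolding p_def by (intro holomorphic_intros hv hh)
  have "\<exists>z\<in>uhp. u z \<noteq> 0"
  proof (rule ccontr)
    assume *: "\<not> ?thesis"
    then have "normalized_deriv u z = normalized_deriv (\<lambda>_. 0) z" if "z \<in> uhp" for z
      using normalized_deriv_cong[of u "\<lambda>_. 0" z] hu that by auto
    then show False using nz * by (auto simp: Wronskian_def normalized_deriv_def)
  qed
  moreover have "u z * normalized_deriv p z = p z * normalized_deriv u z" if z: "z \<in> uhp" for z
  proof -
    have Dp: "normalized_deriv p z = normalized_deriv h z + (- \<beta>) * normalized_deriv v z"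
      unfolding p_def normalized_deriv_add[OF hh hv' z] normalized_deriv_cmult[OF hv z] ..
    have "Wronskian u h z - \<beta> * Wronskian u v z = 0" using \<open>c \<noteq> 0\<close> by (simp add: c[OF z] d[OF z] \<beta>_def)
    then show ?thesis unfolding Dp by (simp add: p_def Wronskian_def algebra_simps)
  qed
  ultimately obtain \<alpha> where "\<And>z. z \<in> uhp \<Longrightarrow> p z = \<alpha> * u z"
    using proportional_if_Wronskian_zero[OF hu hp] by blast
  then have "h z = \<alpha> * u z + \<beta> * v z" if "z \<in> uhp" for z using that by (simp add: p_def algebra_simps)
  then show ?thesis using that by blast
qed

section \<open>Relations of the modular group on solutions\<close>

lemma slash_transform:
  assumes z: "z \<in> uhp"
  shows "f (- 1 / z) = z powi k * slash k f z" "slash k f (- 1 / z) = - (z powi k * f z)"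
proof -
  have z0: "z \<noteq> 0" using z uhp_nonzero by auto
  show "f (- 1 / z) = z powi k * slash k f z" using z0 by (simp add: slash_def power_int_minus)
  have "(- 1 / z) powi (- k) = - (z powi k)"
  proof -
    have "(- 1 / z) powi (- k) = ((- 1) powi (- k)) / (z powi (- k))" by (rule power_int_divide_distrib)
    also have "(- 1 :: complex) powi (- k) = - 1" using k by (simp add: power_int_minus_left)
    finally show ?thesis using z0 by (simp add: power_int_minus field_simps)
  qed
  moreover have "- 1 / (- 1 / z) = z" using z0 by simp
  ultimately show "slash k f (- 1 / z) = - (z powi k * f z)" unfolding slash_def by (simp only: mult_minus_left)
qed

text \<open>The relation $(ST)^3 = S^2$ of the modular group, evaluated on a periodic function.\<close>

lemma slash_braid_relation:
  assumes per: "\<And>z. z \<in> uhp \<Longrightarrow> f (z + 1) = f z" 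
    and g: "\<And>z. z \<in> uhp \<Longrightarrow> slash k f (z + 1) = \<alpha> * f z + \<beta> * slash k f z" and z: "z \<in> uhp"
  shows "f z = \<beta> * (\<alpha> * f z + \<beta> * slash k f z) - \<alpha> * slash k f z"
proof -
  have z0: "z \<noteq> 0" using z uhp_nonzero by auto
  \<comment> \<open>The point u = -1/z - 1 is chosen because u + 1 = -1/z and -1/u = -1/(z + 1) + 1,
    so both of its images differ by translations from images of known points.\<close>
  define u where "u = - 1 / z + of_int (- 1)"
  have y: "- 1 / z \<in> uhp" by (rule uhp_minus_inverse[OF z])
  have u: "u \<in> uhp" unfolding u_def by (rule uhp_add_int[OF y])
  have u1: "u + 1 = - 1 / z" by (simp add: u_def)
  have z1: "z + 1 \<in> uhp" "z + 1 \<noteq> 0" using uhp_plus_1[OF z] uhp_nonzero by auto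
  have u0: "u \<noteq> 0" using u uhp_nonzero by auto
  have ueq: "u = - ((z + 1) / z)" using z0 by (simp add: u_def field_simps)
  have "f u = f (u + 1)" using per[OF u] by simp
  then have fu: "f u = z powi k * slash k f z" unfolding u1 by (simp only: slash_transform(1)[OF z])
  have "- 1 / u = - 1 / (z + 1) + 1" unfolding ueq using z0 z1(2) by (simp add: field_simps)
  then have "f (- 1 / u) = f (- 1 / (z + 1))" using per[OF uhp_minus_inverse[OF z1(1)]] by (simp only:)
  also have "\<dots> = (z + 1) powi k * slash k f (z + 1)" by (rule slash_transform(1)[OF z1(1)])
  finally have fu': "u powi k * slash k f u = (z + 1) powi k * slash k f (z + 1)"
    unfolding slash_transform(1)[OF u] .
  have "u powi k = - ((z + 1) powi k / z powi k)"
    unfolding ueq using k by (simp add: power_int_minus_left power_int_divide_distrib)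
  then have "(z + 1) powi k = - (u powi k * z powi k)" using z0 by (simp add: field_simps)
  then have "u powi k * slash k f u = u powi k * (- (z powi k * slash k f (z + 1)))"
    unfolding fu' by (simp only:) simp
  then have gu: "slash k f u = - (z powi k * slash k f (z + 1))"
    using u0 by (subst (asm) mult_left_cancel) simp_all
  have "slash k f (u + 1) = \<alpha> * f u + \<beta> * slash k f u" by (rule g[OF u])
  then have "- (z powi k * f z) = \<alpha> * (z powi k * slash k f z) - \<beta> * (z powi k * (\<alpha> * f z + \<beta> * slash k f z))"
    unfolding u1 slash_transform(2)[OF z] fu gu g[OF z] by simp
  then have "z powi k * f z = z powi k * (\<beta> * (\<alpha> * f z + \<beta> * slash k f z) - \<alpha> * slash k f z)"
    by (simp add: algebra_simps)
  then show ?thesis using z0 by simp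
qed

text \<open>Otherwise the image of f is \<mu> f. The braid relation with \<alpha> = 0 and \<beta> =
  1 gives \<mu> = 1, whereas the square - 1 of the transformation in odd weight requires \<mu>^2 = -
  1.\<close>

lemma Wronskian_slash_nonzero:
  assumes f: "solution f" and per: "\<And>z. z \<in> uhp \<Longrightarrow> f (z + 1) = f z" and nz: "\<exists>z\<in>uhp. f z \<noteq> 0"
  shows "\<exists>z\<in>uhp. Wronskian f (slash k f) z \<noteq> 0"
proof (rule ccontr)
  assume "\<not> ?thesis"
  then have "f z * normalized_deriv (slash k f) z = slash k f z * normalized_deriv f z" if "z \<in> uhp" for z
    using that by (auto simp: Wronskian_def)
  moreover have hf: "f holomorphic_on uhp" using f by (simp add: holomorphic_solution_def)
  ultimately obtain \<mu> where \<mu>: "\<And>z. z \<in> uhp \<Longrightarrow> slash k f z = \<mu> * f z"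
    using proportional_if_Wronskian_zero[OF hf slash_holomorphic[OF hf] nz] by blast
  obtain z where z: "z \<in> uhp" "f z \<noteq> 0" using nz by blast
  have z0: "z \<noteq> 0" using z uhp_nonzero by auto
  have "slash k f (z + 1) = 0 * f z + 1 * slash k f z" if "z \<in> uhp" for z
    using \<mu>[OF that] \<mu>[OF uhp_plus_1[OF that]] per[OF that] by simp
  from slash_braid_relation[OF per this z(1)] have "\<mu> = 1" using \<mu>[OF z(1)] z(2) by simp
  moreover have "- (z powi k * f z) = \<mu> * f (- 1 / z)"
    using slash_transform(2)[OF z(1), of f] \<mu>[OF uhp_minus_inverse[OF z(1)]] by simp
  ultimately have "- (z powi k * f z) = z powi k * f z"
    using slash_transform(1)[OF z(1), of f] \<mu>[OF z(1)] by simp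
  then show False using z z0 by simp
qed

text \<open>Translation multiplies the Wronskian of f and g by \<beta>, and V is periodic, so
  \<beta> = 1. The braid relation then reads (1 - \<alpha>) (g - f) = 0, and g = f is excluded by
  the nonzero Wronskian.\<close>

lemma slash_plus_1:
  assumes f: "solution f" and per: "\<And>z. z \<in> uhp \<Longrightarrow> f (z + 1) = f z" and nz: "\<exists>z\<in>uhp. f z \<noteq> 0" and z: "z \<in> uhp"
  shows "slash k f (z + 1) = f z + slash k f z"
proof -
  define g where "g = slash k f"
  have g: "solution g" unfolding g_def by (rule solution_slash[OF f])
  have hf: "f holomorphic_on uhp" and hg: "g holomorphic_on uhp" using f g by (auto simp: holomorphic_solution_def)
  have W: "\<exists>z\<in>uhp. Wronskian f g z \<noteq> 0" unfolding g_def by (rule Wronskian_slash_nonzero[OF f per nz])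
  obtain c where c: "\<And>z. z \<in> uhp \<Longrightarrow> Wronskian f g z = c * V z" using Wronskian_solutions[OF f g] by blast
  obtain \<alpha> \<beta> where ab: "\<And>z. z \<in> uhp \<Longrightarrow> g (z + 1) = \<alpha> * f z + \<beta> * g z"
    using solution_in_span[OF f g solution_shift[OF g] W] by blast
  have Wz: "Wronskian f g (z + 1) = \<beta> * Wronskian f g z" if z: "z \<in> uhp" for z
  proof -
    have "normalized_deriv f (z + 1) = normalized_deriv f z"
      using normalized_deriv_shift[OF hf z] normalized_deriv_cong[OF per shift_holomorphic[OF hf] z] by simp
    moreover have "normalized_deriv g (z + 1) = \<alpha> * normalized_deriv f z + \<beta> * normalized_deriv g z"
    proof -
      have "normalized_deriv g (z + 1) = normalized_deriv (\<lambda>z. \<alpha> * f z + \<beta> * g z) z"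
        using normalized_deriv_shift[OF hg z] normalized_deriv_cong[OF ab shift_holomorphic[OF hg] z] by simp
      also have "\<dots> = \<alpha> * normalized_deriv f z + \<beta> * normalized_deriv g z"
        by (subst normalized_deriv_add) (auto intro!: holomorphic_intros hf hg z simp: normalized_deriv_cmult hf hg z)
      finally show ?thesis .
    qed
    ultimately show ?thesis by (simp only: Wronskian_def per[OF z] ab[OF z]) (simp add: algebra_simps)
  qed
  have "\<beta> = 1"
  proof -
    obtain z where z: "z \<in> uhp" "Wronskian f g z \<noteq> 0" using W by blast
    then have "Wronskian f g (z + 1) = Wronskian f g z" by (simp add: c uhp_plus_1 periodic)
    then show ?thesis using Wz[OF z(1)] z(2) by simp
  qed
  have rel: "f z = (\<alpha> * f z + g z) - \<alpha> * g z" if "z \<in> uhp" for z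
    using slash_braid_relation[OF per ab[unfolded g_def] that] by (simp add: \<open>\<beta> = 1\<close> g_def)
  have "\<alpha> = 1"
  proof (rule ccontr)
    assume "\<alpha> \<noteq> 1"
    have fg: "g z = f z" if "z \<in> uhp" for z
    proof -
      have "(1 - \<alpha>) * (g z - f z) = 0" using rel[OF that] by (simp add: algebra_simps)
      then show ?thesis using \<open>\<alpha> \<noteq> 1\<close> by simp
    qed
    then have "normalized_deriv g z = normalized_deriv f z" if "z \<in> uhp" for z
      using normalized_deriv_cong[OF _ hg that, of f] by simp
    then show False using W fg by (simp add: Wronskian_def)
  qed
  then show ?thesis using ab[OF z] \<open>\<beta> = 1\<close> by (simp add: g_def)
qed

end

section \<open>The second solution at the cusp\<close>

lemma cusp_rep_shift:
  assumes "cusp_rep (l + int n) F f"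
  shows "cusp_rep l (\<lambda>q. q ^ n * F q) f"
  using assms by (auto simp: cusp_rep_def power_int_add intro!: holomorphic_intros)

lemma cusp_rep_shift': "cusp_rep i F f \<Longrightarrow> l \<le> i \<Longrightarrow> cusp_rep l (\<lambda>q. q ^ nat (i - l) * F q) f"
  by (rule cusp_rep_shift) simp

lemma cusp_rep_times_qpar: "cusp_rep l F f \<longleftrightarrow> cusp_rep 0 F (\<lambda>z. qpar z powi (- l) * f z)"
proof -
  have "f z = qpar z powi l * F (qpar z) \<longleftrightarrow> qpar z powi (- l) * f z = F (qpar z)" for z
    by (auto simp: power_int_minus field_simps)
  then show ?thesis by (simp add: cusp_rep_def)
qed

lemma cusp_rep_factor':
  assumes "cusp_rep l F f" "F 0 = 0"
  obtains G where "cusp_rep (l + 1) G f"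
proof -
  obtain G where G: "cusp_rep 1 G (\<lambda>z. qpar z powi (- l) * f z)"
    using cusp_rep_factor[of F "\<lambda>z. qpar z powi (- l) * f z"] assms cusp_rep_times_qpar by blast
  have "f z = qpar z powi (l + 1) * G (qpar z)" if "z \<in> uhp" for z
  proof -
    have "qpar z powi (- l) * f z = qpar z * G (qpar z)" using G that by (simp add: cusp_rep_def)
    then have "f z = qpar z powi l * (qpar z * G (qpar z))" by (simp add: power_int_minus field_simps)
    then show ?thesis by (simp add: power_int_add)
  qed
  then show ?thesis using G that[of G] by (simp add: cusp_rep_def)
qed

lemma qpar_powi_holomorphic: "(\<lambda>z. qpar z powi l) holomorphic_on uhp"
  by (intro holomorphic_intros) auto

lemma cusp_rep_holomorphic':
  assumes "cusp_rep l F f" shows "f holomorphic_on uhp"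
proof -
  have "(\<lambda>z. F (qpar z)) holomorphic_on uhp"
    by (rule cusp_rep_holomorphic[of F]) (use assms in \<open>simp add: cusp_rep_def\<close>)
  then have "(\<lambda>z. qpar z powi l * F (qpar z)) holomorphic_on uhp" 
    by (intro holomorphic_intros qpar_powi_holomorphic)
  then show ?thesis by (rule holomorphic_transform) (use assms in \<open>simp add: cusp_rep_def\<close>)
qed

lemma normalized_deriv_qpar_powi: "normalized_deriv (\<lambda>z. qpar z powi l) z = of_int l * qpar z powi l"
proof (rule normalized_deriv_eqI)
  have "((\<lambda>z. qpar z powi l) has_field_derivative (of_int l * qpar z powi (l - 1) * (2 * of_real pi * \<i> * qpar z * 1))) (at z)"
    by (rule DERIV_power_int[OF has_field_derivative_qpar[OF DERIV_ident]]) simp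
  moreover have "of_int l * qpar z powi (l - 1) * (2 * of_real pi * \<i> * qpar z * 1)
      = 2 * of_real pi * \<i> * (of_int l * (qpar z powi (l - 1) * qpar z))"
    by (simp add: mult_ac)
  moreover have "qpar z powi (l - 1) * qpar z = qpar z powi l" by (simp add: power_int_diff)
  ultimately show "((\<lambda>z. qpar z powi l) has_field_derivative (2 * of_real pi * \<i> * (of_int l * qpar z powi l))) (at z)"
    by (simp only:)
qed

lemma cusp_rep_normalized_deriv':
  assumes "cusp_rep l F f"
  shows "cusp_rep l (\<lambda>q. of_int l * F q + q * deriv F q) (normalized_deriv f)"
proof -
  have F: "cusp_rep 0 F (\<lambda>z. F (qpar z))" using assms by (simp add: cusp_rep_def)
  have h: "(\<lambda>z. F (qpar z)) holomorphic_on uhp" by (rule cusp_rep_holomorphic[OF F])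
  have D: "cusp_rep 0 (\<lambda>q. q * deriv F q) (normalized_deriv (\<lambda>z. F (qpar z)))" by (rule cusp_rep_normalized_deriv[OF F])
  have "normalized_deriv f z = qpar z powi l * (of_int l * F (qpar z) + qpar z * deriv F (qpar z))" if z: "z \<in> uhp" for z
  proof -
    have "normalized_deriv f z = normalized_deriv (\<lambda>z. qpar z powi l * F (qpar z)) z"
      by (rule normalized_deriv_cong[OF _ cusp_rep_holomorphic'[OF assms] z]) (use assms in \<open>simp add: cusp_rep_def\<close>)
    also have "\<dots> = of_int l * qpar z powi l * F (qpar z) + qpar z powi l * normalized_deriv (\<lambda>z. F (qpar z)) z"
      unfolding normalized_deriv_mult[OF qpar_powi_holomorphic h z] normalized_deriv_qpar_powi ..
    also have "normalized_deriv (\<lambda>z. F (qpar z)) z = qpar z * deriv F (qpar z)" using D z by (simp add: cusp_rep_def)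
    finally show ?thesis by (simp add: algebra_simps)
  qed
  moreover have "(\<lambda>q. of_int l * F q + q * deriv F q) holomorphic_on ball 0 1"
    using assms by (intro holomorphic_intros holomorphic_deriv) (auto simp: cusp_rep_def)
  ultimately show ?thesis by (simp add: cusp_rep_def)
qed

lemma cusp_rep_leading_bounds:
  assumes F: "cusp_rep l F f" "F 0 \<noteq> 0" and V: "cusp_rep m G V"
  obtains Y \<delta> K where "Y > 0" "\<delta> > 0" "\<And>z. Im z \<ge> Y \<Longrightarrow> norm (F (qpar z)) \<ge> \<delta>"
    "\<And>z. Im z \<ge> Y \<Longrightarrow> norm (F (qpar z)) \<le> K" "\<And>z. Im z \<ge> Y \<Longrightarrow> norm (G (qpar z)) \<le> K"
proof -
  have "isCont F 0" using F by (auto simp: cusp_rep_def intro!: continuous_on_interior[of "ball 0 1"] holomorphic_on_imp_continuous_on)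
  then have "(F \<longlongrightarrow> F 0) (nhds 0)" by (simp add: continuous_at tendsto_nhds_iff)
  then have "eventually (\<lambda>q. dist (F q) (F 0) < norm (F 0) / 2) (nhds 0)"
    by (rule tendstoD) (use F in simp)
  then obtain r where r: "r > 0" "\<And>q. dist q 0 < r \<Longrightarrow> dist (F q) (F 0) < norm (F 0) / 2"
    unfolding eventually_nhds_metric by blast
  have "((\<lambda>y. exp (- (2 * pi * y))) \<longlongrightarrow> 0) at_top" by real_asymp
  then have "eventually (\<lambda>y. exp (- (2 * pi * y)) < r) at_top" by (rule order_tendstoD) (use r in simp)
  then obtain Y0 where Y0: "\<And>y. y \<ge> Y0 \<Longrightarrow> exp (- (2 * pi * y)) < r"
    unfolding eventually_at_top_linorder by blast
  define Y where "Y = max Y0 1"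
  have Y: "Y > 0" "Y \<ge> Y0" by (auto simp: Y_def)
  have "norm (F (qpar z)) \<ge> norm (F 0) / 2" if "Im z \<ge> Y" for z
  proof -
    have "norm (qpar z) < r" using Y0[of "Im z"] that Y by (simp add: norm_qpar)
    then have "norm (F (qpar z) - F 0) < norm (F 0) / 2" using r(2)[of "qpar z"] by (simp add: dist_norm)
    then show ?thesis using norm_triangle_ineq3[of "F (qpar z)" "F 0"] by linarith
  qed
  moreover have "cusp_rep 0 F (\<lambda>z. F (qpar z))" "cusp_rep 0 G (\<lambda>z. G (qpar z))" using F V by (auto simp: cusp_rep_def)
  then obtain K1 K2 where "\<And>z. Im z \<ge> Y \<Longrightarrow> norm (F (qpar z)) \<le> K1" "\<And>z. Im z \<ge> Y \<Longrightarrow> norm (G (qpar z)) \<le> K2"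
    using cusp_rep_bounded Y(1) by meson
  then have "\<And>z. Im z \<ge> Y \<Longrightarrow> norm (F (qpar z)) \<le> max K1 K2" "\<And>z. Im z \<ge> Y \<Longrightarrow> norm (G (qpar z)) \<le> max K1 K2"
    by (auto intro: le_max_iff_disj[THEN iffD2])
  ultimately show ?thesis using that[of Y "norm (F 0) / 2" "max K1 K2"] Y F(2) by simp
qed

text \<open>Integrating $(g/f)' = c V / f^2 - 1$ along vertical lines bounds \<open>g\<close> near the cusp by a power of
  $q^{-1}$; this replaces the Frobenius expansion of the second solution.\<close>

lemma meromorphic_at_cusp:
  assumes F: "cusp_rep l F f" "F 0 \<noteq> 0" and l: "l \<ge> 0" and V: "cusp_rep m G V" and N: "2 * l \<le> m + int N"
    and g: "g holomorphic_on uhp" and per: "\<And>z. z \<in> uhp \<Longrightarrow> g (z + 1) = g z"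
    and W: "\<And>z. z \<in> uhp \<Longrightarrow> f z * normalized_deriv g z - g z * normalized_deriv f z = c * V z - (f z)\<^sup>2 / (2 * of_real pi * \<i>)"
  shows "\<exists>P. cusp_rep (- int N - 1) P g"
proof -
  obtain Y \<delta> K where Y: "Y > 0" "\<delta> > 0" "\<And>z. Im z \<ge> Y \<Longrightarrow> norm (F (qpar z)) \<ge> \<delta>"
    "\<And>z. Im z \<ge> Y \<Longrightarrow> norm (F (qpar z)) \<le> K" "\<And>z. Im z \<ge> Y \<Longrightarrow> norm (G (qpar z)) \<le> K"
    using cusp_rep_leading_bounds[OF F V] by metis
  have hf: "f holomorphic_on uhp" by (rule cusp_rep_holomorphic'[OF F(1)])
  have u: "z \<in> uhp" if "Im z \<ge> Y" for z using that Y by (simp add: uhp_def)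
  have fz: "f z = qpar z powi l * F (qpar z)" and Vz: "V z = qpar z powi m * G (qpar z)" if "z \<in> uhp" for z
    using F V that by (auto simp: cusp_rep_def)
  have f0: "f z \<noteq> 0" if "Im z \<ge> Y" for z using Y(2) Y(3)[OF that] fz[OF u[OF that]] by auto
  have K: "K \<ge> 0" using Y(4)[of "\<i> * of_real Y"] norm_ge_zero[of "F (qpar (\<i> * of_real Y))"] by (simp del: norm_ge_zero)
  define h where "h z = g z / f z" for z
  define h' where "h' z = 2 * of_real pi * \<i> * c * V z / (f z)\<^sup>2 - 1" for z
  have dh: "(h has_field_derivative h' z) (at z)" if "Im z \<ge> Y" for z
  proof -
    have "(h has_field_derivative ((2 * of_real pi * \<i> * normalized_deriv g z) * f z - g z * (2 * of_real pi * \<i> * normalized_deriv f z)) / (f z * f z)) (at z)"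
      unfolding h_def[abs_def] by (rule DERIV_divide[OF has_normalized_deriv[OF g u[OF that]] has_normalized_deriv[OF hf u[OF that]] f0[OF that]])
    moreover have "((2 * of_real pi * \<i> * normalized_deriv g z) * f z - g z * (2 * of_real pi * \<i> * normalized_deriv f z)) / (f z * f z) = h' z"
    proof -
      define p where "p = 2 * complex_of_real pi * \<i>"
      have p0: "p \<noteq> 0" by (simp add: p_def)
      have "(p * normalized_deriv g z) * f z - g z * (p * normalized_deriv f z) = p * (f z * normalized_deriv g z - g z * normalized_deriv f z)"
        by (simp add: algebra_simps)
      also have "\<dots> = p * (c * V z - (f z)\<^sup>2 / p)" using W[OF u[OF that]] by (simp only: p_def)
      also have "\<dots> = p * c * V z - (f z)\<^sup>2" using p0 by (simp add: right_diff_distrib)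
      finally show ?thesis using f0[OF that] unfolding h'_def p_def[symmetric]
        by (simp add: diff_divide_distrib power2_eq_square)
    qed
    ultimately show ?thesis by (simp only:)
  qed
  \<comment> \<open>V / f^2 has order at least m - 2 l >= - N at the cusp, so it grows at most like
    |q|^(-N); the summand 1 covers the - 1 in \<open>h'\<close>.\<close>
  define B where "B = 2 * pi * norm c * K / \<delta>\<^sup>2 + 1"
  have B: "B \<ge> 0" using K Y(2) by (simp add: B_def)
  have bound: "norm (h' z) \<le> B * exp (2 * pi * N * Im z)" if z: "Im z \<ge> Y" for z
  proof -
    define x where "x = exp (2 * pi * N * Im z)"
    have x1: "x \<ge> 1" using z Y(1) by (simp add: x_def)
    have "norm (qpar z powi (m - 2 * l)) \<le> x"
    proof -
      have q: "norm (qpar z) = exp (- 2 * pi * Im z)" by (rule norm_qpar)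
      have "norm (qpar z powi (m - 2 * l)) = norm (qpar z) powi (m - 2 * l)" by (rule norm_power_int)
      also have "\<dots> \<le> norm (qpar z) powi (- int N)"
        using N norm_qpar_less_1[OF u[OF z]] by (intro power_int_decreasing) auto
      also have "\<dots> = x" by (simp add: power_int_minus q x_def exp_of_nat_mult[symmetric] exp_minus[symmetric] mult_ac)
      finally show ?thesis .
    qed
    moreover have "V z / (f z)\<^sup>2 = qpar z powi (m - 2 * l) * (G (qpar z) / (F (qpar z))\<^sup>2)"
    proof -
      have "(qpar z powi l)\<^sup>2 = qpar z powi (2 * l)" by (simp add: power_int_mult mult.commute power_int_power)
      then show ?thesis unfolding fz[OF u[OF z]] Vz[OF u[OF z]] by (simp add: power_mult_distrib power_int_diff)
    qed
    moreover have "norm (G (qpar z) / (F (qpar z))\<^sup>2) \<le> K / \<delta>\<^sup>2"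
      using Y z K by (auto simp: norm_divide norm_power intro!: frac_le power_mono)
    ultimately have "norm (V z / (f z)\<^sup>2) \<le> x * (K / \<delta>\<^sup>2)"
      using x1 K by (simp only: norm_mult) (intro mult_mono, auto)
    then have "2 * pi * norm c * norm (V z / (f z)\<^sup>2) \<le> 2 * pi * norm c * (x * (K / \<delta>\<^sup>2))"
      by (intro mult_left_mono) auto
    moreover have "norm (h' z) \<le> norm (2 * of_real pi * \<i> * c * (V z / (f z)\<^sup>2)) + norm (1::complex)"
      unfolding h'_def by (metis norm_triangle_ineq4 times_divide_eq_right)
    moreover have "norm (2 * of_real pi * \<i> * c * (V z / (f z)\<^sup>2)) = 2 * pi * norm c * norm (V z / (f z)\<^sup>2)"
      by (simp only: norm_mult) simp
    ultimately have "norm (h' z) \<le> 2 * pi * norm c * (x * (K / \<delta>\<^sup>2)) + 1" by simp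
    also have "\<dots> \<le> 2 * pi * norm c * (x * (K / \<delta>\<^sup>2)) + x" using x1 by simp
    also have "\<dots> = B * x" by (simp add: B_def algebra_simps)
    finally show ?thesis by (simp only: x_def)
  qed
  \<comment> \<open>The integration starts on a segment of one period at height Y, where h is
    bounded by compactness.\<close>
  have "compact (h ` closed_segment (Complex 0 Y) (Complex 1 Y))"
  proof (rule compact_continuous_image)
    have "continuous_on {z. Im z \<ge> Y} h"
      by (rule DERIV_continuous_on[where D = h']) (use dh in \<open>auto intro: has_field_derivative_at_within\<close>)
    moreover have "closed_segment (Complex 0 Y) (Complex 1 Y) \<subseteq> {z. Im z \<ge> Y}"
      by (intro closed_segment_subset convex_halfspace_Im_ge) auto
    ultimately show "continuous_on (closed_segment (Complex 0 Y) (Complex 1 Y)) h" by (rule continuous_on_subset)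
  qed simp
  then have "bounded (h ` closed_segment (Complex 0 Y) (Complex 1 Y))" by (rule compact_imp_bounded)
  then obtain L where L: "\<And>z. z \<in> closed_segment (Complex 0 Y) (Complex 1 Y) \<Longrightarrow> norm (h z) \<le> L"
    unfolding bounded_iff by blast
  have L0: "L \<ge> 0" using L[of "Complex 0 Y"] norm_ge_zero[of "h (Complex 0 Y)"] by (simp del: norm_ge_zero)
  \<comment> \<open>One power of q beyond N absorbs the linear factor y - Y that integration along a
    vertical segment adds.\<close>
  define \<phi> where "\<phi> z = qpar z ^ (N + 1) * g z" for z
  have per\<phi>: "\<phi> (z + 1) = \<phi> z" if "z \<in> uhp" for z using per[OF that] by (simp add: \<phi>_def qpar_plus_1)
  have bd: "norm (\<phi> z) \<le> (L + B) * K" if z: "Im z \<ge> Y" "0 \<le> Re z" "Re z \<le> 1" for z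
  proof -
    define y where "y = Im z"
    define zY where "zY = Complex (Re z) Y"
    have seg: "zY \<in> closed_segment (Complex 0 Y) (Complex 1 Y)"
      unfolding in_segment using z by (intro exI[of _ "Re z"]) (auto simp: zY_def complex_eq_iff algebra_simps)
    have "norm (h z - h zY) \<le> B * exp (2 * pi * N * y) * norm (z - zY)"
    proof (rule field_differentiable_bound[of "{w. Y \<le> Im w} \<inter> {w. Im w \<le> y}"])
      show "convex ({w. Y \<le> Im w} \<inter> {w. Im w \<le> y})"
        by (intro convex_Int convex_halfspace_Im_ge convex_halfspace_Im_le)
      fix w assume w: "w \<in> {w. Y \<le> Im w} \<inter> {w. Im w \<le> y}"
      then show "(h has_field_derivative h' w) (at w within {w. Y \<le> Im w} \<inter> {w. Im w \<le> y})"
        using dh by (auto intro: has_field_derivative_at_within)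
      have "norm (h' w) \<le> B * exp (2 * pi * N * Im w)" using w by (intro bound) simp
      also have "\<dots> \<le> B * exp (2 * pi * N * y)" using w B by (intro mult_left_mono) (auto intro!: mult_left_mono)
      finally show "norm (h' w) \<le> B * exp (2 * pi * N * y)" .
    qed (use z in \<open>auto simp: y_def zY_def\<close>)
    also have "norm (z - zY) = y - Y" using z by (simp add: zY_def y_def cmod_def)
    finally have "norm (h z - h zY) \<le> B * exp (2 * pi * N * y) * (y - Y)" .
    moreover have "norm (h z) \<le> norm (h zY) + norm (h z - h zY)" by (rule norm_triangle_sub)
    ultimately have hz: "norm (h z) \<le> L + B * exp (2 * pi * N * y) * (y - Y)" using L[OF seg] by linarith
    have q: "norm (qpar z) = exp (- 2 * pi * y)" by (simp add: norm_qpar y_def)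
    define E where "E = exp (2 * pi * y)"
    have E: "E \<ge> 1" "y \<le> E" "E > 0"
    proof -
      have "2 * pi * y \<ge> 1 * y" using z Y(1) pi_ge_3 by (intro mult_right_mono) (auto simp: y_def)
      moreover have "2 * pi * y \<le> E" using exp_ge_add_one_self[of "2 * pi * y"] unfolding E_def by linarith
      ultimately show "y \<le> E" by simp
      show "E \<ge> 1" "E > 0" using z Y(1) by (auto simp: E_def y_def)
    qed
    have EN: "exp (2 * pi * N * y) = E ^ N" by (simp add: E_def exp_of_nat_mult[symmetric] mult_ac)
    have qE: "norm (qpar z) = 1 / E" unfolding q by (simp add: E_def exp_minus field_simps)
    have "norm (f z) \<le> K"
    proof -
      have "norm (f z) = norm (qpar z) powi l * norm (F (qpar z))"
        unfolding fz[OF u[OF z(1)]] by (simp add: norm_mult norm_power_int)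
      also have "norm (qpar z) powi l = norm (qpar z) ^ nat l" using l by (simp add: power_int_def)
      also have "norm (qpar z) ^ nat l * norm (F (qpar z)) \<le> 1 * K"
        using Y(4)[OF z(1)] norm_qpar_less_1[OF u[OF z(1)]] by (intro mult_mono power_le_one) auto
      finally show ?thesis by simp
    qed
    have "norm (\<phi> z) = (1 / E) ^ (N + 1) * norm (h z) * norm (f z)"
      using f0[OF z(1)] by (simp add: \<phi>_def h_def norm_mult norm_power norm_divide qE)
    also have "\<dots> \<le> (1 / E) ^ (N + 1) * (L + B * E ^ N * (y - Y)) * K"
    proof (rule mult_mono[OF _ \<open>norm (f z) \<le> K\<close>])
      show "(1 / E) ^ (N + 1) * norm (h z) \<le> (1 / E) ^ (N + 1) * (L + B * E ^ N * (y - Y))"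
        using hz E unfolding EN by (intro mult_left_mono) auto
      show "0 \<le> (1 / E) ^ (N + 1) * (L + B * E ^ N * (y - Y))"
        using E order_trans[OF norm_ge_zero hz] unfolding EN by (intro mult_nonneg_nonneg) auto
    qed simp
    also have "\<dots> \<le> (L + B) * K"
    proof (rule mult_right_mono[OF _ K])
      have "(1 / E) ^ (N + 1) * (L + B * E ^ N * (y - Y)) = (1 / E) ^ (N + 1) * L + B * ((y - Y) / E)"
        using E(3) by (simp add: field_simps power_divide power_add)
      also have "\<dots> \<le> 1 * L + B * 1"
        using E L0 B Y(1) by (intro add_mono mult_right_mono mult_left_mono power_le_one) auto
      finally show "(1 / E) ^ (N + 1) * (L + B * E ^ N * (y - Y)) \<le> L + B" by simp
    qed
    finally show ?thesis .
  qed
  have "norm (\<phi> z) \<le> (L + B) * K" if z: "Im z \<ge> Y" for z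
  proof -
    \<comment> \<open>Periodicity moves z into the strip covered by \<open>bd\<close>.\<close>
    define z' where "z' = z + of_int (- \<lfloor>Re z\<rfloor>)"
    have "\<phi> z' = \<phi> z" unfolding z'_def using per\<phi> u[OF z] by (rule periodic_plus_int)
    moreover have "norm (\<phi> z') \<le> (L + B) * K"
    proof (rule bd)
      have "Re z' = Re z - of_int \<lfloor>Re z\<rfloor>" by (simp add: z'_def)
      then show "0 \<le> Re z'" "Re z' \<le> 1" by linarith+
    qed (use z in \<open>simp add: z'_def\<close>)
    ultimately show ?thesis by simp
  qed
  moreover have "\<phi> holomorphic_on uhp" unfolding \<phi>_def by (intro holomorphic_intros g)
  ultimately obtain P where P: "cusp_rep 0 P \<phi>" using cusp_rep_of_bounded[of \<phi> Y "(L + B) * K"] per\<phi> by blast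
  have "(\<lambda>z. qpar z powi (- (- int N - 1)) * g z) = \<phi>"
  proof
    fix z
    have "- (- int N - 1) = int (N + 1)" by simp
    then show "qpar z powi (- (- int N - 1)) * g z = \<phi> z" unfolding \<phi>_def by (simp only: power_int_of_nat)
  qed
  then have "cusp_rep (- int N - 1) P g" using P by (subst cusp_rep_times_qpar) simp
  then show ?thesis by blast
qed

text \<open>The Wronskian relation is compared at order l + i when g is expanded from an order i <=
  m - l. The term f^2 has order 2 l > l + i and drops out, leaving (i - l) F(0) P(0) on the left
  and, only for i = m - l, c G(0) on the right. As i < l, the leading coefficient of g vanishes
  below order m - l and does not vanish at it.\<close>

lemma second_solution_order:
  assumes F: "cusp_rep l F f" "F 0 \<noteq> 0" and l: "l \<ge> 0" and V: "cusp_rep m G V" "G 0 \<noteq> 0" and lm: "m < 2 * l"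
    and g: "g holomorphic_on uhp" and per: "\<And>z. z \<in> uhp \<Longrightarrow> g (z + 1) = g z" and c: "c \<noteq> 0"
    and W: "\<And>z. z \<in> uhp \<Longrightarrow> f z * normalized_deriv g z - g z * normalized_deriv f z = c * V z - (f z)\<^sup>2 / (2 * of_real pi * \<i>)"
  shows "\<exists>P. cusp_rep (m - l) P g \<and> P 0 \<noteq> 0"
proof -
  \<comment> \<open>The power of 0 is the indicator of i = m - l.\<close>
  have key: "of_int (i - l) * F 0 * P 0 = c * 0 ^ nat (m - l - i) * G 0" if P: "cusp_rep i P g" and i: "i \<le> m - l" for i P
  proof -
    have "cusp_rep (l + i) (\<lambda>q. F q * (of_int i * P q + q * deriv P q) + (- 1) * (P q * (of_int l * F q + q * deriv F q)))
      (\<lambda>z. f z * normalized_deriv g z + (- 1) * (g z * normalized_deriv f z))"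
      using cusp_rep_mult[OF F(1) cusp_rep_normalized_deriv'[OF P]] cusp_rep_mult[OF P cusp_rep_normalized_deriv'[OF F(1)]]
      by (intro cusp_rep_add cusp_rep_cmult) (simp_all add: add.commute)
    then have 1: "cusp_rep (l + i) (\<lambda>q. F q * (of_int i * P q + q * deriv P q) + (- 1) * (P q * (of_int l * F q + q * deriv F q)))
      (\<lambda>z. c * V z + (- (1 / (2 * of_real pi * \<i>))) * (f z * f z))"
      unfolding cusp_rep_def using W by (simp add: power2_eq_square)
    have "cusp_rep (l + i) (\<lambda>q. q ^ nat (m - (l + i)) * G q) V" by (rule cusp_rep_shift'[OF V(1)]) (use i in simp)
    moreover have "cusp_rep (l + i) (\<lambda>q. q ^ nat (l + l - (l + i)) * (F q * F q)) (\<lambda>z. f z * f z)"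
      by (rule cusp_rep_shift'[OF cusp_rep_mult[OF F(1) F(1)]]) (use i lm in simp)
    ultimately have 2: "cusp_rep (l + i) (\<lambda>q. c * (q ^ nat (m - (l + i)) * G q) + (- (1 / (2 * of_real pi * \<i>))) * (q ^ nat (l + l - (l + i)) * (F q * F q)))
      (\<lambda>z. c * V z + (- (1 / (2 * of_real pi * \<i>))) * (f z * f z))"
      by (intro cusp_rep_add cusp_rep_cmult)
    have "i < l" using i lm by simp
    then show ?thesis using cusp_rep_unique[OF 1 2, of 0] by (simp add: algebra_simps power_0_left)
  qed
  define N where "N = nat (2 * l - m)"
  have "2 * l \<le> m + int N" by (simp add: N_def)
  from meromorphic_at_cusp[OF F l V(1) this g per W] obtain P0 where P0: "cusp_rep (- int N - 1) P0 g" by blast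
  \<comment> \<open>The expansion supplied by \<open>meromorphic_at_cusp\<close> starts too low;
    since each leading coefficient below order m - l is 0, the starting order is raised one by
    one.\<close>
  have ex: "i \<le> m - l \<longrightarrow> (\<exists>P. cusp_rep i P g)" if "- int N - 1 \<le> i" for i
    using that
  proof (induction rule: int_ge_induct)
    case base
    then show ?case using P0 by blast
  next
    case (step i)
    show ?case
    proof
      assume i: "i + 1 \<le> m - l"
      then obtain P where P: "cusp_rep i P g" using step by auto
      have "nat (m - l - i) \<noteq> 0" using i by simp
      then have "of_int (i - l) * F 0 * P 0 = 0" using key[OF P] i by simp
      moreover have "i - l \<noteq> 0" using i lm by simp
      ultimately have "P 0 = 0" using F(2) by (simp only: mult_eq_0_iff of_int_eq_0_iff simp_thms)
      then show "\<exists>P. cusp_rep (i + 1) P g" using cusp_rep_factor'[OF P] by metis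
    qed
  qed
  have "- int N - 1 \<le> m - l" using lm l by (simp add: N_def)
  then obtain P where P: "cusp_rep (m - l) P g" using ex by blast
  then have "of_int (m - l - l) * F 0 * P 0 = c * G 0" using key[OF P] by simp
  then have "P 0 \<noteq> 0" using c V(2) by auto
  then show ?thesis using P by blast
qed

section \<open>Balanced solutions and fundamental systems\<close>

lemma holomorphic_solution_cong:
  assumes "\<And>z. z \<in> uhp \<Longrightarrow> L f z = L' f z"
  shows "holomorphic_solution L f \<longleftrightarrow> holomorphic_solution L' f"
  using assms by (simp add: holomorphic_solution_def)

context modular_ode
begin

lemma balanced_quasimodular_of_solution:
  assumes f: "solution f" and q: "q_expansion l c f" and c: "c 0 \<noteq> 0" and V: "cusp_rep m G V" "G 0 \<noteq> 0"
    and l: "0 \<le> l" "l \<le> m" "m < 2 * l" and w: "w = k + 1"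
    and dimQ: "int (fun_space.dim (quasimodular_forms w 1)) = m + 1"
    and dimM: "m - l < int (fun_space.dim (modular_forms (w - 2)))"
  shows "balanced_quasimodular w f"
proof -
  define F where "F q = (\<Sum>n. c n * q ^ n)" for q
  have F: "cusp_rep l F f" unfolding F_def by (rule q_expansion_imp_cusp_rep[OF q])
  have F0: "F 0 \<noteq> 0" using c powser_zero[of c] by (simp add: F_def)
  have per: "f (z + 1) = f z" if "z \<in> uhp" for z by (rule cusp_rep_periodic[OF F that])
  have nz: "\<exists>z\<in>uhp. f z \<noteq> 0" by (rule cusp_rep_not_zero[OF F F0])
  have hf: "f holomorphic_on uhp" using f by (simp add: holomorphic_solution_def)
  define s where "s = slash k f"
  have s: "solution s" unfolding s_def by (rule solution_slash[OF f])
  have hs: "s holomorphic_on uhp" using s by (simp add: holomorphic_solution_def)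
  have s1: "s (z + 1) = f z + s z" if "z \<in> uhp" for z unfolding s_def by (rule slash_plus_1[OF f per nz that])
  define g where "g z = s z + (- 1) * (z * f z)" for z
  have hzf: "(\<lambda>z. z * f z) holomorphic_on uhp" and hzf': "(\<lambda>z. (- 1) * (z * f z)) holomorphic_on uhp"
    by (intro holomorphic_intros hf)+
  have hg: "g holomorphic_on uhp" unfolding g_def by (intro holomorphic_intros hf hs)
  have gper: "g (z + 1) = g z" if "z \<in> uhp" for z by (simp only: g_def s1[OF that] per[OF that]) (simp add: algebra_simps)
  obtain C where C: "\<And>z. z \<in> uhp \<Longrightarrow> Wronskian f s z = C * V z" using Wronskian_solutions[OF f s] by blast
  have C0: "C \<noteq> 0" using Wronskian_slash_nonzero[OF f per nz] C by (auto simp: s_def)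
  \<comment> \<open>The derivative of z is 1 / (2 pi i) in this normalisation, which is the source
    of the term in f^2.\<close>
  have W: "f z * normalized_deriv g z - g z * normalized_deriv f z = C * V z - (f z)\<^sup>2 / (2 * of_real pi * \<i>)" if z: "z \<in> uhp" for z
  proof -
    define p where "p = 2 * complex_of_real pi * \<i>"
    have "normalized_deriv (\<lambda>z. z) z = 1 / p" by (rule normalized_deriv_eqI) (simp add: p_def)
    then have Dg: "normalized_deriv g z = normalized_deriv s z + (- 1) * (f z / p + z * normalized_deriv f z)"
      unfolding g_def normalized_deriv_add[OF hs hzf' z] normalized_deriv_cmult[OF hzf z]
        normalized_deriv_mult[OF holomorphic_on_ident hf z] by simp
    have "f z * normalized_deriv g z - g z * normalized_deriv f z = Wronskian f s z - (f z)\<^sup>2 / p"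
      unfolding Dg by (simp add: g_def Wronskian_def algebra_simps power2_eq_square)
    then show ?thesis by (simp only: C[OF z] p_def)
  qed
  have "\<exists>P. cusp_rep (m - l) P g \<and> P 0 \<noteq> 0"
    by (rule second_solution_order[OF F F0 l(1) V l(3) hg gper C0 W])
  then obtain P where P: "cusp_rep (m - l) P g" "P 0 \<noteq> 0" by blast
  have P': "cusp_rep 0 (\<lambda>q. q ^ nat (m - l) * P q) g" using cusp_rep_shift'[OF P(1), of 0] l by simp
  have F': "cusp_rep 0 (\<lambda>q. q ^ nat l * F q) f" using cusp_rep_shift'[OF F, of 0] l by simp
  have gS: "g (- 1 / z) = z powi (k - 1) * g z" if z: "z \<in> uhp" for z
  proof -
    have z0: "z \<noteq> 0" using z uhp_nonzero by auto
    have "g (- 1 / z) = - (z powi k * f z) + (- 1) * ((- 1 / z) * (z powi k * s z))"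
      unfolding g_def s_def slash_transform(2)[OF z] slash_transform(1)[OF z, of f] ..
    also have "z powi k = z powi (k - 1) * z" using z0 by (simp add: power_int_diff)
    finally show ?thesis using z0 by (simp add: g_def algebra_simps)
  qed
  \<comment> \<open>The coefficient of the defect of \<open>E2\<close>; dividing g by it lets E2 h1
    carry the whole non-modular part of f.\<close>
  define d where "d = 6 / (complex_of_real pi * \<i>)"
  have d0: "d \<noteq> 0" by (simp add: d_def)
  define h1 where "h1 z = (1 / d) * g z" for z
  define h0 where "h0 z = f z + (- 1) * (E2 z * h1 z)" for z
  have even: "even w" "even (w - 2)" using k by (simp_all add: w)
  have R1: "cusp_rep 0 (\<lambda>q. (1 / d) * (q ^ nat (m - l) * P q)) h1"
    unfolding h1_def by (rule cusp_rep_cmult[OF P'])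
  have R0: "cusp_rep 0 (\<lambda>q. q ^ nat l * F q + (- 1) * (E2q q * ((1 / d) * (q ^ nat (m - l) * P q)))) h0"
    unfolding h0_def using cusp_rep_mult[OF cusp_rep_E2 R1] by (intro cusp_rep_add cusp_rep_cmult F') simp
  have S1: "h1 (- 1 / z) = z powi (w - 2) * h1 z" if z: "z \<in> uhp" for z
    unfolding h1_def gS[OF z] by (simp add: w)
  have S0: "h0 (- 1 / z) = z powi w * h0 z" if z: "z \<in> uhp" for z
  proof -
    have z0: "z \<noteq> 0" using z uhp_nonzero by auto
    have f': "f (- 1 / z) = z powi k * (z * f z + d * h1 z)"
      unfolding slash_transform(1)[OF z, of f] using d0 by (simp add: h1_def g_def s_def)
    have E: "E2 (- 1 / z) = z\<^sup>2 * E2 z + d * z" using E2_transform[OF z] by (simp add: d_def)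
    have h1': "h1 (- 1 / z) = z powi (k - 1) * h1 z" using S1[OF z] by (simp add: w)
    have p: "z powi k = z powi (k - 1) * z" "z powi w = z powi (k - 1) * z\<^sup>2" using z0 by (simp_all add: w power_int_diff power_int_add power2_eq_square)
    show ?thesis unfolding h0_def f' E h1' p by (simp add: algebra_simps power2_eq_square)
  qed
  have M1: "restrict_uhp h1 \<in> modular_forms (w - 2)"
    by (rule modular_formsI[OF even(2) cusp_rep_periodic[OF R1] S1 R1])
  have M0: "restrict_uhp h0 \<in> modular_forms w"
    by (rule modular_formsI[OF even(1) cusp_rep_periodic[OF R0] S0 R0])
  have nz1: "\<exists>z\<in>uhp. restrict_uhp h1 z \<noteq> 0"
    using cusp_rep_not_zero[OF P] d0 by (auto simp: h1_def restrict_uhp_eq)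
  have fh: "\<forall>z\<in>uhp. f z = restrict_uhp h0 z + E2 z * restrict_uhp h1 z"
    by (simp add: restrict_uhp_eq h0_def)
  have v0: "vanishing_order_at_cusp f l" unfolding vanishing_order_iff using F F0 by blast
  have "cusp_rep (m - l) P (\<lambda>z. 6 / (of_real pi * \<i>) * restrict_uhp h1 z)"
    using P(1) d0 unfolding cusp_rep_def d_def[symmetric] by (simp add: restrict_uhp_eq h1_def)
  then have v1: "vanishing_order_at_cusp (\<lambda>z. 6 / (of_real pi * \<i>) * restrict_uhp h1 z) (m - l)"
    unfolding vanishing_order_iff using P(2) by blast
  have num: "l \<ge> m - l \<and> m - l \<ge> 0 \<and> l < int (fun_space.dim (quasimodular_forms w 1))
      \<and> m - l < int (fun_space.dim (modular_forms (w - 2))) \<and> l + (m - l) = int (fun_space.dim (quasimodular_forms w 1)) - 1"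
    using l dimM unfolding dimQ by auto
  show ?thesis unfolding balanced_quasimodular_def
    by (intro bexI[OF _ M0] bexI[OF _ M1] exI[of _ l] exI[of _ "m - l"] conjI nz1 fh v0 v1) (use num in blast)+
qed

text \<open>Independence and spanning both come from the nonzero Wronskian of u with its image. L is
  any operator agreeing with \<open>operator\<close> on the half plane, which fits the three
  equations as they are stated.\<close>

lemma fundamental_system_slash:
  assumes u: "solution u" and per: "\<And>z. z \<in> uhp \<Longrightarrow> u (z + 1) = u z" and nz: "\<exists>z\<in>uhp. u z \<noteq> 0"
    and v: "\<And>z. z \<in> uhp \<Longrightarrow> v z = slash k u z" and L: "\<And>f z. z \<in> uhp \<Longrightarrow> L f z = operator f z"
  shows "fundamental_system L u v"
proof -
  have sol: "holomorphic_solution L f \<longleftrightarrow> solution f" for f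
    by (rule holomorphic_solution_cong) (rule L)
  have hu: "u holomorphic_on uhp" using u by (simp add: holomorphic_solution_def)
  have vs: "solution (slash k u)" by (rule solution_slash[OF u])
  have W: "\<exists>z\<in>uhp. Wronskian u (slash k u) z \<noteq> 0" by (rule Wronskian_slash_nonzero[OF u per nz])
  define a where "a = restrict_uhp u"
  define b where "b = restrict_uhp v"
  have a: "a z = u z" and b: "b z = slash k u z" if "z \<in> uhp" for z
    using that v by (simp_all add: a_def b_def restrict_uhp_eq)
  have out: "a z = 0" "b z = 0" if "z \<notin> uhp" for z using that by (simp_all add: a_def b_def restrict_uhp_def)
  have not_prop: False if "b = scale_fun \<mu> a" for \<mu>
  proof -
    have eq: "slash k u z = \<mu> * u z" if "z \<in> uhp" for z
      using fun_cong[OF \<open>b = scale_fun \<mu> a\<close>, of z] that by (simp add: a b scale_fun_def)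
    have "Wronskian u (slash k u) z = 0" if z: "z \<in> uhp" for z
    proof -
      have "normalized_deriv (slash k u) z = normalized_deriv (\<lambda>z. \<mu> * u z) z"
        by (rule normalized_deriv_cong[OF eq slash_holomorphic[OF hu] z])
      then show ?thesis by (simp add: Wronskian_def eq[OF z] normalized_deriv_cmult[OF hu z])
    qed
    then show False using W by blast
  qed
  have a0: "a \<noteq> 0" using nz a by (metis zero_fun_apply)
  have span: "x \<in> fun_space.span {b, a} \<longleftrightarrow> (\<exists>\<beta> \<alpha>. x = scale_fun \<alpha> a + scale_fun \<beta> b)" for x
    by (auto simp: fun_space.span_breakdown_eq algebra_simps)
  have "b \<notin> fun_space.span {a}"
  proof
    assume "b \<in> fun_space.span {a}"
    then obtain \<mu> where "b - scale_fun \<mu> a = 0" by (auto simp: fun_space.span_breakdown_eq)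
    then have "b = scale_fun \<mu> a" by (simp only: right_minus_eq)
    then show False by (rule not_prop)
  qed
  moreover have "fun_space.independent {a}" using a0 by (simp add: fun_space.independent_insert)
  ultimately have ind: "fun_space.independent {b, a}" by (rule fun_space.independent_insertI)
  have sp: "fun_space.span {b, a} = solution_space L"
  proof (intro equalityI subsetI)
    fix x assume "x \<in> fun_space.span {b, a}"
    then have "\<exists>\<beta> \<alpha>. x = scale_fun \<alpha> a + scale_fun \<beta> b" unfolding span .
    then obtain \<alpha> \<beta> where x: "x = scale_fun \<alpha> a + scale_fun \<beta> b" by blast
    have xz: "x z = \<alpha> * a z + \<beta> * b z" for z by (simp add: x scale_fun_def)
    have "\<alpha> * u z + \<beta> * slash k u z = x z" if "z \<in> uhp" for z
      by (simp only: xz a[OF that] b[OF that])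
    then have "solution x" using solution_lincomb[OF u vs, of \<alpha> \<beta>] by (rule solution_cong)
    moreover have "x z = 0" if "z \<notin> uhp" for z by (simp only: xz out[OF that] mult_zero_right add_0_right)
    ultimately show "x \<in> solution_space L" unfolding solution_space_def mem_Collect_eq sol by blast
  next
    fix x assume x: "x \<in> solution_space L"
    then have "solution x" and xo: "\<And>z. z \<notin> uhp \<Longrightarrow> x z = 0"
      unfolding solution_space_def mem_Collect_eq sol by blast+
    obtain \<alpha> \<beta> where xz: "\<And>z. z \<in> uhp \<Longrightarrow> x z = \<alpha> * u z + \<beta> * slash k u z"
      using solution_in_span[OF u vs \<open>solution x\<close> W] by blast
    have "x z = (scale_fun \<alpha> a + scale_fun \<beta> b) z" for z
    proof (cases "z \<in> uhp")
      case True
      then show ?thesis by (simp only: plus_fun_apply scale_fun_def xz a b)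
    next
      case False
      then show ?thesis by (simp only: plus_fun_apply scale_fun_def xo[OF False] out[OF False] mult_zero_right add_0_right)
    qed
    then have "x = scale_fun \<alpha> a + scale_fun \<beta> b" by (rule ext)
    then show "x \<in> fun_space.span {b, a}" unfolding span by (intro exI)
  qed
  have ne: "a \<noteq> b" using not_prop[of 1] by (auto simp: scale_fun_def)
  have e: "{a, b} = {b, a}" by (rule insert_commute)
  show ?thesis unfolding fundamental_system_def a_def[symmetric] b_def[symmetric] e
    by (intro conjI ne ind sp)
qed

end

section \<open>The three equations as instances of the general one\<close>

lemma serre_deriv_Delta_power:
  assumes z: "z \<in> uhp" shows "serre_deriv (12 * int n) (\<lambda>z. \<Delta> z ^ n) z = 0"
proof -
  have "normalized_deriv (\<lambda>z. \<Delta> z ^ n) z = of_nat n * E2 z * \<Delta> z ^ n"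
    unfolding normalized_deriv_power[OF Delta_holomorphic z] Ramanujan_Delta[OF z] by (cases n) simp_all
  then show ?thesis by (simp add: serre_deriv_def)
qed

lemma Delta_power_holomorphic: "(\<lambda>z. \<Delta> z ^ n) holomorphic_on uhp"
  by (intro holomorphic_intros Delta_holomorphic)

text \<open>The Serre derivative of weight 12 kills \<Delta>, so powers of \<Delta> behave like
  constants that shift the weight.\<close>

lemma serre_deriv_times_Delta_power:
  assumes h: "h holomorphic_on uhp" and z: "z \<in> uhp"
  shows "serre_deriv (j + 12 * int n) (\<lambda>z. h z * \<Delta> z ^ n) z = serre_deriv j h z * \<Delta> z ^ n"
  unfolding serre_deriv_mult[OF h Delta_power_holomorphic z] serre_deriv_Delta_power[OF z] by simp

lemma serre_deriv_E4: "z \<in> uhp \<Longrightarrow> serre_deriv 4 E4 z = - E6 z / 3"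
  by (simp add: serre_deriv_def Ramanujan_E4 field_simps)

lemma cusp_rep_Delta_power: "\<exists>G. cusp_rep (int n) G (\<lambda>z. \<Delta> z ^ n) \<and> G 0 = 1"
proof -
  obtain G where G: "cusp_rep 1 G \<Delta>" "G 0 = 1" using Delta_cusp_rep by blast
  then have "cusp_rep (int n) (\<lambda>q. G q ^ n) (\<lambda>z. \<Delta> z ^ n)"
    by (auto simp: cusp_rep_def power_mult_distrib intro!: holomorphic_intros)
  with G(2) show ?thesis by (intro exI[of _ "\<lambda>q. G q ^ n"]) simp
qed

lemma cusp_rep_E4_power_Delta_power: "\<exists>G. cusp_rep (int n) G (\<lambda>z. E4 z ^ i * \<Delta> z ^ n) \<and> G 0 \<noteq> 0"
proof -
  obtain G where G: "cusp_rep (int n) G (\<lambda>z. \<Delta> z ^ n)" "G 0 = 1" using cusp_rep_Delta_power by blast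
  have "cusp_rep (int n) (\<lambda>q. E4q q ^ i * G q) (\<lambda>z. E4 z ^ i * \<Delta> z ^ n)"
    using cusp_rep_mult[OF cusp_rep_power[OF cusp_rep_E4, of i] G(1)] by simp
  then show ?thesis using G(2) by (intro exI[of _ "\<lambda>q. E4q q ^ i * G q"]) simp
qed

lemma E4_power_Delta_power_nonzero: "\<exists>z\<in>uhp. E4 z ^ i * \<Delta> z ^ n \<noteq> 0"
  using E4_not_zero Delta_nonzero by auto

lemma E_periodic: "z \<in> uhp \<Longrightarrow> E2 (z + 1) = E2 z" "z \<in> uhp \<Longrightarrow> E4 (z + 1) = E4 z" "z \<in> uhp \<Longrightarrow> E6 (z + 1) = E6 z"
  by (rule cusp_rep_periodic[OF cusp_rep_E2] cusp_rep_periodic[OF cusp_rep_E4] cusp_rep_periodic[OF cusp_rep_E6]; assumption)+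

lemma Delta_periodic: "z \<in> uhp \<Longrightarrow> \<Delta> (z + 1) = \<Delta> z"
  by (simp only: modular_discriminant_def E_periodic)

text \<open>Here k = w - 1 = 6 m - 1 and Wronskians have weight 12 m, that of \<Delta>^m; the
  trivial factor E4^0 keeps the three cases uniform.\<close>

lemma modular_ode_a0: "modular_ode (6 * int m - 1) 0 (\<lambda>_. 1) (\<lambda>_. 0) (\<lambda>z. c * E4 z) (\<lambda>z. E4 z ^ 0 * \<Delta> z ^ m)"
proof
  show "\<exists>z\<in>uhp. E4 z ^ 0 * \<Delta> z ^ m \<noteq> 0" by (rule E4_power_Delta_power_nonzero)
  show "\<exists>z\<in>uhp. 1 \<noteq> (0::complex)" by (intro bexI[of _ \<i>]) (auto simp: uhp_def)
  fix z assume z: "z \<in> uhp"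
  show "c * E4 (- 1 / z) = z powi (0 + 4) * (c * E4 z)" unfolding E4_transform[OF z] by simp
  have e: "2 * (6 * int m - 1) + 2 = 12 * int m" by simp
  show "1 * serre_deriv (2 * (6 * int m - 1) + 2) (\<lambda>z. E4 z ^ 0 * \<Delta> z ^ m) z + 0 * (E4 z ^ 0 * \<Delta> z ^ m) = 0"
    unfolding e using serre_deriv_Delta_power[OF z] by simp
qed (auto simp: E_periodic Delta_periodic intro!: holomorphic_intros Delta_holomorphic)

text \<open>Wronskians have weight 12 m + 4, which leaves room for one factor E4; its Serre
  derivative - E6 / 3 cancels the coefficient E6 / 3.\<close>

lemma modular_ode_a2: "modular_ode (6 * int m + 1) 4 E4 (\<lambda>z. 1 / 3 * E6 z) (\<lambda>z. c * E4 z ^ 2) (\<lambda>z. E4 z ^ 1 * \<Delta> z ^ m)"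
proof
  show "\<exists>z\<in>uhp. E4 z ^ 1 * \<Delta> z ^ m \<noteq> 0" by (rule E4_power_Delta_power_nonzero)
  show "\<exists>z\<in>uhp. E4 z \<noteq> 0" by (rule E4_not_zero)
  fix z assume z: "z \<in> uhp"
  show "E4 (- 1 / z) = z powi 4 * E4 z" unfolding E4_transform[OF z] by simp
  show "1 / 3 * E6 (- 1 / z) = z powi (4 + 2) * (1 / 3 * E6 z)" unfolding E6_transform[OF z] by simp
  show "c * E4 (- 1 / z) ^ 2 = z powi (4 + 4) * (c * E4 z ^ 2)" unfolding E4_transform[OF z]
    by (simp add: power_mult_distrib flip: power_mult)
  have e: "2 * (6 * int m + 1) + 2 = 4 + 12 * int m" by simp
  show "E4 z * serre_deriv (2 * (6 * int m + 1) + 2) (\<lambda>z. E4 z ^ 1 * \<Delta> z ^ m) z + 1 / 3 * E6 z * (E4 z ^ 1 * \<Delta> z ^ m) = 0"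
    unfolding e power_one_right serre_deriv_times_Delta_power[OF E_holomorphic(2) z] serre_deriv_E4[OF z] by simp
qed (auto simp: E_periodic Delta_periodic intro!: holomorphic_intros Delta_holomorphic E_holomorphic)

text \<open>Wronskians have weight 12 m + 8; squaring E4 doubles its logarithmic Serre derivative,
  in accordance with the coefficient 2/3.\<close>

lemma modular_ode_a4: "modular_ode (6 * int m + 3) 8 (\<lambda>z. E4 z ^ 2) (\<lambda>z. 2 / 3 * E4 z * E6 z) (\<lambda>z. c * E4 z ^ 3 + d * \<Delta> z) (\<lambda>z. E4 z ^ 2 * \<Delta> z ^ m)"
proof
  show "\<exists>z\<in>uhp. E4 z ^ 2 * \<Delta> z ^ m \<noteq> 0" by (rule E4_power_Delta_power_nonzero)
  show "\<exists>z\<in>uhp. E4 z ^ 2 \<noteq> 0" using E4_not_zero by simp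
  fix z assume z: "z \<in> uhp"
  show "E4 (- 1 / z) ^ 2 = z powi 8 * E4 z ^ 2" unfolding E4_transform[OF z]
    by (simp add: power_mult_distrib flip: power_mult)
  show "2 / 3 * E4 (- 1 / z) * E6 (- 1 / z) = z powi (8 + 2) * (2 / 3 * E4 z * E6 z)"
    unfolding E4_transform[OF z] E6_transform[OF z] by (simp flip: power_add)
  show "c * E4 (- 1 / z) ^ 3 + d * \<Delta> (- 1 / z) = z powi (8 + 4) * (c * E4 z ^ 3 + d * \<Delta> z)"
    unfolding E4_transform[OF z] Delta_transform[OF z] by (simp add: power_mult_distrib distrib_left flip: power_mult)
  have e: "2 * (6 * int m + 3) + 2 = 8 + 12 * int m" by simp
  have E44: "serre_deriv 8 (\<lambda>z. E4 z ^ 2) z = 2 * E4 z * (- E6 z / 3)"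
    using serre_deriv_mult[OF E_holomorphic(2) E_holomorphic(2) z, of 4 4] serre_deriv_E4[OF z] by (simp add: power2_eq_square)
  have h: "(\<lambda>z. E4 z ^ 2) holomorphic_on uhp" by (intro holomorphic_intros E_holomorphic)
  show "E4 z ^ 2 * serre_deriv (2 * (6 * int m + 3) + 2) (\<lambda>z. E4 z ^ 2 * \<Delta> z ^ m) z + 2 / 3 * E4 z * E6 z * (E4 z ^ 2 * \<Delta> z ^ m) = 0"
    unfolding e serre_deriv_times_Delta_power[OF h z] E44 by (simp add: field_simps)
qed (auto simp: E_periodic Delta_periodic intro!: holomorphic_intros Delta_holomorphic E_holomorphic)

text \<open>Powers of \<Delta> factor out of the equation, so for l = m / 2 only the seeds 1, E2 and
  E4 in the weights -1, 1 and 3 have to be checked.\<close>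

lemma (in modular_ode) solution_times_Delta_power:
  assumes h: "h holomorphic_on uhp" and j: "k = j + 12 * int n"
    and eq: "\<And>z. z \<in> uhp \<Longrightarrow> A z * serre_deriv (j + 2) (serre_deriv j h) z + B z * serre_deriv j h z + C z * h z = 0"
  shows "solution (\<lambda>z. h z * \<Delta> z ^ n)"
proof -
  have hol: "(\<lambda>z. h z * \<Delta> z ^ n) holomorphic_on uhp" by (intro holomorphic_intros h Delta_holomorphic)
  have s1: "serre_deriv k (\<lambda>z. h z * \<Delta> z ^ n) z = serre_deriv j h z * \<Delta> z ^ n" if "z \<in> uhp" for z
    unfolding j by (rule serre_deriv_times_Delta_power[OF h that])
  have s2: "serre_deriv (k + 2) (serre_deriv k (\<lambda>z. h z * \<Delta> z ^ n)) z = serre_deriv (j + 2) (serre_deriv j h) z * \<Delta> z ^ n"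
    if z: "z \<in> uhp" for z
  proof -
    have "serre_deriv (k + 2) (serre_deriv k (\<lambda>z. h z * \<Delta> z ^ n)) z = serre_deriv (k + 2) (\<lambda>z. serre_deriv j h z * \<Delta> z ^ n) z"
      by (rule serre_deriv_cong[OF s1 serre_deriv_holomorphic[OF hol] z])
    also have "\<dots> = serre_deriv (j + 2) (serre_deriv j h) z * \<Delta> z ^ n"
    proof -
      have e: "k + 2 = j + 2 + 12 * int n" by (simp add: j)
      show ?thesis unfolding e by (rule serre_deriv_times_Delta_power[OF serre_deriv_holomorphic[OF h] z])
    qed
    finally show ?thesis .
  qed
  have "operator (\<lambda>z. h z * \<Delta> z ^ n) z = 0" if z: "z \<in> uhp" for z
  proof -
    have "operator (\<lambda>z. h z * \<Delta> z ^ n) z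
      = (A z * serre_deriv (j + 2) (serre_deriv j h) z + B z * serre_deriv j h z + C z * h z) * \<Delta> z ^ n"
      unfolding operator_def s1[OF z] s2[OF z] by (simp add: algebra_simps)
    then show ?thesis by (simp only: eq[OF z] mult_zero_left)
  qed
  then show ?thesis using hol by (simp add: holomorphic_solution_def)
qed

section \<open>Second Serre derivatives of the seeds 1, E2 and E4\<close>

lemma serre_deriv_2_const:
  assumes z: "z \<in> uhp" shows "serre_deriv 1 (serre_deriv (- 1) (\<lambda>_. 1)) z = - E4 z / 144"
proof -
  have 1: "serre_deriv (- 1) (\<lambda>_. 1) = (\<lambda>z. (1 / 12) * E2 z)"
    by (rule ext) (simp add: serre_deriv_def normalized_deriv_def)
  show ?thesis unfolding 1 serre_deriv_cmult[OF E_holomorphic(1) z]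
    by (simp add: serre_deriv_def Ramanujan_E2[OF z] field_simps power2_eq_square)
qed

lemma serre_deriv_E2:
  assumes z: "z \<in> uhp" shows "serre_deriv 1 E2 z = (- 1 / 12) * E4 z"
  by (simp add: serre_deriv_def Ramanujan_E2[OF z] field_simps power2_eq_square)

lemma serre_deriv_2_E2:
  assumes z: "z \<in> uhp" shows "serre_deriv 3 (serre_deriv 1 E2) z = E6 z / 36 - E2 z * E4 z / 144"
proof -
  have "serre_deriv 3 (serre_deriv 1 E2) z = serre_deriv 3 (\<lambda>z. (- 1 / 12) * E4 z) z"
    by (rule serre_deriv_cong[OF serre_deriv_E2 serre_deriv_holomorphic[OF E_holomorphic(1)] z])
  also have "\<dots> = E6 z / 36 - E2 z * E4 z / 144"
    unfolding serre_deriv_cmult[OF E_holomorphic(2) z] by (simp add: serre_deriv_def Ramanujan_E4[OF z] field_simps)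
  finally show ?thesis .
qed

lemma serre_deriv_3_E4:
  assumes z: "z \<in> uhp" shows "serre_deriv 3 E4 z = (1 / 12) * (E2 z * E4 z) + (- 1 / 3) * E6 z"
  by (simp add: serre_deriv_def Ramanujan_E4[OF z] field_simps)

lemma serre_deriv_2_E4:
  assumes z: "z \<in> uhp" shows "serre_deriv 5 (serre_deriv 3 E4) z = 23 / 144 * E4 z ^ 2 - E2 z * E6 z / 18"
proof -
  have h: "(\<lambda>z. E2 z * E4 z) holomorphic_on uhp" "(\<lambda>z. (1 / 12) * (E2 z * E4 z)) holomorphic_on uhp"
    "(\<lambda>z. (- 1 / 3) * E6 z) holomorphic_on uhp"
    by (intro holomorphic_intros E_holomorphic)+
  have "serre_deriv 5 (serre_deriv 3 E4) z = serre_deriv 5 (\<lambda>z. (1 / 12) * (E2 z * E4 z) + (- 1 / 3) * E6 z) z"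
    by (rule serre_deriv_cong[OF serre_deriv_3_E4 serre_deriv_holomorphic[OF E_holomorphic(2)] z])
  \<comment> \<open>Weight 5 is split as 1 + 4, the weights in which E2 and E4 have simple Serre
    derivatives.\<close>
  also have "\<dots> = (1 / 12) * (serre_deriv 1 E2 z * E4 z + E2 z * serre_deriv 4 E4 z) + (- 1 / 3) * serre_deriv 5 E6 z"
    unfolding serre_deriv_add[OF h(2,3) z] serre_deriv_cmult[OF h(1) z] serre_deriv_cmult[OF E_holomorphic(3) z]
    using serre_deriv_mult[OF E_holomorphic(1,2) z, of 1 4] by simp
  also have "\<dots> = 23 / 144 * E4 z ^ 2 - E2 z * E6 z / 18"
    unfolding serre_deriv_E2[OF z] serre_deriv_E4[OF z]
    by (simp add: serre_deriv_def Ramanujan_E6[OF z] field_simps power2_eq_square)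
  finally show ?thesis .
qed

lemma iterated_serre_deriv_2: "iterated_serre_deriv k 2 f = serre_deriv (k + 2) (serre_deriv k f)"
  by (simp add: numeral_2_eq_2)

lemma slash_times_Delta_power:
  assumes z: "z \<in> uhp" 
  shows "slash (j + 12 * int n) (\<lambda>z. h z * \<Delta> z ^ n) z = slash j h z * \<Delta> z ^ n"
proof -
  have z0: "z \<noteq> 0" using z uhp_nonzero by auto
  have e: "(z ^ 12) ^ n = z powi int (12 * n)" unfolding power_int_of_nat by (simp only: power_mult)
  have "z powi (- (j + 12 * int n)) * (z ^ 12) ^ n = z powi (- (j + 12 * int n) + int (12 * n))"
    unfolding e by (rule power_int_add[symmetric]) (use z0 in simp)
  then have p: "z powi (- (j + 12 * int n)) * (z ^ 12) ^ n = z powi (- j)" by simp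
  have "slash (j + 12 * int n) (\<lambda>z. h z * \<Delta> z ^ n) z = (z powi (- (j + 12 * int n)) * (z ^ 12) ^ n) * (h (- 1 / z) * \<Delta> z ^ n)"
    unfolding slash_def Delta_transform[OF z] by (simp only: power_mult_distrib mult_ac)
  then show ?thesis unfolding p slash_def by (simp only: mult.assoc)
qed

text \<open>For each residue r one of the weights w and w - 2 has the form 6 m + 4 r' and the other
  6 (m - 1) + 4 r''. The dimensions add up to m + 1 because the halves of m and m - 1, rounded down,
  add up to m - 1.\<close>

lemma dim_forms:
  fixes m :: nat
  assumes "m \<ge> 1" "r \<in> {0, 1, 2}"
  shows "int (fun_space.dim (quasimodular_forms (6 * int m + 2 * int r) 1)) = int m + 1"
    "fun_space.dim (modular_forms (6 * int m + 2 * int r - 2)) \<ge> (m - 1) div 2 + 1"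
proof -
  obtain n where n: "m = Suc n" using assms(1) by (cases m) auto
  have D: "has_dim (modular_forms (6 * int m + 4 * int r)) (m div 2 + 1)" if "r \<in> {0, 1, 2}" for m r
    using has_dim_modular_forms[OF that, of m] by simp
  have half: "(m div 2 + 1) + (n div 2 + 1) = m + 1" "m div 2 + 1 \<ge> n div 2 + 1" unfolding n by presburger+
  have w: "6 * int m + 2 * int r = 6 * int m' + 4 * int r'" if "3 * m + r = 3 * m' + 2 * r'" for m' r'
    using that by linarith
  have w': "6 * int m + 2 * int r - 2 = 6 * int m' + 4 * int r'" if "3 * m + r = 3 * m' + 2 * r' + 1" for m' r'
    using that by linarith
  have "r = 0 \<or> r = 1 \<or> r = 2" using assms(2) by auto
  then have "\<exists>a b. has_dim (modular_forms (6 * int m + 2 * int r)) a \<and> has_dim (modular_forms (6 * int m + 2 * int r - 2)) b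
      \<and> a + b = m + 1 \<and> b \<ge> n div 2 + 1"
  proof (elim disjE)
    assume r: "r = 0"
    have "6 * int m + 2 * int r = 6 * int m + 4 * int 0" "6 * int m + 2 * int r - 2 = 6 * int n + 4 * int 1"
      by (rule w w'; simp add: r n)+
    then show ?thesis using D[of 0 m] D[of 1 n] half by (metis insertI1 insertI2 order_refl)
  next
    assume r: "r = 1"
    have "6 * int m + 2 * int r = 6 * int n + 4 * int 2" "6 * int m + 2 * int r - 2 = 6 * int m + 4 * int 0"
      by (rule w w'; simp add: r n)+
    then show ?thesis using D[of 2 n] D[of 0 m] half by (metis insertI1 insertI2 add.commute)
  next
    assume r: "r = 2"
    have "6 * int m + 2 * int r = 6 * int m + 4 * int 1" "6 * int m + 2 * int r - 2 = 6 * int n + 4 * int 2"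
      by (rule w w'; simp add: r n)+
    then show ?thesis using D[of 1 m] D[of 2 n] half by (metis insertI1 insertI2 order_refl)
  qed
  then obtain a b where ab: "has_dim (modular_forms (6 * int m + 2 * int r)) a" "has_dim (modular_forms (6 * int m + 2 * int r - 2)) b"
      "a + b = m + 1" "b \<ge> n div 2 + 1" by blast
  show "int (fun_space.dim (quasimodular_forms (6 * int m + 2 * int r) 1)) = int m + 1"
    using has_dim_imp_dim[OF has_dim_quasimodular_forms[OF ab(1,2)]] ab(3) by simp
  show "fun_space.dim (modular_forms (6 * int m + 2 * int r - 2)) \<ge> (m - 1) div 2 + 1"
    using has_dim_imp_dim[OF ab(2)] ab(4) n by simp
qed

theorem theorem5p1:
  fixes w a l :: int
  assumes "a \<in> {0, 2, 4}"
    and "[w = a] (mod 6)"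
    and "real_of_int (w - a) / 12 \<le> real_of_int l"
    and "real_of_int l \<le> real_of_int (w - a) / 6"
  shows
    "(a = 0 \<longrightarrow>
       (real_of_int l > real_of_int w / 12 \<longrightarrow>
          (\<forall>f c. q_expansion l c f \<and> c 0 \<noteq> 0 \<and> holomorphic_solution (mde_a0 w l) f \<longrightarrow>
                 balanced_quasimodular w f)) \<and>
       (real_of_int l = real_of_int w / 12 \<longrightarrow>
          fundamental_system (mde_a0 w l)
            (\<lambda>z. modular_discriminant z powi (w div 12))
            (\<lambda>z. z * modular_discriminant z powi (w div 12)))) \<and>
     (a = 2 \<longrightarrow>
       (real_of_int l > real_of_int (w - 2) / 12 \<longrightarrow>
          (\<forall>f c. q_expansion l c f \<and> c 0 \<noteq> 0 \<and> holomorphic_solution (mde_a2 w l) f \<longrightarrow>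
                 balanced_quasimodular w f)) \<and>
       (real_of_int l = real_of_int (w - 2) / 12 \<longrightarrow>
          fundamental_system (mde_a2 w l)
            (\<lambda>z. E2 z * modular_discriminant z powi ((w - 2) div 12))
            (\<lambda>z. z * E2 z * modular_discriminant z powi ((w - 2) div 12)
                 + 6 / (of_real pi * \<i>) * modular_discriminant z powi ((w - 2) div 12)))) \<and>
     (a = 4 \<longrightarrow>
       (real_of_int l > real_of_int (w - 4) / 12 \<longrightarrow>
          (\<forall>f c. q_expansion l c f \<and> c 0 \<noteq> 0 \<and> holomorphic_solution (mde_a4 w l) f \<longrightarrow>
                 balanced_quasimodular w f)) \<and>
       (real_of_int l = real_of_int (w - 4) / 12 \<longrightarrow>
          fundamental_system (mde_a4 w l)
            (\<lambda>z. E4 z * modular_discriminant z powi ((w - 4) div 12))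
            (\<lambda>z. z * E4 z * modular_discriminant z powi ((w - 4) div 12))))"
proof -
  \<comment> \<open>With m = (w - a) / 6 the hypotheses read m / 2 <= l <= m; together they force m
    >= 0, so m can be a natural number.\<close>
  obtain m where m: "w - a = 6 * int m" "int m \<le> 2 * l" "l \<le> int m"
  proof -
    have "6 dvd (w - a)" using assms(2) by (simp add: cong_iff_dvd_diff)
    then obtain t where t: "w - a = 6 * t" by (elim dvdE)
    have "6 * real_of_int t = real_of_int (w - a)" unfolding t by simp
    then have "real_of_int t \<le> 2 * real_of_int l" "real_of_int l \<le> real_of_int t" using assms(3,4) by simp_all
    then have t': "t \<le> 2 * l" "l \<le> t" by linarith+
    show ?thesis by (rule that[of "nat t"]) (use t t' in auto)
  qed
  have l0: "0 \<le> l" using m by linarith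
  have gt: "int m < 2 * l" if "real_of_int l > real_of_int (w - a) / 12"
  proof -
    have "real_of_int (6 * int m) < 12 * real_of_int l" using that unfolding m(1) by simp
    then have "6 * int m < 12 * l" by linarith
    then show ?thesis by simp
  qed
  have eq: "int m = 2 * l" if "real_of_int l = real_of_int (w - a) / 12"
  proof -
    have "real_of_int (6 * int m) = 12 * real_of_int l" using that unfolding m(1) by simp
    then have "6 * int m = 12 * l" by linarith
    then show ?thesis by simp
  qed
  \<comment> \<open>From m < 2 l follows m - l <= (m - 1) / 2, which is the bound needed in weight w
    - 2; together with l <= m it also excludes m = 0.\<close>
  have dim: "int (fun_space.dim (quasimodular_forms w 1)) = int m + 1"
    "int m - l < int (fun_space.dim (modular_forms (w - 2)))" if "int m < 2 * l" "w = 6 * int m + 2 * int r" "r \<in> {0, 1, 2}" for r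
  proof -
    have m1: "m \<ge> 1" using that m(3) by linarith
    show "int (fun_space.dim (quasimodular_forms w 1)) = int m + 1" unfolding that(2) by (rule dim_forms(1)[OF m1 that(3)])
    have "(m - 1) div 2 + 1 \<le> fun_space.dim (modular_forms (w - 2))" unfolding that(2) by (rule dim_forms(2)[OF m1 that(3)])
    moreover have "int m - l < int ((m - 1) div 2 + 1)" using that(1) m1 by linarith
    ultimately show "int m - l < int (fun_space.dim (modular_forms (w - 2)))" by linarith
  qed
  consider "a = 0" | "a = 2" | "a = 4" using assms(1) by auto
  then show ?thesis
  proof cases
    case 1
    then have w: "w = 6 * int m" using m by simp
    have w1: "w - 1 = 6 * int m - 1" by (simp add: w)
    define co where "co = - (complex_of_int ((12 * l - w - 1) * (12 * l - w + 1)) / 144)"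
    interpret M: modular_ode "6 * int m - 1" 0 "\<lambda>_. 1" "\<lambda>_. 0" "\<lambda>z. co * E4 z" "\<lambda>z. E4 z ^ 0 * \<Delta> z ^ m"
      by (rule modular_ode_a0)
    have op: "mde_a0 w l f z = M.operator f z" for f z
      unfolding mde_a0_def M.operator_def iterated_serre_deriv_2 w1 unfolding co_def by simp
    have sol: "holomorphic_solution (mde_a0 w l) f \<longleftrightarrow> M.solution f" for f
      by (rule holomorphic_solution_cong) (rule op)
    obtain G where G: "cusp_rep (int m) G (\<lambda>z. E4 z ^ 0 * \<Delta> z ^ m)" "G 0 \<noteq> 0" using cusp_rep_E4_power_Delta_power by blast
    have "balanced_quasimodular w f" if "real_of_int l > real_of_int (w - a) / 12" "q_expansion l c f" "c 0 \<noteq> 0" "holomorphic_solution (mde_a0 w l) f" for f c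
    proof (rule M.balanced_quasimodular_of_solution[OF _ that(2,3) G l0 m(3) gt[OF that(1)]])
      show "M.solution f" using that(4) by (simp only: sol)
      have w': "w = 6 * int m + 2 * int 0" using w by simp
      show "int (fun_space.dim (quasimodular_forms w 1)) = int m + 1" by (rule dim(1)[OF gt[OF that(1)] w']) simp
      show "int m - l < int (fun_space.dim (modular_forms (w - 2)))" by (rule dim(2)[OF gt[OF that(1)] w']) simp
    qed (simp add: w)
    moreover have "fundamental_system (mde_a0 w l) (\<lambda>z. \<Delta> z powi (w div 12)) (\<lambda>z. z * \<Delta> z powi (w div 12))"
      if "real_of_int l = real_of_int (w - a) / 12"
    proof -
      define n where "n = nat l"
      have ln: "l = int n" "int m = 2 * int n" using l0 eq[OF that] by (simp_all add: n_def)
      \<comment> \<open>In the boundary case w = 12 n, so the integer division in the statement is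
        exact.\<close>
      have wn: "w div 12 = int n" by (simp add: w ln)
      have k: "6 * int m - 1 = - 1 + 12 * int n" by (simp add: ln)
      \<comment> \<open>Here 12 l = w, so the two factors are - 1 and 1.\<close>
      have co: "co = 1 / 144" by (simp add: co_def w ln)
      have "M.solution (\<lambda>z. 1 * \<Delta> z ^ n)"
        by (rule M.solution_times_Delta_power[OF holomorphic_on_const k]) (simp add: serre_deriv_2_const co)
      then have u: "M.solution (\<lambda>z. \<Delta> z powi int n)" by simp
      show ?thesis unfolding wn
      proof (rule M.fundamental_system_slash[OF u])
        show "\<exists>z\<in>uhp. \<Delta> z powi int n \<noteq> 0" using Delta_nonzero by (intro bexI[of _ \<i>]) (auto simp: uhp_def)
        fix z assume z: "z \<in> uhp"
        \<comment> \<open>In weight -1 the constant 1 is sent to z.\<close>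
        show "z * \<Delta> z powi int n = slash (6 * int m - 1) (\<lambda>z. \<Delta> z powi int n) z"
          using slash_times_Delta_power[OF z, of "- 1" n "\<lambda>_. 1"] unfolding k by (simp add: slash_def)
      qed (simp_all add: op Delta_periodic)
    qed
    ultimately show ?thesis using 1 by auto
  next
    case 2
    then have w: "w = 6 * int m + 2" using m by simp
    have w1: "w - 1 = 6 * int m + 1" by (simp add: w)
    define co where "co = - (complex_of_int ((12 * l - w + 1) * (12 * l - w + 3)) / 144)"
    interpret M: modular_ode "6 * int m + 1" 4 E4 "\<lambda>z. 1 / 3 * E6 z" "\<lambda>z. co * E4 z ^ 2" "\<lambda>z. E4 z ^ 1 * \<Delta> z ^ m"
      by (rule modular_ode_a2)
    have op: "mde_a2 w l f z = M.operator f z" for f z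
      unfolding mde_a2_def M.operator_def iterated_serre_deriv_2 w1 unfolding co_def by simp
    have sol: "holomorphic_solution (mde_a2 w l) f \<longleftrightarrow> M.solution f" for f
      by (rule holomorphic_solution_cong) (rule op)
    obtain G where G: "cusp_rep (int m) G (\<lambda>z. E4 z ^ 1 * \<Delta> z ^ m)" "G 0 \<noteq> 0" using cusp_rep_E4_power_Delta_power by blast
    have "balanced_quasimodular w f" if "real_of_int l > real_of_int (w - a) / 12" "q_expansion l c f" "c 0 \<noteq> 0" "holomorphic_solution (mde_a2 w l) f" for f c
    proof (rule M.balanced_quasimodular_of_solution[OF _ that(2,3) G l0 m(3) gt[OF that(1)]])
      show "M.solution f" using that(4) by (simp only: sol)
      have w': "w = 6 * int m + 2 * int 1" using w by simp
      show "int (fun_space.dim (quasimodular_forms w 1)) = int m + 1" by (rule dim(1)[OF gt[OF that(1)] w']) simp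
      show "int m - l < int (fun_space.dim (modular_forms (w - 2)))" by (rule dim(2)[OF gt[OF that(1)] w']) simp
    qed (simp add: w)
    moreover have "fundamental_system (mde_a2 w l) (\<lambda>z. E2 z * \<Delta> z powi ((w - 2) div 12))
       (\<lambda>z. z * E2 z * \<Delta> z powi ((w - 2) div 12) + 6 / (of_real pi * \<i>) * \<Delta> z powi ((w - 2) div 12))"
      if "real_of_int l = real_of_int (w - a) / 12"
    proof -
      define n where "n = nat l"
      have ln: "l = int n" "int m = 2 * int n" using l0 eq[OF that] by (simp_all add: n_def)
      have wn: "(w - 2) div 12 = int n" by (simp add: w ln)
      have k: "6 * int m + 1 = 1 + 12 * int n" by (simp add: ln)
      \<comment> \<open>Here 12 l - w = - 2, so the two factors are again - 1 and 1.\<close>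
      have co: "co = 1 / 144" by (simp add: co_def w ln)
      have "M.solution (\<lambda>z. E2 z * \<Delta> z ^ n)"
        by (rule M.solution_times_Delta_power[OF E_holomorphic(1) k])
           (simp add: serre_deriv_2_E2 serre_deriv_E2 co field_simps power2_eq_square)
      then have u: "M.solution (\<lambda>z. E2 z * \<Delta> z powi int n)" by simp
      show ?thesis unfolding wn
      proof (rule M.fundamental_system_slash[OF u])
        have "\<exists>z\<in>uhp. E2 z \<noteq> 0" by (rule cusp_rep_not_zero[OF cusp_rep_E2]) simp
        then show "\<exists>z\<in>uhp. E2 z * \<Delta> z powi int n \<noteq> 0" using Delta_nonzero by auto
        fix z assume z: "z \<in> uhp"
        have z0: "z \<noteq> 0" using z uhp_nonzero by auto
        \<comment> \<open>The defect of \<open>E2\<close> supplies the second summand of the claimed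
          solution.\<close>
        have "slash 1 E2 z = z * E2 z + 6 / (of_real pi * \<i>)"
          unfolding slash_def E2_transform[OF z] using z0 by (simp add: field_simps power_int_minus power2_eq_square)
        then show "z * E2 z * \<Delta> z powi int n + 6 / (of_real pi * \<i>) * \<Delta> z powi int n = slash (6 * int m + 1) (\<lambda>z. E2 z * \<Delta> z powi int n) z"
          unfolding k power_int_of_nat slash_times_Delta_power[OF z] by (simp only: distrib_right)
      qed (simp_all add: op Delta_periodic E_periodic)
    qed
    ultimately show ?thesis using 2 by auto
  next
    case 3
    then have w: "w = 6 * int m + 4" using m by simp
    have w1: "w - 1 = 6 * int m + 3" by (simp add: w)
    define co where "co = - (complex_of_int ((12 * l - w + 3) * (12 * l - w + 5)) / 144 - 1 / 18)"
    interpret M: modular_ode "6 * int m + 3" 8 "\<lambda>z. E4 z ^ 2" "\<lambda>z. 2 / 3 * E4 z * E6 z" "\<lambda>z. co * E4 z ^ 3 + (- 384) * \<Delta> z" "\<lambda>z. E4 z ^ 2 * \<Delta> z ^ m"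
      by (rule modular_ode_a4)
    have op: "mde_a4 w l f z = M.operator f z" for f z
      unfolding mde_a4_def M.operator_def iterated_serre_deriv_2 w1 unfolding co_def by (simp add: algebra_simps)
    have sol: "holomorphic_solution (mde_a4 w l) f \<longleftrightarrow> M.solution f" for f
      by (rule holomorphic_solution_cong) (rule op)
    obtain G where G: "cusp_rep (int m) G (\<lambda>z. E4 z ^ 2 * \<Delta> z ^ m)" "G 0 \<noteq> 0" using cusp_rep_E4_power_Delta_power by blast
    have "balanced_quasimodular w f" if "real_of_int l > real_of_int (w - a) / 12" "q_expansion l c f" "c 0 \<noteq> 0" "holomorphic_solution (mde_a4 w l) f" for f c
    proof (rule M.balanced_quasimodular_of_solution[OF _ that(2,3) G l0 m(3) gt[OF that(1)]])
      show "M.solution f" using that(4) by (simp only: sol)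
      have w': "w = 6 * int m + 2 * int 2" using w by simp
      show "int (fun_space.dim (quasimodular_forms w 1)) = int m + 1" by (rule dim(1)[OF gt[OF that(1)] w']) simp
      show "int m - l < int (fun_space.dim (modular_forms (w - 2)))" by (rule dim(2)[OF gt[OF that(1)] w']) simp
    qed (simp add: w)
    moreover have "fundamental_system (mde_a4 w l) (\<lambda>z. E4 z * \<Delta> z powi ((w - 4) div 12)) (\<lambda>z. z * E4 z * \<Delta> z powi ((w - 4) div 12))"
      if "real_of_int l = real_of_int (w - a) / 12"
    proof -
      define n where "n = nat l"
      have ln: "l = int n" "int m = 2 * int n" using l0 eq[OF that] by (simp_all add: n_def)
      have wn: "(w - 4) div 12 = int n" by (simp add: w ln)
      have k: "6 * int m + 3 = 3 + 12 * int n" by (simp add: ln)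
      \<comment> \<open>Here 12 l - w = - 4, so \<open>co\<close> is 1/144 + 1/18.\<close>
      have co: "co = 1 / 16" by (simp add: co_def w ln)
      have "M.solution (\<lambda>z. E4 z * \<Delta> z ^ n)"
      proof (rule M.solution_times_Delta_power[OF E_holomorphic(2) k])
        fix z assume z: "z \<in> uhp"
        have five: "3 + 2 = (5::int)" by simp
        \<comment> \<open>The E2 terms cancel. As 384 / 1728 = 2/9, the discriminant term cancels -
          2/9 in the coefficient of E4 E6^2 and 23/144 + 1/16 = 2/9 in that of E4^4.\<close>
        show "E4 z ^ 2 * serre_deriv (3 + 2) (serre_deriv 3 E4) z + 2 / 3 * E4 z * E6 z * serre_deriv 3 E4 z
          + (co * E4 z ^ 3 + (- 384) * \<Delta> z) * E4 z = 0"
          unfolding five serre_deriv_2_E4[OF z] serre_deriv_3_E4[OF z] co modular_discriminant_def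
          by (simp add: field_simps power2_eq_square power3_eq_cube)
      qed
      then have u: "M.solution (\<lambda>z. E4 z * \<Delta> z powi int n)" by simp
      show ?thesis unfolding wn
      proof (rule M.fundamental_system_slash[OF u])
        show "\<exists>z\<in>uhp. E4 z * \<Delta> z powi int n \<noteq> 0" using Delta_nonzero E4_not_zero by auto
        fix z assume z: "z \<in> uhp"
        have z0: "z \<noteq> 0" using z uhp_nonzero by auto
        have "slash 3 E4 z = z * E4 z"
        proof -
          have "z powi (- 3) = inverse (z ^ 3)" by (simp add: power_int_minus)
          moreover have "z ^ 4 = z ^ 3 * z" using power_Suc2[of z 3] by simp
          ultimately show ?thesis unfolding slash_def E4_transform[OF z] using z0 by simp
        qed
        then show "z * E4 z * \<Delta> z powi int n = slash (6 * int m + 3) (\<lambda>z. E4 z * \<Delta> z powi int n) z"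
          unfolding k power_int_of_nat slash_times_Delta_power[OF z] by (simp only:)
      qed (simp_all add: op Delta_periodic E_periodic)
    qed
    ultimately show ?thesis using 3 by auto
  qed
qed

end
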